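(* Let $\mathcal{S}\subset\mathbb{R}^{\ast}$ be a measurable set which is translation congruent to $(0,1]$ and satisfies $\mathcal{S}\subseteq[-1,1]$. Then there is a function $f\in\mathbf{H}_{\mathcal{S}}$ such that the system $\tau(\Lambda)f=\{\tau(\gamma,\eta)f:(\gamma,\eta)\in\Lambda\}$ is a Parseval frame in $\mathbf{H}_{\mathcal{S}}$ and $$\|f\|_{L^{2}(\mathbb{H})}^{2}\leq\frac{2}{3}.$$
   Context: **Heisenberg group.** For $x,y,z\in\mathbb{R}$ put $$M(x,y,z)=\begin{bmatrix}1&x&-y&z\\0&1&0&y\\0&0&1&0\\0&0&0&1\end{bmatrix},\qquad \mathbb{H}=\{M(x,y,z):x,y,z\in\mathbb{R}\}\subset GL(4,\mathbb{R}),$$ a realization of the three-dimensional Heisenberg group, with $M(x,y,z)M(w,v,u)=M(x+w,y+v,z+u+xv)$. It is endowed with the Haar measure $dx\,dy\,dz$ (Lebesgue measure on $\mathbb{R}^3$). **Biregular representation.** $\tau:\mathbb{H}\times\mathbb{H}\to\mathcal{U}(L^2(\mathbb{H}))$ is $\tau(u,v)f=L(u)R(v)f$, where $L(u)f(x)=f(u^{-1}x)$ and $R(v)f(x)=f(xv)$. **Index set.** $\Lambda=\{(M(k_3,k_2,k_1),M(m_3,m_2,0)):k_1,k_2,k_3,m_2,m_3\in\mathbb{Z}\}\subset\mathbb{H}\times\mathbb{H}$. **Plancherel transform.** $\mathbb{R}^{\ast}=\mathbb{R}\setminus\{0\}$. For $\lambda\in\mathbb{R}^{\ast}$, $\pi_\lambda$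 is the irreducible unitary representation of $\mathbb{H}$ on $L^2(\mathbb{R})$ given by $\pi_\lambda(M(x,y,z))\phi(t)=e^{2\pi i\lambda z}e^{-2\pi i\lambda yt}\phi(t-x)$. For $f\in L^1(\mathbb{H})\cap L^2(\mathbb{H})$ the Fourier transform is $\mathcal{F}f(\lambda)=\int_{\mathbb{H}}f(n)\pi_\lambda(n)\,dn$ (weakly defined). It is a Hilbert-Schmidt operator on $L^2(\mathbb{R})$ for almost every $\lambda$, and $\mathcal{F}$ extends to a unitary operator, the Plancherel transform, $$\mathbf{P}:L^2(\mathbb{H})\to\int_{\mathbb{R}^{\ast}}^{\oplus}L^2(\mathbb{R})\otimes L^2(\mathbb{R})\,|\lambda|d\lambda,\qquad \|f\|^2_{L^2(\mathbb{H})}=\int_{\mathbb{R}^{\ast}}\|\mathbf{P}f(\lambda)\|^2_{\mathcal{HS}}\,|\lambda|d\lambda,$$ where $L^2(\mathbb{R})\otimes L^2(\mathbb{R})$ denotes the Hilbert space of Hilbert-Schmidt operators on $L^2(\mathbb{R})$ with norm $\|\cdot\|_{\mathcal{HS}}$ and $d\lambda$ is Lebesgue measure. For measurable $\mathcal{S}\subset\mathbb{R}^{\ast}$, $\mathbf{H}_{\mathcal{S}}=\mathbf{P}^{-1}\left(\int_{\mathcal{S}}^{\oplus}L^2(\mathbb{R})\otimes L^2(\mathbb{R})\,|\lambda|d\lambda\right)$, i.e. the closed $\tau$-invariant subspace of those $f\in L^2(\mathbb{H})$ with $\mathbf{P}f(\lambda)=0$ for a.e. $\lambda\notin\mathcal{S}$.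 **Translation congruence.** Measurable sets $I,J\subset\mathbb{R}$ are translation congruent if there is a bijection $\rho:I\to J$ and an integer-valued (measurable) function $k$ on $I$ with $\rho(\lambda)=\lambda+k(\lambda)$. All sets and functions are measurable and sets are identified when their symmetric difference has Lebesgue measure zero. **Parseval frame.** A countable family $\{f_i\}_{i\in I}$ in a Hilbert space $\mathbf{H}$ is a Parseval frame in $\mathbf{H}$ if $\sum_{i\in I}|\langle h,f_i\rangle|^2=\|h\|^2$ for all $h\in\mathbf{H}$. *)

theory Defs
  imports "HOL-Analysis.Analysis"
begin

section \<open>Square-integrable functions\<close>

text \<open>
  Elements of \<open>L\<^sup>2(M)\<close> are handled through representatives: a vector is a measurable
  square-integrable function, and equality of vectors is equality almost everywhere.
\<close>

definition L2 :: "'a measure \<Rightarrow> ('a \<Rightarrow> complex) set" where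
  "L2 M = {f \<in> borel_measurable M. integrable M (\<lambda>x. (cmod (f x))\<^sup>2)}"

definition L2_inner :: "'a measure \<Rightarrow> ('a \<Rightarrow> complex) \<Rightarrow> ('a \<Rightarrow> complex) \<Rightarrow> complex" where
  "L2_inner M f g = (LINT x|M. f x * cnj (g x))"

definition L2_norm :: "'a measure \<Rightarrow> ('a \<Rightarrow> complex) \<Rightarrow> real" where
  "L2_norm M f = sqrt (LINT x|M. (cmod (f x))\<^sup>2)"

text \<open>\<open>H\<close> is meant to be (the set of representatives of) a closed subspace of \<open>L\<^sup>2(M)\<close>.\<close>

definition parseval_frame ::
    "'a measure \<Rightarrow> ('a \<Rightarrow> complex) set \<Rightarrow> 'i set \<Rightarrow> ('i \<Rightarrow> 'a \<Rightarrow> complex) \<Rightarrow> bool" where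
  "parseval_frame M H I F \<longleftrightarrow>
     countable I \<and> (\<forall>i\<in>I. F i \<in> H) \<and>
     (\<forall>h\<in>H. ((\<lambda>i. (cmod (L2_inner M h (F i)))\<^sup>2) has_sum (L2_norm M h)\<^sup>2) I)"


section \<open>Hilbert--Schmidt operators on \<open>L\<^sup>2(\<real>)\<close>\<close>

type_synonym operator = "(real \<Rightarrow> complex) \<Rightarrow> real \<Rightarrow> complex"

abbreviation L2R :: "(real \<Rightarrow> complex) set" where
  "L2R \<equiv> L2 lborel"

text \<open>
  The values of an operator outside \<^term>\<open>L2R\<close> are irrelevant. Linearity together with
  boundedness implies that almost everywhere equal arguments have almost everywhere equal images.
\<close>

definition bounded_operator :: "operator \<Rightarrow> bool" where
  "bounded_operator T \<longleftrightarrow>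
     (\<forall>\<phi>\<in>L2R. T \<phi> \<in> L2R) \<and>
     (\<forall>\<phi>\<in>L2R. \<forall>\<psi>\<in>L2R. \<forall>a b.
        AE t in lborel. T (\<lambda>s. a * \<phi> s + b * \<psi> s) t = a * T \<phi> t + b * T \<psi> t) \<and>
     (\<exists>C. \<forall>\<phi>\<in>L2R. L2_norm lborel (T \<phi>) \<le> C * L2_norm lborel \<phi>)"

definition zero_operator :: "operator \<Rightarrow> bool" where
  "zero_operator T \<longleftrightarrow> (\<forall>\<phi>\<in>L2R. AE t in lborel. T \<phi> t = 0)"

definition orthonormal_basis :: "(nat \<Rightarrow> real \<Rightarrow> complex) \<Rightarrow> bool" where
  "orthonormal_basis e \<longleftrightarrow>
     (\<forall>n. e n \<in> L2R) \<and>
     (\<forall>m n. L2_inner lborel (e m) (e n) = (if m = n then 1 else 0)) \<and>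
     (\<forall>\<phi>\<in>L2R. (\<forall>n. L2_inner lborel \<phi> (e n) = 0) \<longrightarrow> (AE t in lborel. \<phi> t = 0))"

text \<open>
  The squared Hilbert--Schmidt norm. Its value does not depend on the orthonormal basis used;
  it is infinite exactly if the bounded operator \<open>T\<close> is not Hilbert--Schmidt.
\<close>

definition HS_norm_sq :: "operator \<Rightarrow> ennreal" where
  "HS_norm_sq T =
     (let e = (SOME e. orthonormal_basis e)
      in \<Sum>n. ennreal ((L2_norm lborel (T (e n)))\<^sup>2))"

definition hilbert_schmidt :: "operator \<Rightarrow> bool" where
  "hilbert_schmidt T \<longleftrightarrow> bounded_operator T \<and> HS_norm_sq T < \<infinity>"


section \<open>The Heisenberg group\<close>

definition heis :: "real \<Rightarrow> real \<Rightarrow> real \<Rightarrow> real^4^4" where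
  "heis x y z = vector [
     vector [1, x, - y, z],
     vector [0, 1,   0, y],
     vector [0, 0,   1, 0],
     vector [0, 0,   0, 1]]"

definition heisenberg :: "(real^4^4) set" where
  "heisenberg = {heis x y z | x y z. True}"

definition haar :: "(real^4^4) measure" where
  "haar = distr (lborel :: (real \<times> real \<times> real) measure)
            (restrict_space borel heisenberg) (\<lambda>(x, y, z). heis x y z)"

lemma vector_4':
  "vector [a, b, c, d] $ (1::4) = a" "vector [a, b, c, d] $ (2::4) = b"
  "vector [a, b, c, d] $ (3::4) = c" "vector [a, b, c, d] $ (4::4) = (d::'a::zero)"
  by (simp_all add: vector_def)

lemma heis_mult: "heis x y z ** heis w v u = heis (x + w) (y + v) (z + u + x * v)"
  by (simp add: heis_def matrix_matrix_mult_def vec_eq_iff forall_4 sum_4 vector_4')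

lemma heis_0: "heis 0 0 0 = mat 1"
  by (simp add: heis_def mat_def vec_eq_iff forall_4 vector_4')

lemma heis_inverse: "matrix_inv (heis x y z) = heis (- x) (- y) (x * y - z)"
proof -
  let ?A = "heis x y z" and ?B = "heis (- x) (- y) (x * y - z)"
  have AB: "?A ** ?B = mat 1" and BA: "?B ** ?A = mat 1"
    by (simp_all add: heis_mult heis_0)
  then have "matrix_inv ?A ** ?A = mat 1"
    unfolding matrix_inv_def by (rule someI2[where a = ?B, OF conjI]) auto
  then have "matrix_inv ?A ** (?A ** ?B) = ?B"
    by (simp add: matrix_mul_assoc)
  with AB show ?thesis
    by simp
qed

lemma measurable_heis:
  "(\<lambda>(x, y, z). heis x y z) \<in>
     (lborel :: (real \<times> real \<times> real) measure) \<rightarrow>\<^sub>M restrict_space borel heisenberg"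
proof -
  have "continuous_on UNIV
      (\<lambda>p::real \<times> real \<times> real. \<chi> i j. heis (fst p) (fst (snd p)) (snd (snd p)) $ i $ j)"
  proof (intro continuous_on_vec_lambda)
    fix i j :: 4
    show "continuous_on UNIV
        (\<lambda>p::real \<times> real \<times> real. heis (fst p) (fst (snd p)) (snd (snd p)) $ i $ j)"
      using exhaust_4[of i] exhaust_4[of j]
      by (elim disjE; hypsubst; unfold heis_def vector_4'; intro continuous_intros)
  qed
  then have "continuous_on UNIV
      (\<lambda>p::real \<times> real \<times> real. heis (fst p) (fst (snd p)) (snd (snd p)))"
    by simp
  then have "(\<lambda>p::real \<times> real \<times> real. heis (fst p) (fst (snd p)) (snd (snd p)))
      \<in> borel_measurable borel"
    by (rule borel_measurable_continuous_onI)
  then show ?thesis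
    by (intro measurable_restrict_space2) (auto simp: heisenberg_def split_beta')
qed


section \<open>The biregular representation\<close>

definition left_translation :: "real^4^4 \<Rightarrow> (real^4^4 \<Rightarrow> complex) \<Rightarrow> real^4^4 \<Rightarrow> complex" where
  "left_translation u f = (\<lambda>x. f (matrix_inv u ** x))"

definition right_translation :: "real^4^4 \<Rightarrow> (real^4^4 \<Rightarrow> complex) \<Rightarrow> real^4^4 \<Rightarrow> complex" where
  "right_translation v f = (\<lambda>x. f (x ** v))"

definition biregular ::
    "(real^4^4) \<times> (real^4^4) \<Rightarrow> (real^4^4 \<Rightarrow> complex) \<Rightarrow> real^4^4 \<Rightarrow> complex" where
  "biregular = (\<lambda>(u, v) f. left_translation u (right_translation v f))"

definition index_set :: "((real^4^4) \<times> (real^4^4)) set" where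
  "index_set =
     {(heis (of_int k\<^sub>3) (of_int k\<^sub>2) (of_int k\<^sub>1), heis (of_int m\<^sub>3) (of_int m\<^sub>2) 0)
      | k\<^sub>1 k\<^sub>2 k\<^sub>3 m\<^sub>2 m\<^sub>3 :: int. True}"


section \<open>The Plancherel transform\<close>

text \<open>
  The coordinates of \<open>n = heis x y z\<close> are read off from its entries: \<open>x = n $ 1 $ 2\<close>,
  \<open>y = n $ 2 $ 4\<close> and \<open>z = n $ 1 $ 4\<close>.
\<close>

definition schroedinger_rep :: "real \<Rightarrow> real^4^4 \<Rightarrow> operator" where
  "schroedinger_rep l n \<phi> = (\<lambda>t.
     exp (2 * of_real pi * \<i> * of_real (l * n $ 1 $ 4)) *
     exp (- 2 * of_real pi * \<i> * of_real (l * n $ 2 $ 4 * t)) * \<phi> (t - n $ 1 $ 2))"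

lemma schroedinger_rep_heis:
  "schroedinger_rep l (heis x y z) \<phi> = (\<lambda>t.
     exp (2 * of_real pi * \<i> * of_real (l * z)) *
     exp (- 2 * of_real pi * \<i> * of_real (l * y * t)) * \<phi> (t - x))"
  by (simp add: schroedinger_rep_def heis_def vector_4')

text \<open>
  \<open>A\<close> is the weakly defined operator integral of \<open>f(n) \<pi>\<^sub>l(n)\<close> over the group. This
  determines \<open>A \<phi>\<close> up to almost everywhere equality.
\<close>

definition has_fourier_transform ::
    "(real^4^4 \<Rightarrow> complex) \<Rightarrow> real \<Rightarrow> operator \<Rightarrow> bool" where
  "has_fourier_transform f l A \<longleftrightarrow>
     bounded_operator A \<and>
     (\<forall>\<phi>\<in>L2R. \<forall>\<psi>\<in>L2R.
        L2_inner lborel (A \<phi>) \<psi> =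
        (LINT n|haar. f n * L2_inner lborel (schroedinger_rep l n \<phi>) \<psi>))"

text \<open>
  The direct integral over \<open>\<real> - {0}\<close> of the Hilbert--Schmidt operators on \<open>L\<^sup>2(\<real>)\<close> with
  respect to \<open>\<bar>l\<bar> dl\<close>. The value of a field at \<open>0\<close> is irrelevant.
\<close>

definition field_norm_sq :: "(real \<Rightarrow> operator) \<Rightarrow> ennreal" where
  "field_norm_sq T = (\<integral>\<^sup>+ l. HS_norm_sq (T l) * ennreal \<bar>l\<bar> \<partial>lborel)"

definition HS_direct_integral :: "(real \<Rightarrow> operator) set" where
  "HS_direct_integral =
     {T. (\<forall>l. l \<noteq> 0 \<longrightarrow> hilbert_schmidt (T l)) \<and>
         (\<forall>\<phi>\<in>L2R. \<forall>\<psi>\<in>L2R. (\<lambda>l. L2_inner lborel (T l \<phi>) \<psi>) \<in> borel_measurable lborel) \<and>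
         field_norm_sq T < \<infinity>}"

text \<open>
  The Plancherel transform of \<open>f \<in> L\<^sup>2\<close>, as the continuous extension of the Fourier transform
  from \<open>L\<^sup>1 \<inter> L\<^sup>2\<close>: \<open>T\<close> is the limit of the Fourier transforms \<open>G k\<close> of functions
  \<open>g k \<in> L\<^sup>1 \<inter> L\<^sup>2\<close> that converge to \<open>f\<close>. By the Plancherel theorem, such a \<open>T\<close>
  exists and is unique up to almost everywhere equality.
\<close>

definition has_plancherel_transform ::
    "(real^4^4 \<Rightarrow> complex) \<Rightarrow> (real \<Rightarrow> operator) \<Rightarrow> bool" where
  "has_plancherel_transform f T \<longleftrightarrow>
     f \<in> L2 haar \<and> T \<in> HS_direct_integral \<and>
     (\<exists>g G.
        (\<forall>k. integrable haar (g k) \<and> g k \<in> L2 haar) \<and>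
        (\<forall>k l. l \<noteq> 0 \<longrightarrow> has_fourier_transform (g k) l (G k l)) \<and>
        (\<lambda>k::nat. L2_norm haar (\<lambda>n. g k n - f n)) \<longlonglongrightarrow> 0 \<and>
        (\<lambda>k. field_norm_sq (\<lambda>l \<phi> t. G k l \<phi> t - T l \<phi> t)) \<longlonglongrightarrow> 0)"

definition spectral_subspace :: "real set \<Rightarrow> (real^4^4 \<Rightarrow> complex) set" where
  "spectral_subspace S =
     {f \<in> L2 haar. \<exists>T. has_plancherel_transform f T \<and>
                       (AE l in lborel. l \<notin> S \<longrightarrow> zero_operator (T l))}"


section \<open>Translation congruence\<close>

text \<open>
  Sets are identified if their symmetric difference is a null set, so the bijection is only
  required between suitable representatives of \<open>I\<close> and \<open>J\<close>.
\<close>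

definition translation_congruent :: "real set \<Rightarrow> real set \<Rightarrow> bool" where
  "translation_congruent I J \<longleftrightarrow>
     (\<exists>I' J' (k :: real \<Rightarrow> int).
        I' \<in> sets lebesgue \<and> J' \<in> sets lebesgue \<and>
        sym_diff I I' \<in> null_sets lebesgue \<and> sym_diff J J' \<in> null_sets lebesgue \<and>
        k \<in> measurable (lebesgue_on I') (count_space UNIV) \<and>
        bij_betw (\<lambda>l. l + of_int (k l)) I' J')"

end

theory Submission
  imports Defs
begin

text \<open>
  On the Plancherel side, translating by \<open>(M(k\<^sub>3, k\<^sub>2, k\<^sub>1), M(m\<^sub>3, m\<^sub>2, 0))\<close> multiplies a rank-one
  field \<open>c(l) \<alpha>\<^sub>l \<otimes> \<beta>\<^sub>l\<close> by \<open>exp(2\<pi>i l k\<^sub>1)\<close> and moves \<open>\<alpha>\<^sub>l\<close> and \<open>\<beta>\<^sub>l\<close> through the Gabor lattice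
  \<open>\<int> \<times> l\<int>\<close>. For \<open>\<bar>l\<bar> \<le> 1\<close> the indicator function of the unit interval generates a tight Gabor
  frame with bound \<open>1 / \<bar>l\<bar>\<close>, and since \<open>S\<close> is packed modulo the integers, the exponentials in \<open>l\<close>
  form a Parseval system on \<open>S\<close>. So \<open>\<alpha>\<^sub>l = \<beta>\<^sub>l = 1\<^bsub>[0,1)\<^esub>\<close> and \<open>c(l) = \<bar>l\<bar>\<^bsup>1/2\<^esup> 1\<^sub>S(l)\<close> give a Parseval
  frame, and the squared norm of its generator is the integral of \<open>l\<^sup>2\<close> over \<open>S \<subseteq> [-1, 1]\<close>.
\<close>

section \<open>Square-integrable functions\<close>

text \<open>The exponent 1/2 in c(l) is forced. A coefficient of h against a translate is an
  integral in l with density |l| c(l). Squaring and summing over both Gabor lattices leaves (|l|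
  c(l))^2 / l^2 = c(l)^2 times the squared Hilbert-Schmidt norm at l, and this factor must be the
  Plancherel density |l|. The obstacle is that a Plancherel transform is given only as a limit of
  Fourier transforms of functions in both L1 and L2. So the generator is written down by the
  inversion formula (\<open>packet\<close>), and its transform is found through truncations g of it.
  By Fubini, g pairs with the packet as its Fourier transform pairs with the rank-one field; hence
  the squared distance between that transform and the field is exactly the squared norm of the
  packet minus that of g, and this tends to 0. A vector of the spectral subspace comes with an
  unspecified transform \<open>T\<close>, so the isometry and the pairing formula are proved for
  every \<open>T\<close> with \<open>has_plancherel_transform h T\<close>.\<close>

lemma borel_measurable_cnj [measurable (raw)]:
  "f \<in> borel_measurable M \<Longrightarrow> (\<lambda>x. cnj (f x)) \<in> borel_measurable M"
  by (rule borel_measurable_continuous_on[where f=cnj]) (auto intro: continuous_intros)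

lemma L2_measurable: "f \<in> L2 M \<Longrightarrow> f \<in> borel_measurable M"
  by (simp add: L2_def)

lemma L2_sq_integrable: "f \<in> L2 M \<Longrightarrow> integrable M (\<lambda>x. (cmod (f x))\<^sup>2)"
  by (simp add: L2_def)

lemma L2_norm_nonneg [simp]: "0 \<le> L2_norm M f"
  by (simp add: L2_norm_def)

lemma L2_norm_sq: "(L2_norm M f)\<^sup>2 = (LINT x|M. (cmod (f x))\<^sup>2)"
  by (simp add: L2_norm_def)

lemma L2_norm_sq_nn:
  assumes "f \<in> L2 M"
  shows "ennreal ((L2_norm M f)\<^sup>2) = (\<integral>\<^sup>+x. ennreal ((cmod (f x))\<^sup>2) \<partial>M)"
  unfolding L2_norm_sq using L2_sq_integrable[OF assms]
  by (subst nn_integral_eq_integral) auto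

lemma L2I_nn:
  assumes "f \<in> borel_measurable M" "(\<integral>\<^sup>+x. ennreal ((cmod (f x))\<^sup>2) \<partial>M) < \<infinity>"
  shows "f \<in> L2 M"
  using assms unfolding L2_def by (auto intro!: integrableI_nonneg)

lemma L2_nn_finite: "f \<in> L2 M \<Longrightarrow> (\<integral>\<^sup>+x. ennreal ((cmod (f x))\<^sup>2) \<partial>M) < \<infinity>"
  by (simp flip: L2_norm_sq_nn)

lemma cmod_add_sq_le: "(cmod (a + b))\<^sup>2 \<le> 2 * (cmod a)\<^sup>2 + 2 * (cmod b)\<^sup>2"
proof -
  have "(cmod (a + b))\<^sup>2 \<le> (cmod a + cmod b)\<^sup>2"
    by (intro power_mono norm_triangle_ineq) auto
  also have "\<dots> \<le> 2 * (cmod a)\<^sup>2 + 2 * (cmod b)\<^sup>2"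
    using zero_le_power2[of "cmod a - cmod b"] by (simp add: power2_eq_square algebra_simps)
  finally show ?thesis .
qed

lemma L2_add:
  assumes "f \<in> L2 M" "g \<in> L2 M"
  shows "(\<lambda>x. f x + g x) \<in> L2 M"
proof -
  have [measurable]: "f \<in> borel_measurable M" "g \<in> borel_measurable M"
    using assms by (auto simp: L2_def)
  have "integrable M (\<lambda>x. 2 * (cmod (f x))\<^sup>2 + 2 * (cmod (g x))\<^sup>2)"
    using assms by (auto simp: L2_def)
  then have "integrable M (\<lambda>x. (cmod (f x + g x))\<^sup>2)"
    by (rule Bochner_Integration.integrable_bound) (auto simp: cmod_add_sq_le)
  then show ?thesis by (simp add: L2_def)
qed

lemma L2_scale: "f \<in> L2 M \<Longrightarrow> (\<lambda>x. c * f x) \<in> L2 M"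
  by (auto simp: L2_def norm_mult power_mult_distrib)

lemma L2_zero: "(\<lambda>x. 0) \<in> L2 M"
  by (auto simp: L2_def)

lemma L2_diff: "f \<in> L2 M \<Longrightarrow> g \<in> L2 M \<Longrightarrow> (\<lambda>x. f x - g x) \<in> L2 M"
  using L2_add[of f M "\<lambda>x. (-1) * g x"] L2_scale[of g M "-1"] by simp

lemma L2_sum: "(\<And>i. i \<in> I \<Longrightarrow> f i \<in> L2 M) \<Longrightarrow> (\<lambda>x. \<Sum>i\<in>I. f i x) \<in> L2 M"
  by (induction I rule: infinite_finite_induct) (auto intro!: L2_add L2_zero)

lemma L2_inner_integrable:
  assumes "f \<in> L2 M" "g \<in> L2 M"
  shows "integrable M (\<lambda>x. f x * cnj (g x))"
proof -
  have [measurable]: "f \<in> borel_measurable M" "g \<in> borel_measurable M"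
    using assms by (auto simp: L2_def)
  have "integrable M (\<lambda>x. (cmod (f x))\<^sup>2 + (cmod (g x))\<^sup>2)"
    using assms by (auto simp: L2_def)
  then show ?thesis
  proof (rule Bochner_Integration.integrable_bound)
    have "cmod a * cmod b \<le> (cmod a)\<^sup>2 + (cmod b)\<^sup>2" for a b
    proof -
      have "2 * (cmod a * cmod b) \<le> (cmod a)\<^sup>2 + (cmod b)\<^sup>2" "0 \<le> cmod a * cmod b"
        using sum_squares_bound[of "cmod a" "cmod b"] by (simp_all add: mult.assoc)
      then show ?thesis by linarith
    qed
    then show "AE x in M. norm (f x * cnj (g x)) \<le> norm ((cmod (f x))\<^sup>2 + (cmod (g x))\<^sup>2)"
      by (auto simp: norm_mult)
  qed measurable
qed

lemma L2_mult_integrable: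
  assumes "f \<in> L2 M" "g \<in> L2 M"
  shows "integrable M (\<lambda>x. cmod (f x) * cmod (g x))"
  using integrable_norm[OF L2_inner_integrable[OF assms]] by (simp add: norm_mult)

lemma L2_inner_cnj: "L2_inner M g f = cnj (L2_inner M f g)"
  unfolding L2_inner_def by (simp add: mult.commute flip: Bochner_Integration.integral_cnj)

lemma L2_inner_add_left:
  "\<lbrakk>f \<in> L2 M; g \<in> L2 M; h \<in> L2 M\<rbrakk> \<Longrightarrow>
    L2_inner M (\<lambda>x. f x + g x) h = L2_inner M f h + L2_inner M g h"
  unfolding L2_inner_def distrib_right
  by (intro Bochner_Integration.integral_add L2_inner_integrable)

lemma L2_inner_diff_left:
  "\<lbrakk>f \<in> L2 M; g \<in> L2 M; h \<in> L2 M\<rbrakk> \<Longrightarrow>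
    L2_inner M (\<lambda>x. f x - g x) h = L2_inner M f h - L2_inner M g h"
  unfolding L2_inner_def left_diff_distrib
  by (intro Bochner_Integration.integral_diff L2_inner_integrable)

lemma L2_inner_scale_left: "L2_inner M (\<lambda>x. c * f x) h = c * L2_inner M f h"
  unfolding L2_inner_def by (simp add: mult.assoc)

lemma L2_inner_scale_right: "L2_inner M f (\<lambda>x. c * g x) = cnj c * L2_inner M f g"
  unfolding L2_inner_def by (simp add: mult.left_commute)

lemma L2_inner_add_right:
  "\<lbrakk>f \<in> L2 M; g \<in> L2 M; h \<in> L2 M\<rbrakk> \<Longrightarrow>
    L2_inner M h (\<lambda>x. f x + g x) = L2_inner M h f + L2_inner M h g"
  by (simp add: L2_inner_cnj[of _ h] L2_inner_add_left)

lemma L2_inner_zero_left [simp]: "L2_inner M (\<lambda>x. 0) h = 0"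
  by (simp add: L2_inner_def)

lemma L2_inner_sum_left:
  assumes "\<And>i. i \<in> I \<Longrightarrow> f i \<in> L2 M" "h \<in> L2 M"
  shows "L2_inner M (\<lambda>x. \<Sum>i\<in>I. f i x) h = (\<Sum>i\<in>I. L2_inner M (f i) h)"
  using assms(1)
  by (induction I rule: infinite_finite_induct) (auto simp: L2_inner_add_left L2_sum assms(2))

lemma L2_inner_self: "L2_inner M f f = of_real ((L2_norm M f)\<^sup>2)"
  unfolding L2_inner_def L2_norm_sq
  by (simp only: complex_norm_square[symmetric] integral_complex_of_real)

lemma L2_norm_add_sq:
  assumes "f \<in> L2 M" "g \<in> L2 M"
  shows "(L2_norm M (\<lambda>x. f x + g x))\<^sup>2 =
    (L2_norm M f)\<^sup>2 + 2 * Re (L2_inner M f g) + (L2_norm M g)\<^sup>2"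
proof -
  have "complex_of_real ((L2_norm M (\<lambda>x. f x + g x))\<^sup>2) =
    L2_inner M f f + L2_inner M f g + cnj (L2_inner M f g) + L2_inner M g g"
    unfolding L2_inner_self[symmetric] using assms
    by (simp add: L2_inner_add_left L2_inner_add_right L2_add L2_inner_cnj[of M g f] add_ac)
  then have "Re (complex_of_real ((L2_norm M (\<lambda>x. f x + g x))\<^sup>2)) =
    Re (L2_inner M f f + L2_inner M f g + cnj (L2_inner M f g) + L2_inner M g g)" by simp
  then show ?thesis by (simp add: L2_inner_self)
qed

lemma L2_norm_scale: "L2_norm M (\<lambda>x. c * f x) = cmod c * L2_norm M f"
  unfolding L2_norm_def by (simp add: norm_mult power_mult_distrib real_sqrt_mult)

lemma L2_norm_diff_sq:
  assumes "f \<in> L2 M" "g \<in> L2 M"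
  shows "(L2_norm M (\<lambda>x. f x - g x))\<^sup>2 =
    (L2_norm M f)\<^sup>2 - 2 * Re (L2_inner M f g) + (L2_norm M g)\<^sup>2"
  using L2_norm_add_sq[OF assms(1) L2_scale[OF assms(2), of "-1"]] 
    L2_norm_scale[of M "-1" g] L2_inner_scale_right[of M f "-1" g] by simp

lemma L2_norm_minus: "L2_norm M (\<lambda>x. f x - g x) = L2_norm M (\<lambda>x. g x - f x)"
  unfolding L2_norm_def by (simp add: norm_minus_commute)

lemma L2_norm_eq_0_iff:
  assumes "f \<in> L2 M" shows "L2_norm M f = 0 \<longleftrightarrow> (AE x in M. f x = 0)"
proof -
  have "L2_norm M f = 0 \<longleftrightarrow> (LINT x|M. (cmod (f x))\<^sup>2) = 0"
    by (simp add: L2_norm_def)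
  also have "\<dots> \<longleftrightarrow> (AE x in M. f x = 0)"
    by (subst integral_nonneg_eq_0_iff_AE) (auto simp: L2_sq_integrable[OF assms])
  finally show ?thesis .
qed

lemma L2_norm_cong_AE:
  assumes "f \<in> borel_measurable M" "g \<in> borel_measurable M" "AE x in M. f x = g x"
  shows "L2_norm M f = L2_norm M g"
  unfolding L2_norm_def using assms by (intro arg_cong[where f=sqrt] integral_cong_AE) auto

lemma L2_inner_cong_AE:
  assumes "f \<in> borel_measurable M" "f' \<in> borel_measurable M" "g \<in> borel_measurable M"
    "AE x in M. f x = f' x"
  shows "L2_inner M f g = L2_inner M f' g"
proof -
  note assms(1-3)[measurable]
  show ?thesis
    unfolding L2_inner_def by (intro integral_cong_AE) (measurable, use assms(4) in auto)
qed

text \<open>The moduli F and G have a real inner product I, so the squared norm of a F - b G is a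
  quadratic form in a, b that is never negative. The version with moduli inside the integral also
  supplies the majorants for Fubini later on.\<close>

lemma L2_Cauchy_Schwarz_norms:
  assumes "f \<in> L2 M" "g \<in> L2 M"
  shows "(LINT x|M. cmod (f x) * cmod (g x)) \<le> L2_norm M f * L2_norm M g"
proof -
  define F G where "F = (\<lambda>x. complex_of_real (cmod (f x)))" and "G = (\<lambda>x. complex_of_real (cmod (g x)))"
  have FG: "F \<in> L2 M" "G \<in> L2 M"
    using assms by (auto simp: L2_def F_def G_def)
  have nrm: "L2_norm M F = L2_norm M f" "L2_norm M G = L2_norm M g"
    by (auto simp: L2_norm_def F_def G_def)
  define I where "I = (LINT x|M. cmod (f x) * cmod (g x))"
  have I: "L2_inner M F G = of_real I"
    unfolding L2_inner_def I_def F_def G_def by (simp flip: integral_complex_of_real)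
  define t u where "t = L2_norm M f" and "u = L2_norm M g"
  have key: "2 * a * b * I \<le> a\<^sup>2 * t\<^sup>2 + b\<^sup>2 * u\<^sup>2" for a b :: real
  proof -
    have "0 \<le> (L2_norm M (\<lambda>x. of_real a * F x - of_real b * G x))\<^sup>2" by simp
    also have "\<dots> = a\<^sup>2 * t\<^sup>2 - 2 * a * b * I + b\<^sup>2 * u\<^sup>2"
      by (subst L2_norm_diff_sq)
        (auto intro!: L2_scale FG simp: L2_norm_scale L2_inner_scale_left L2_inner_scale_right
          nrm I power_mult_distrib t_def u_def)
    finally show ?thesis by simp
  qed
  have tu: "t \<ge> 0" "u \<ge> 0" by (auto simp: t_def u_def)
  have "I \<le> t * u"
  proof (cases "t = 0 \<or> u = 0")
    case False
    then have pos: "t > 0" "u > 0" using tu by auto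
    \<comment> \<open>The choice a = u, b = t turns both squares into (u t)^2, so a factor u t
      cancels.\<close>
    have "2 * u * t * I \<le> 2 * (u * t) * (u * t)" using key[of u t] by (simp add: power2_eq_square algebra_simps)
    then show ?thesis using pos by (simp add: mult.commute)
  next
    case True
    then have "AE x in M. cmod (f x) * cmod (g x) = 0"
      using L2_norm_eq_0_iff[OF assms(1)] L2_norm_eq_0_iff[OF assms(2)] by (auto simp: t_def u_def)
    then have "I = 0" unfolding I_def by (rule integral_eq_zero_AE)
    then show ?thesis using tu by simp
  qed
  then show ?thesis by (simp add: I_def t_def u_def)
qed

lemma L2_Cauchy_Schwarz:
  assumes "f \<in> L2 M" "g \<in> L2 M"
  shows "cmod (L2_inner M f g) \<le> L2_norm M f * L2_norm M g"
proof -
  have "cmod (L2_inner M f g) \<le> (LINT x|M. cmod (f x * cnj (g x)))"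
    unfolding L2_inner_def by (rule integral_norm_bound)
  also have "\<dots> = (LINT x|M. cmod (f x) * cmod (g x))" by (simp add: norm_mult)
  finally show ?thesis using L2_Cauchy_Schwarz_norms[OF assms] by linarith
qed

lemma L2_triangle:
  assumes "f \<in> L2 M" "g \<in> L2 M"
  shows "L2_norm M (\<lambda>x. f x + g x) \<le> L2_norm M f + L2_norm M g"
proof (rule power2_le_imp_le)
  have "Re (L2_inner M f g) \<le> L2_norm M f * L2_norm M g"
    using L2_Cauchy_Schwarz[OF assms] complex_Re_le_cmod order_trans by blast
  then show "(L2_norm M (\<lambda>x. f x + g x))\<^sup>2 \<le> (L2_norm M f + L2_norm M g)\<^sup>2"
    unfolding L2_norm_add_sq[OF assms] by (simp add: power2_sum)
qed simp

lemma L2_norm_diff_le: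
  assumes "f \<in> L2 M" "g \<in> L2 M"
  shows "\<bar>L2_norm M f - L2_norm M g\<bar> \<le> L2_norm M (\<lambda>x. f x - g x)"
  using L2_triangle[OF L2_diff[OF assms] assms(2)]
    L2_triangle[OF L2_diff[OF assms(2) assms(1)] assms(1)]
  by (simp add: L2_norm_minus[of M g f])

lemma L2_norm_tendsto:
  assumes "\<And>n. f n \<in> L2 M" "g \<in> L2 M" "(\<lambda>n. L2_norm M (\<lambda>x. f n x - g x)) \<longlonglongrightarrow> 0"
  shows "(\<lambda>n. L2_norm M (f n)) \<longlonglongrightarrow> L2_norm M g"
proof (rule LIM_zero_cancel, rule Lim_null_comparison[OF _ assms(3)])
  show "\<forall>\<^sub>F n in sequentially. norm (L2_norm M (f n) - L2_norm M g) \<le> L2_norm M (\<lambda>x. f n x - g x)"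
    using L2_norm_diff_le[OF assms(1,2)] by simp
qed

lemma L2_inner_tendsto_left:
  assumes "\<And>n. f n \<in> L2 M" "g \<in> L2 M" "h \<in> L2 M" "(\<lambda>n. L2_norm M (\<lambda>x. f n x - g x)) \<longlonglongrightarrow> 0"
  shows "(\<lambda>n. L2_inner M (f n) h) \<longlonglongrightarrow> L2_inner M g h"
proof (rule LIM_zero_cancel, rule Lim_null_comparison)
  show "\<forall>\<^sub>F n in sequentially. norm (L2_inner M (f n) h - L2_inner M g h)
      \<le> L2_norm M (\<lambda>x. f n x - g x) * L2_norm M h"
    using L2_Cauchy_Schwarz[OF L2_diff[OF assms(1,2)] assms(3)] assms
    by (simp add: L2_inner_diff_left)
  show "(\<lambda>n. L2_norm M (\<lambda>x. f n x - g x) * L2_norm M h) \<longlonglongrightarrow> 0"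
    using tendsto_mult_left_zero[OF assms(4)] .
qed

text \<open>Rapidly converging sequences converge almost everywhere by the weighted Cauchy--Schwarz
  inequality, and Fatou's lemma identifies the pointwise limit as the limit in the mean.\<close>

lemma summable_of_weighted_sq:
  fixes a :: "nat \<Rightarrow> real"
  assumes "\<And>n. a n \<ge> 0" and s: "summable (\<lambda>n. 2 ^ n * (a n)\<^sup>2)"
  shows "summable a"
proof (rule summable_comparison_test_ev)
  have "a n \<le> (1/2)^n + 2^n * (a n)\<^sup>2" for n
  proof -
    define p :: real where "p = 2 ^ n"
    have p: "p > 0" by (simp add: p_def)
    \<comment> \<open>Expanding gives p a <= 1 + (p a)^2; division by p = 2^n leaves a geometric
      term plus the weighted square.\<close>
    have "0 \<le> (1 - p * a n)\<^sup>2 + p * a n"  using assms(1)[of n] p by simp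
    then have "a n * p \<le> 1 + (p * a n)\<^sup>2" by (simp add: power2_eq_square algebra_simps)
    then have "a n \<le> (1 + (p * a n)\<^sup>2) / p" using p by (simp add: pos_le_divide_eq)
    also have "\<dots> = 1 / p + p * (a n)\<^sup>2" using p by (simp add: power2_eq_square field_simps)
    finally show ?thesis by (simp add: p_def power_one_over)
  qed
  then show "\<forall>\<^sub>F n in sequentially. norm (a n) \<le> (1/2)^n + 2^n * (a n)\<^sup>2"
    using assms(1) by auto
  show "summable (\<lambda>n. (1/2)^n + 2^n * (a n)\<^sup>2)"
    using s by (intro summable_add) auto
qed

lemma L2_complete_rapid:
  assumes u: "\<And>n. u n \<in> L2 M" and d: "\<And>n. L2_norm M (\<lambda>x. u (Suc n) x - u n x) \<le> (1/2)^n"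
  obtains w where "w \<in> L2 M" "(\<lambda>n. L2_norm M (\<lambda>x. u n x - w x)) \<longlonglongrightarrow> 0"
proof -
  have [measurable]: "u n \<in> borel_measurable M" for n using u by (auto simp: L2_def)
  define a where "a n x = cmod (u (Suc n) x - u n x)" for n x
  have [measurable]: "a n \<in> borel_measurable M" for n unfolding a_def by measurable
  have "(\<integral>\<^sup>+x. (\<Sum>n. ennreal (2^n * (a n x)\<^sup>2)) \<partial>M) = (\<Sum>n. \<integral>\<^sup>+x. ennreal (2^n * (a n x)\<^sup>2) \<partial>M)"
    by (rule nn_integral_suminf) simp
  also have "\<dots> \<le> (\<Sum>n. ennreal ((1/2)^n))"
  proof (rule suminf_le)
    fix n
    have "(\<integral>\<^sup>+x. ennreal (2^n * (a n x)\<^sup>2) \<partial>M) = ennreal (2^n) * (\<integral>\<^sup>+x. ennreal ((a n x)\<^sup>2) \<partial>M)"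
      by (simp add: ennreal_mult nn_integral_cmult)
    also have "\<dots> = ennreal (2^n * (L2_norm M (\<lambda>x. u (Suc n) x - u n x))\<^sup>2)"
      unfolding a_def by (subst L2_norm_sq_nn[symmetric]) (auto intro!: L2_diff u simp: ennreal_mult)
    also have "\<dots> \<le> ennreal (2^n * ((1/2)^n)\<^sup>2)"
      using d[of n] by (intro ennreal_leI mult_left_mono power_mono) auto
    also have "2^n * ((1/2)^n)\<^sup>2 = ((1/2)^n :: real)"
      by (simp add: power2_eq_square power_one_over)
    finally show "(\<integral>\<^sup>+x. ennreal (2^n * (a n x)\<^sup>2) \<partial>M) \<le> ennreal ((1/2)^n)" .
  qed auto
  also have "\<dots> < \<infinity>"
    by (subst suminf_ennreal2) auto
  finally have "AE x in M. (\<Sum>n. ennreal (2^n * (a n x)\<^sup>2)) \<noteq> \<infinity>"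
    by (intro nn_integral_PInf_AE) auto
  then have conv: "AE x in M. convergent (\<lambda>n. u n x)"
  proof (rule eventually_mono)
    fix x assume fin: "(\<Sum>n. ennreal (2^n * (a n x)\<^sup>2)) \<noteq> \<infinity>"
    have "summable (\<lambda>n. 2^n * (a n x)\<^sup>2)"
      by (rule summable_suminf_not_top) (use fin in auto)
    then have "summable (\<lambda>n. a n x)"
      by (rule summable_of_weighted_sq[rotated]) (simp add: a_def)
    then have "summable (\<lambda>n. norm (u (Suc n) x - u n x))"
      by (simp add: a_def)
    then have "summable (\<lambda>n. u (Suc n) x - u n x)"
      by (rule summable_norm_cancel)
    then have "convergent (\<lambda>n. \<Sum>k<n. (u (Suc k) x - u k x))"
      by (simp add: summable_iff_convergent)
    then have "convergent (\<lambda>n. (u n x - u 0 x))"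
      by (simp only: sum_lessThan_telescope[of "\<lambda>n. u n x"])
    then have "convergent (\<lambda>n. (u n x - u 0 x) + u 0 x)"
      by (rule convergent_add) (rule convergent_const)
    then show "convergent (\<lambda>n. u n x)" by simp
  qed
  \<comment> \<open>On the null set where the sequence diverges, \<open>lim\<close> is a default
    value, which does not affect measurability.\<close>
  define w where "w x = lim (\<lambda>n. u n x)" for x
  have [measurable]: "w \<in> borel_measurable M" unfolding w_def by measurable
  have lim: "AE x in M. (\<lambda>n. u n x) \<longlonglongrightarrow> w x"
    using conv by eventually_elim (simp add: w_def convergent_LIMSEQ_iff)
  \<comment> \<open>The right-hand side is the exact geometric sum of (1/2)^i for n <= i < n + k,
    which lets the induction on k close.\<close>
  have tail: "L2_norm M (\<lambda>x. u (n + k) x - u n x) \<le> 2 * (1/2)^n - 2 * (1/2)^(n+k)" for n k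
  proof (induction k)
    case 0 then show ?case by (simp add: L2_norm_def)
  next
    case (Suc k)
    have "L2_norm M (\<lambda>x. u (n + Suc k) x - u n x) =
      L2_norm M (\<lambda>x. (u (Suc (n + k)) x - u (n+k) x) + (u (n+k) x - u n x))" by simp
    also have "\<dots> \<le> (1/2)^(n+k) + (2 * (1/2)^n - 2 * (1/2)^(n+k))"
      by (rule order_trans[OF L2_triangle[OF L2_diff[OF u u] L2_diff[OF u u]] add_mono[OF d Suc]])
    finally show ?case by simp
  qed
  have bound: "(\<integral>\<^sup>+x. ennreal ((cmod (u n x - w x))\<^sup>2) \<partial>M) \<le> ennreal ((2 * (1/2)^n)\<^sup>2)" for n
  proof -
    have "(\<integral>\<^sup>+x. ennreal ((cmod (u n x - w x))\<^sup>2) \<partial>M)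
      = (\<integral>\<^sup>+x. liminf (\<lambda>k. ennreal ((cmod (u n x - u k x))\<^sup>2)) \<partial>M)"
    proof (rule nn_integral_cong_AE, use lim in eventually_elim)
      fix x assume "(\<lambda>n. u n x) \<longlonglongrightarrow> w x"
      then have "(\<lambda>k. ennreal ((cmod (u n x - u k x))\<^sup>2)) \<longlonglongrightarrow> ennreal ((cmod (u n x - w x))\<^sup>2)"
        by (intro tendsto_intros)
      from lim_imp_Liminf[OF _ this]
      show "ennreal ((cmod (u n x - w x))\<^sup>2) = liminf (\<lambda>k. ennreal ((cmod (u n x - u k x))\<^sup>2))" by simp
    qed
    also have "\<dots> \<le> liminf (\<lambda>k. \<integral>\<^sup>+x. ennreal ((cmod (u n x - u k x))\<^sup>2) \<partial>M)"
      by (rule nn_integral_liminf) simp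
    also have "\<dots> = liminf (\<lambda>k. ennreal ((L2_norm M (\<lambda>x. u k x - u n x))\<^sup>2))"
      by (subst L2_norm_sq_nn) (auto intro!: L2_diff u simp: norm_minus_commute)
    also have "\<dots> \<le> ennreal ((2 * (1/2)^n)\<^sup>2)"
    proof (rule order_trans[OF Liminf_le_Limsup], simp, rule Limsup_bounded)
      show "\<forall>\<^sub>F k in sequentially. ennreal ((L2_norm M (\<lambda>x. u k x - u n x))\<^sup>2) \<le> ennreal ((2 * (1/2)^n)\<^sup>2)"
      proof (rule eventually_sequentiallyI[of n])
        fix k assume "n \<le> k"
        then obtain j where k: "k = n + j" using le_Suc_ex by blast
        have "L2_norm M (\<lambda>x. u k x - u n x) \<le> 2 * (1/2)^n"
          using tail[of n j] unfolding k by (smt (verit) zero_le_power half_gt_zero_iff zero_le_divide_1_iff)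
        then show "ennreal ((L2_norm M (\<lambda>x. u k x - u n x))\<^sup>2) \<le> ennreal ((2 * (1/2)^n)\<^sup>2)"
          by (intro ennreal_leI power_mono) auto
      qed
    qed
    finally show ?thesis .
  qed
  have diff: "(\<lambda>x. u n x - w x) \<in> L2 M" for n
    by (rule L2I_nn) (auto intro: le_less_trans[OF bound])
  have w: "w \<in> L2 M"
    using L2_diff[OF u[of 0] diff[of 0]] by simp
  have le: "L2_norm M (\<lambda>x. u n x - w x) \<le> 2 * (1/2)^n" for n
  proof -
    have "ennreal ((L2_norm M (\<lambda>x. u n x - w x))\<^sup>2) \<le> ennreal ((2 * (1/2)^n)\<^sup>2)"
      using bound[of n] by (simp add: L2_norm_sq_nn[OF diff])
    then have "(L2_norm M (\<lambda>x. u n x - w x))\<^sup>2 \<le> (2 * (1/2)^n)\<^sup>2"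
      by (subst (asm) ennreal_le_iff) auto
    then show ?thesis by (rule power2_le_imp_le) auto
  qed
  have "(\<lambda>n. L2_norm M (\<lambda>x. u n x - w x)) \<longlonglongrightarrow> 0"
  proof (rule Lim_null_comparison)
    show "\<forall>\<^sub>F n in sequentially. norm (L2_norm M (\<lambda>x. u n x - w x)) \<le> 2 * (1/2)^n" using le by auto
    show "(\<lambda>n. 2 * (1/2)^n :: real) \<longlonglongrightarrow> 0"
      using tendsto_mult_right_zero[OF LIMSEQ_power_zero[of "1/2::real"]] by simp
  qed
  with w show thesis by (rule that)
qed

section \<open>Bessel's identity, the Riesz-Fischer theorem and Parseval's identity\<close>

definition orthonormal_seq :: "'a measure \<Rightarrow> (nat \<Rightarrow> 'a \<Rightarrow> complex) \<Rightarrow> bool" where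
  "orthonormal_seq M e \<longleftrightarrow> (\<forall>n. e n \<in> L2 M) \<and>
     (\<forall>m n. L2_inner M (e m) (e n) = (if m = n then 1 else 0))"

lemma orthonormal_seqD:
  assumes "orthonormal_seq M e"
  shows "e n \<in> L2 M" "L2_inner M (e m) (e n) = (if m = n then 1 else 0)"
  using assms by (auto simp: orthonormal_seq_def)

lemma orthonormal_sum_norm:
  assumes e: "orthonormal_seq M e" and I: "finite I"
  shows "(L2_norm M (\<lambda>x. \<Sum>i\<in>I. c i * e i x))\<^sup>2 = (\<Sum>i\<in>I. (cmod (c i))\<^sup>2)"
  using I
proof (induction I)
  case empty
  then show ?case by (simp add: L2_norm_def)
next
  case (insert j I)
  have L: "(\<lambda>x. \<Sum>i\<in>I. c i * e i x) \<in> L2 M" "(\<lambda>x. c j * e j x) \<in> L2 M"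
    by (intro L2_sum L2_scale orthonormal_seqD[OF e])+
  have "L2_inner M (\<lambda>x. \<Sum>i\<in>I. c i * e i x) (\<lambda>x. c j * e j x)
      = (\<Sum>i\<in>I. L2_inner M (\<lambda>x. c i * e i x) (\<lambda>x. c j * e j x))"
    by (intro L2_inner_sum_left L2_scale orthonormal_seqD[OF e])
  also have "\<dots> = 0"
    using insert.hyps by (intro sum.neutral)
      (auto simp: L2_inner_scale_left L2_inner_scale_right orthonormal_seqD[OF e])
  finally have z: "L2_inner M (\<lambda>x. \<Sum>i\<in>I. c i * e i x) (\<lambda>x. c j * e j x) = 0" .
  have n1: "(L2_norm M (e j))\<^sup>2 = 1"
    using L2_inner_self[of M "e j"] orthonormal_seqD(2)[OF e, of j j]
    by (metis of_real_eq_1_iff)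
  have "(L2_norm M (\<lambda>x. \<Sum>i\<in>insert j I. c i * e i x))\<^sup>2
      = (L2_norm M (\<lambda>x. (\<Sum>i\<in>I. c i * e i x) + c j * e j x))\<^sup>2"
    using insert.hyps by (simp add: add.commute)
  also have "\<dots> = (\<Sum>i\<in>insert j I. (cmod (c i))\<^sup>2)"
    unfolding L2_norm_add_sq[OF L] z insert.IH
    using insert.hyps by (simp add: L2_norm_scale power_mult_distrib n1)
  finally show ?case .
qed

lemma orthonormal_coefficient_sum:
  assumes e: "orthonormal_seq M e"
  shows "L2_inner M (\<lambda>x. \<Sum>i<N. c i * e i x) (e n) = (if n < N then c n else 0)"
proof -
  have "L2_inner M (\<lambda>x. \<Sum>i<N. c i * e i x) (e n) = (\<Sum>i<N. L2_inner M (\<lambda>x. c i * e i x) (e n))"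
    by (intro L2_inner_sum_left L2_scale orthonormal_seqD[OF e])
  also have "\<dots> = (\<Sum>i<N. if i = n then c i else 0)"
    by (intro sum.cong) (auto simp: L2_inner_scale_left orthonormal_seqD[OF e])
  finally show ?thesis by simp
qed

lemma bessel_identity:
  assumes e: "orthonormal_seq M e" and f: "f \<in> L2 M"
  shows "(L2_norm M (\<lambda>x. f x - (\<Sum>i<N. L2_inner M f (e i) * e i x)))\<^sup>2 =
    (L2_norm M f)\<^sup>2 - (\<Sum>i<N. (cmod (L2_inner M f (e i)))\<^sup>2)"
proof -
  let ?s = "\<lambda>x. \<Sum>i<N. L2_inner M f (e i) * e i x"
  have s: "?s \<in> L2 M"
    by (intro L2_sum L2_scale orthonormal_seqD[OF e])
  have "L2_inner M ?s f = (\<Sum>i<N. L2_inner M (\<lambda>x. L2_inner M f (e i) * e i x) f)"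
    by (intro L2_inner_sum_left L2_scale orthonormal_seqD[OF e] f)
  also have "\<dots> = (\<Sum>i<N. of_real ((cmod (L2_inner M f (e i)))\<^sup>2))"
    unfolding L2_inner_scale_left complex_norm_square
    by (intro sum.cong refl arg_cong2[where f="(*)"] L2_inner_cnj)
  finally have "Re (L2_inner M f ?s) = (\<Sum>i<N. (cmod (L2_inner M f (e i)))\<^sup>2)"
    by (simp add: L2_inner_cnj[of M f])
  then show ?thesis
    by (simp add: L2_norm_diff_sq[OF f s] orthonormal_sum_norm[OF e])
qed

text \<open>Completeness is at hand for rapidly convergent sequences, so the partial sums are
  thinned to indices N j whose tails are below (1/2)^j. Coefficients are continuous in the mean and
  eventually constant along the partial sums.\<close>

lemma riesz_fischer:
  assumes e: "orthonormal_seq M e" and c: "summable (\<lambda>n. (cmod (c n))\<^sup>2)"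
  obtains w N where "w \<in> L2 M" "\<And>n. L2_inner M w (e n) = c n" "filterlim N sequentially sequentially"
    "(\<lambda>j. L2_norm M (\<lambda>x. (\<Sum>i<N j. c i * e i x) - w x)) \<longlonglongrightarrow> 0"
proof -
  define s where "s N x = (\<Sum>i<N. c i * e i x)" for N x
  have s: "s N \<in> L2 M" for N
    unfolding s_def by (intro L2_sum L2_scale orthonormal_seqD[OF e])
  have "\<exists>N. \<forall>m\<ge>N. \<forall>n. (\<Sum>i\<in>{m..<n}. (cmod (c i))\<^sup>2) < ((1/2)^j)\<^sup>2" for j
    using c[unfolded summable_Cauchy, rule_format, of "((1/2)^j)\<^sup>2"]
    by (auto simp: sum_nonneg)
  then obtain K where K: "\<And>j m n. m \<ge> K j \<Longrightarrow> (\<Sum>i\<in>{m..<n}. (cmod (c i))\<^sup>2) < ((1/2)^j)\<^sup>2"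
    by metis
  \<comment> \<open>Summing the K i makes N monotone and at least K j; adding j makes it tend to
    infinity.\<close>
  define N where "N j = (\<Sum>i\<le>j. K i) + j" for j
  have NK: "K j \<le> N j" for j
    unfolding N_def using member_le_sum[of j "{..j}" K] by simp
  have Nmono: "N j \<le> N (Suc j)" "j \<le> N j" for j by (auto simp: N_def)
  have "L2_norm M (\<lambda>x. s (N (Suc j)) x - s (N j) x) \<le> (1/2)^j" for j
  proof -
    have "s (N (Suc j)) x - s (N j) x = (\<Sum>i\<in>{N j..<N (Suc j)}. c i * e i x)" for x
      unfolding s_def lessThan_atLeast0 using sum.atLeastLessThan_concat[of 0 "N j" "N (Suc j)" "\<lambda>i. c i * e i x"] Nmono
      by (simp add: algebra_simps)
    then have "(L2_norm M (\<lambda>x. s (N (Suc j)) x - s (N j) x))\<^sup>2 = (\<Sum>i\<in>{N j..<N (Suc j)}. (cmod (c i))\<^sup>2)"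
      by (simp add: orthonormal_sum_norm[OF e])
    also have "\<dots> \<le> ((1/2)^j)\<^sup>2" using K[OF NK] less_imp_le by blast
    finally show ?thesis by (rule power2_le_imp_le) simp
  qed
  then obtain w where w: "w \<in> L2 M" "(\<lambda>j. L2_norm M (\<lambda>x. s (N j) x - w x)) \<longlonglongrightarrow> 0"
    using L2_complete_rapid[of "\<lambda>j. s (N j)" M] s by metis
  have "L2_inner M w (e n) = c n" for n
  proof (rule LIMSEQ_unique)
    show "(\<lambda>j. L2_inner M (s (N j)) (e n)) \<longlonglongrightarrow> L2_inner M w (e n)"
      by (rule L2_inner_tendsto_left[OF s w(1) orthonormal_seqD(1)[OF e] w(2)])
    have "\<forall>\<^sub>F j in sequentially. L2_inner M (s (N j)) (e n) = c n"
    proof (rule eventually_sequentiallyI[of "Suc n"])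
      fix j assume "Suc n \<le> j"
      then have "n < N j" using Nmono(2)[of j] by linarith
      then show "L2_inner M (s (N j)) (e n) = c n"
        unfolding s_def by (simp add: orthonormal_coefficient_sum[OF e])
    qed
    then show "(\<lambda>j. L2_inner M (s (N j)) (e n)) \<longlonglongrightarrow> c n" by (rule tendsto_eventually)
  qed
  moreover have "filterlim N sequentially sequentially"
    by (rule filterlim_at_top_mono[OF filterlim_ident]) (simp add: Nmono)
  ultimately show thesis using w that unfolding s_def by blast
qed

text \<open>Orthonormal bases are given as maximal orthonormal systems, so completeness of \<open>L\<^sup>2\<close>
  is what turns them into systems with Parseval's identity.\<close>

definition total_orthonormal :: "'a measure \<Rightarrow> (nat \<Rightarrow> 'a \<Rightarrow> complex) \<Rightarrow> bool" where
  "total_orthonormal M e \<longleftrightarrow> orthonormal_seq M e \<and>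
     (\<forall>f\<in>L2 M. (\<forall>n. L2_inner M f (e n) = 0) \<longrightarrow> (AE t in M. f t = 0))"

lemma bessel_summable:
  assumes e: "orthonormal_seq M e" and f: "f \<in> L2 M"
  shows "summable (\<lambda>n. (cmod (L2_inner M f (e n)))\<^sup>2)"
proof (rule bounded_imp_summable)
  fix n
  have "0 \<le> (L2_norm M f)\<^sup>2 - (\<Sum>i<Suc n. (cmod (L2_inner M f (e i)))\<^sup>2)"
    by (subst bessel_identity[OF e f, symmetric]) simp
  then show "(\<Sum>i\<le>n. (cmod (L2_inner M f (e i)))\<^sup>2) \<le> (L2_norm M f)\<^sup>2"
    by (simp add: lessThan_Suc_atMost)
qed simp

lemma total_orthonormal_expansion:
  assumes "total_orthonormal M e" and f: "f \<in> L2 M"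
  shows "(\<lambda>N. L2_norm M (\<lambda>x. (\<Sum>i<N. L2_inner M f (e i) * e i x) - f x)) \<longlonglongrightarrow> 0" (is ?A)
    and "(\<lambda>n. (cmod (L2_inner M f (e n)))\<^sup>2) sums (L2_norm M f)\<^sup>2" (is ?B)
proof -
  have e: "orthonormal_seq M e" using assms by (simp add: total_orthonormal_def)
  have summ: "summable (\<lambda>n. (cmod (L2_inner M f (e n)))\<^sup>2)" by (rule bessel_summable[OF e f])
  obtain w N where w: "w \<in> L2 M" "\<And>n. L2_inner M w (e n) = L2_inner M f (e n)"
      and N: "filterlim N sequentially sequentially"
      and lw: "(\<lambda>j. L2_norm M (\<lambda>x. (\<Sum>i<N j. L2_inner M f (e i) * e i x) - w x)) \<longlonglongrightarrow> 0"
    by (rule riesz_fischer[OF e summ]) blast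
  let ?S = "\<Sum>n. (cmod (L2_inner M f (e n)))\<^sup>2"
  let ?P = "\<lambda>N. \<Sum>i<N. (cmod (L2_inner M f (e i)))\<^sup>2"
  have [measurable]: "f \<in> borel_measurable M" "w \<in> borel_measurable M"
    "\<And>n. e n \<in> borel_measurable M"
    using f w(1) orthonormal_seqD(1)[OF e] by (auto intro: L2_measurable)
  \<comment> \<open>The Riesz-Fischer limit w has the same coefficients as f, so totality forces w =
    f almost everywhere. Convergence along N then fixes the sum of the squared coefficients, and
    Bessel's identity extends it to all partial sums.\<close>
  have "L2_inner M (\<lambda>x. f x - w x) (e n) = 0" for n
    by (simp add: L2_inner_diff_left f w orthonormal_seqD[OF e])
  then have ae: "AE x in M. f x - w x = 0"
    using assms L2_diff[OF f w(1)] unfolding total_orthonormal_def by fastforce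
  have res: "(L2_norm M (\<lambda>x. (\<Sum>i<N. L2_inner M f (e i) * e i x) - f x))\<^sup>2 = (L2_norm M f)\<^sup>2 - ?P N" for N
    by (subst L2_norm_minus) (rule bessel_identity[OF e f])
  have "(\<lambda>j. L2_norm M (\<lambda>x. (\<Sum>i<N j. L2_inner M f (e i) * e i x) - f x)) \<longlonglongrightarrow> 0"
  proof (rule Lim_transform_eventually[OF lw], intro always_eventually allI)
    fix j show "L2_norm M (\<lambda>x. (\<Sum>i<N j. L2_inner M f (e i) * e i x) - w x) =
        L2_norm M (\<lambda>x. (\<Sum>i<N j. L2_inner M f (e i) * e i x) - f x)"
      by (rule L2_norm_cong_AE) (measurable, use ae in auto)
  qed
  then have "(\<lambda>j. (L2_norm M f)\<^sup>2 - (L2_norm M (\<lambda>x. (\<Sum>i<N j. L2_inner M f (e i) * e i x) - f x))\<^sup>2)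
      \<longlonglongrightarrow> (L2_norm M f)\<^sup>2 - 0\<^sup>2"
    by (intro tendsto_intros)
  then have "(\<lambda>j. ?P (N j)) \<longlonglongrightarrow> (L2_norm M f)\<^sup>2"
    by (simp add: res)
  moreover have "(\<lambda>j. ?P (N j)) \<longlonglongrightarrow> ?S"
    by (rule filterlim_compose[OF summable_LIMSEQ[OF summ] N])
  ultimately have S: "?S = (L2_norm M f)\<^sup>2" by (rule LIMSEQ_unique[rotated])
  show ?B using summable_sums[OF summ] S by simp
  then have "(\<lambda>N. (L2_norm M f)\<^sup>2 - ?P N) \<longlonglongrightarrow> (L2_norm M f)\<^sup>2 - (L2_norm M f)\<^sup>2"
    unfolding sums_def by (intro tendsto_intros)
  then have "(\<lambda>N. sqrt ((L2_norm M (\<lambda>x. (\<Sum>i<N. L2_inner M f (e i) * e i x) - f x))\<^sup>2)) \<longlonglongrightarrow> sqrt 0"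
    unfolding res by (intro tendsto_real_sqrt) simp
  then show ?A by simp
qed

section \<open>Fourier series on the unit interval\<close>

definition ee :: "real \<Rightarrow> complex" where
  "ee x = cis (2 * pi * x)"

lemma ee_0 [simp]: "ee 0 = 1"
  and ee_add: "ee (x + y) = ee x * ee y"
  and cnj_ee [simp]: "cnj (ee x) = ee (- x)"
  and norm_ee [simp]: "cmod (ee x) = 1"
  and ee_nonzero [simp]: "ee x \<noteq> 0"
  by (simp_all add: ee_def cis_mult distrib_left flip: cis_cnj)

lemma ee_of_int [simp]: "ee (of_int k) = 1"
  unfolding ee_def by (simp add: cis_multiple_2pi)

lemma ee_minus: "ee (x - y) = ee x * ee (- y)"
  using ee_add[of x "- y"] by simp

lemma ee_eq_1_iff: "ee x = 1 \<longleftrightarrow> x \<in> \<int>"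
proof
  assume "ee x = 1"
  then have "cos (2 * pi * x) = 1" by (simp add: ee_def cis_conv_exp[symmetric] complex_eq_iff)
  then obtain n :: int where "2 * pi * x = of_int n * 2 * pi" by (auto simp: cos_one_2pi_int)
  then have "x = of_int n" by simp
  then show "x \<in> \<int>" by simp
qed (auto elim!: Ints_cases)

lemma ee_eq_iff: "ee x = ee y \<longleftrightarrow> x - y \<in> \<int>"
proof -
  have "ee x = ee y \<longleftrightarrow> ee (x - y) = 1"
    using ee_add[of y "- y"] by (auto simp: ee_minus) (metis mult.commute mult.left_commute mult.right_neutral)
  then show ?thesis by (simp add: ee_eq_1_iff)
qed

lemma ee_exp: "exp (2 * of_real pi * \<i> * of_real x) = ee x"
  by (simp add: ee_def cis_conv_exp mult_ac)

lemma continuous_on_ee [continuous_intros]: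
  "continuous_on A f \<Longrightarrow> continuous_on A (\<lambda>x. ee (f x))"
  unfolding ee_def cis_conv_exp by (intro continuous_intros)

lemma borel_measurable_ee [measurable (raw)]:
  "f \<in> borel_measurable M \<Longrightarrow> (\<lambda>x. ee (f x)) \<in> borel_measurable M"
  by (rule borel_measurable_continuous_on[where f=ee]) (auto intro: continuous_intros)

section \<open>Uniqueness of Fourier coefficients on the unit interval\<close>

abbreviation unit_measure :: "real measure" where
  "unit_measure \<equiv> restrict_space lborel {0..<1}"

lemma finite_measure_unit: "finite_measure unit_measure"
  by (rule finite_measureI) (simp add: space_restrict_space emeasure_restrict_space)

lemma L2_unit_integrable: "f \<in> L2 unit_measure \<Longrightarrow> integrable unit_measure f"
proof -
  assume f: "f \<in> L2 unit_measure"
  interpret finite_measure unit_measure by (rule finite_measure_unit)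
  have "(\<lambda>x. 1) \<in> L2 unit_measure" by (simp add: L2_def)
  from L2_inner_integrable[OF f this] show ?thesis by simp
qed

text \<open>The functions with vanishing Fourier coefficients are stable under multiplication by
  trigonometric polynomials, which makes Stone--Weierstrass on the circle applicable.\<close>

definition coeffs_vanish :: "(real \<Rightarrow> complex) \<Rightarrow> bool" where
  "coeffs_vanish h \<longleftrightarrow> integrable unit_measure h \<and>
     (\<forall>k::int. (LINT t|unit_measure. h t * ee (of_int k * t)) = 0)"

lemma integrable_mult_ee [simp]:
  assumes "integrable M h" "g \<in> borel_measurable M"
  shows "integrable M (\<lambda>t. h t * ee (g t))"
proof (rule Bochner_Integration.integrable_bound[OF assms(1)])
  have [measurable]: "h \<in> borel_measurable M" using assms(1) by auto
  show "(\<lambda>t. h t * ee (g t)) \<in> borel_measurable M" using assms(2) by measurable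
qed (auto simp: norm_mult)

lemma coeffs_vanish_ee:
  assumes "coeffs_vanish h"
  shows "coeffs_vanish (\<lambda>t. h t * ee (of_int j * t))"
proof -
  have *: "h t * ee (of_int j * t) * ee (of_int k * t) = h t * ee (of_int (j + k) * t)" for k t
    by (simp add: ee_add distrib_right)
  have "integrable unit_measure (\<lambda>t. h t * ee (of_int j * t))"
    using assms unfolding coeffs_vanish_def by (intro integrable_mult_ee) (auto intro!: measurable_restrict_space1)
  then show ?thesis using assms unfolding coeffs_vanish_def * by blast
qed

lemma coeffs_vanish_scale: "coeffs_vanish h \<Longrightarrow> coeffs_vanish (\<lambda>t. c * h t)"
  unfolding coeffs_vanish_def by (simp add: mult.assoc)

lemma coeffs_vanish_add:
  assumes "coeffs_vanish h" "coeffs_vanish g"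
  shows "coeffs_vanish (\<lambda>t. h t + g t)"
proof -
  have "integrable unit_measure (\<lambda>t. f t * ee (of_int k * t))" if "coeffs_vanish f" for f k
    using that unfolding coeffs_vanish_def by (intro integrable_mult_ee) (auto simp: measurable_restrict_space1)
  with assms show ?thesis
    unfolding coeffs_vanish_def by (simp add: distrib_right)
qed

text \<open>Induction over polynomial functions with h left arbitrary: in the product case the
  second hypothesis is applied to h multiplied by the first factor.\<close>

lemma coeffs_vanish_polynomial:
  fixes p :: "complex \<Rightarrow> real"
  assumes "real_polynomial_function p" "coeffs_vanish h"
  shows "coeffs_vanish (\<lambda>t. h t * of_real (p (ee t)))"
  using assms
proof (induction p arbitrary: h rule: real_polynomial_function.induct)
  case (linear p)
  interpret bounded_linear p by fact
  define a b where "a = p 1" and "b = p \<i>"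
  \<comment> \<open>On the circle the linear functional is a cos + b sin, which is twice the real
    part of z e(t) for this z, that is, a combination of two exponentials.\<close>
  define z where "z = (of_real a - \<i> * of_real b) / 2"
  have "h t * of_real (p (ee t)) = z * (h t * ee (of_int 1 * t)) + cnj z * (h t * ee (of_int (-1) * t))" for t
  proof -
    have "p (ee t) = p (Re (ee t) *\<^sub>R 1 + Im (ee t) *\<^sub>R \<i>)"
      by (rule arg_cong[where f=p]) (simp add: complex_eq_iff)
    also have "\<dots> = Re (ee t) * a + Im (ee t) * b"
      by (simp only: add scaleR a_def b_def real_scaleR_def)
    finally have "complex_of_real (p (ee t)) = z * ee t + cnj z * ee (- t)"
      by (simp add: complex_eq_iff z_def ee_def field_simps)
    then show ?thesis by (simp add: algebra_simps)
  qed
  then show ?case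
    by (simp only:) (intro coeffs_vanish_add coeffs_vanish_scale coeffs_vanish_ee \<open>coeffs_vanish h\<close>)
next
  case (const c)
  then show ?case using coeffs_vanish_scale[of h "of_real c"] by (simp add: mult.commute)
next
  case (add f g)
  then show ?case using coeffs_vanish_add[OF add.IH] by (simp add: distrib_left)
next
  case (mult f g)
  then show ?case using mult.IH(2)[OF mult.IH(1)[OF mult.prems]] by (simp add: mult.assoc)
qed

text \<open>Replacing F by a polynomial that is uniformly e-close on the circle changes the integral
  by at most e times the L1 norm of h, and the polynomial integral is 0.\<close>

lemma coeffs_vanish_continuous:
  fixes F :: "complex \<Rightarrow> real"
  assumes F: "continuous_on UNIV F" and h: "coeffs_vanish h"
  shows "(LINT t|unit_measure. h t * of_real (F (ee t))) = 0"
proof (rule ccontr)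
  let ?I = "LINT t|unit_measure. h t * of_real (F (ee t))"
  assume "?I \<noteq> 0"
  then have pos: "cmod ?I > 0" by simp
  have hi: "integrable unit_measure h" using h by (simp add: coeffs_vanish_def)
  then have [measurable]: "h \<in> borel_measurable unit_measure" by auto
  have [measurable]: "F \<in> borel_measurable borel" using F by (rule borel_measurable_continuous_onI)
  have [measurable]: "ee \<in> borel_measurable unit_measure"
    by (rule measurable_restrict_space1) measurable
  define C where "C = (LINT t|unit_measure. cmod (h t))"
  have C: "C \<ge> 0" by (simp add: C_def)
  \<comment> \<open>Then e C is at most half of the integral assumed nonzero; C + 1 keeps the
    denominator positive when C = 0.\<close>
  define e where "e = cmod ?I / (C + 1) / 2"
  have e: "e > 0" using pos C by (simp add: e_def)
  obtain p where p: "real_polynomial_function p" and close: "\<And>z. z \<in> sphere 0 1 \<Longrightarrow> \<bar>F z - p z\<bar> < e"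
    using Stone_Weierstrass_real_polynomial_function[of "sphere 0 1" F e]
      continuous_on_subset[OF F] e by (metis compact_sphere top_greatest)
  have [measurable]: "p \<in> borel_measurable borel"
    by (intro borel_measurable_continuous_onI) (simp add: p continuous_on_polymonial_function continuous_real_polymonial_function continuous_at_imp_continuous_on)
  have vp: "coeffs_vanish (\<lambda>t. h t * of_real (p (ee t)))" by (rule coeffs_vanish_polynomial[OF p h])
  then have ip: "integrable unit_measure (\<lambda>t. h t * of_real (p (ee t)))"
    and zp: "(LINT t|unit_measure. h t * of_real (p (ee t))) = 0"
    unfolding coeffs_vanish_def using of_int_0 by (auto dest: spec[of _ "0::int"])
  have cl: "cmod (h t * of_real (F (ee t)) - h t * of_real (p (ee t))) \<le> e * cmod (h t)" for t
  proof -
    have "\<bar>F (ee t) - p (ee t)\<bar> \<le> e" using close[of "ee t"] by simp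
    then show ?thesis
      by (simp add: norm_mult mult.commute[of e] mult_left_mono flip: right_diff_distrib of_real_diff)
  qed
  have iD: "integrable unit_measure (\<lambda>t. h t * of_real (F (ee t)) - h t * of_real (p (ee t)))"
  proof (rule Bochner_Integration.integrable_bound)
    show "integrable unit_measure (\<lambda>t. e * cmod (h t))" using hi by auto
    show "AE t in unit_measure. norm (h t * of_real (F (ee t)) - h t * of_real (p (ee t))) \<le> norm (e * cmod (h t))"
      using cl e by (auto simp: abs_mult)
  qed measurable
  have "?I = (LINT t|unit_measure. (h t * of_real (F (ee t)) - h t * of_real (p (ee t))) + h t * of_real (p (ee t)))"
    by simp
  also have "\<dots> = (LINT t|unit_measure. h t * of_real (F (ee t)) - h t * of_real (p (ee t)))"
    by (subst Bochner_Integration.integral_add[OF iD ip]) (simp add: zp)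
  finally have "cmod ?I \<le> (LINT t|unit_measure. cmod (h t * of_real (F (ee t)) - h t * of_real (p (ee t))))"
    by (simp only: integral_norm_bound)
  also have "\<dots> \<le> (LINT t|unit_measure. e * cmod (h t))"
    using cl by (intro integral_mono integrable_norm iD) (use hi in auto)
  also have "\<dots> = e * C" by (simp add: C_def)
  also have "\<dots> < cmod ?I"
  proof -
    have "e * C \<le> e * (C + 1)" using e by simp
    also have "\<dots> = cmod ?I / 2" using C by (simp add: e_def divide_simps)
    finally show ?thesis using pos by linarith
  qed
  finally show False by simp
qed

text \<open>The indicator of an open set is the pointwise limit of continuous functions built from
  the distance to the complement. \<open>U\<close> must be proper because \<open>infdist\<close> to
  the empty set is 0 by convention.\<close>

lemma coeffs_vanish_open:
  assumes U: "open U" "U \<noteq> UNIV" and h: "coeffs_vanish h"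
  shows "(LINT t|unit_measure. h t * of_real (indicator U (ee t))) = 0"
proof -
  define F where "F n z = min 1 (real n * infdist z (- U))" for n z
  have hi: "integrable unit_measure h" using h by (simp add: coeffs_vanish_def)
  then have [measurable]: "h \<in> borel_measurable unit_measure" by auto
  have [measurable]: "F n \<in> borel_measurable borel" for n
    unfolding F_def by (intro borel_measurable_continuous_onI continuous_intros)
  have [measurable]: "ee \<in> borel_measurable unit_measure"
    by (rule measurable_restrict_space1) measurable
  have [measurable]: "U \<in> sets borel" using U by auto
  have "(\<lambda>n. F n z) \<longlonglongrightarrow> indicator U z" for z
  proof (cases "z \<in> U")
    case True
    have "infdist z (- U) > 0"
      using True U by (intro infdist_pos_not_in_closed) auto
    then have "filterlim (\<lambda>n. real n * infdist z (- U)) at_top sequentially"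
      by (intro filterlim_at_top_mult_tendsto_pos[where c="infdist z (- U)"] filterlim_real_sequentially) auto
    then have "\<forall>\<^sub>F n in sequentially. 1 \<le> real n * infdist z (- U)"
      by (simp add: filterlim_at_top)
    then have "\<forall>\<^sub>F n in sequentially. F n z = 1"
      by eventually_elim (simp add: F_def)
    with True show ?thesis by (simp add: tendsto_eventually)
  next
    case False
    then show ?thesis by (simp add: F_def)
  qed
  then have "(\<lambda>n. LINT t|unit_measure. h t * of_real (F n (ee t))) \<longlonglongrightarrow>
      (LINT t|unit_measure. h t * of_real (indicator U (ee t)))"
  proof (intro integral_dominated_convergence[where w="\<lambda>t. cmod (h t)"])
    assume lim: "\<And>z. (\<lambda>n. F n z) \<longlonglongrightarrow> indicat_real U z"
    then show "AE t in unit_measure. (\<lambda>n. h t * of_real (F n (ee t))) \<longlonglongrightarrow> h t * of_real (indicator U (ee t))"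
      by (auto intro!: tendsto_intros)
    show "AE t in unit_measure. cmod (h t * of_real (F n (ee t))) \<le> cmod (h t)" for n
      by (auto simp: norm_mult F_def infdist_nonneg mult_left_le)
    show "(\<lambda>t. h t * of_real (F n (ee t))) \<in> borel_measurable unit_measure" for n by measurable
    show "(\<lambda>t. h t * of_real (indicator U (ee t))) \<in> borel_measurable unit_measure" by measurable
    show "integrable unit_measure (\<lambda>t. cmod (h t))" using hi by auto
  qed
  moreover have "(LINT t|unit_measure. h t * of_real (F n (ee t))) = 0" for n
    using h unfolding F_def by (intro coeffs_vanish_continuous continuous_intros)
  ultimately show ?thesis
    by (simp add: LIMSEQ_const_iff)
qed

text \<open>An open subinterval of [0, 1) is, apart from the point 0, the preimage under
  \<open>ee\<close> of the complement of a closed arc K, so the result for open sets of the circle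
  applies.\<close>

lemma coeffs_vanish_interval:
  assumes h: "coeffs_vanish h"
  shows "(LINT t:{a<..<b}|unit_measure. h t) = 0"
proof -
  have hi: "integrable unit_measure h" using h by (simp add: coeffs_vanish_def)
  then have [measurable]: "h \<in> borel_measurable unit_measure" by auto
  \<comment> \<open>The interval is clipped to [0, 1]; the outer maximum keeps a' <= b' when the
    clipped interval is empty.\<close>
  define a' b' where "a' = max a 0" and "b' = max a' (min b 1)"
  define K where "K = ee ` ({0..a'} \<union> {b'..1})"
  have "compact K" unfolding K_def
    by (intro compact_continuous_image continuous_intros compact_Un) auto
  show ?thesis
  proof (cases "a' < 1")
    case False
    then have "{a<..<b} \<inter> {0..<1} = {}" by (auto simp: a'_def)
    then have "(LINT t:{a<..<b}|unit_measure. h t) = (LINT t|unit_measure. 0)"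
      unfolding set_lebesgue_integral_def
      by (intro Bochner_Integration.integral_cong) (auto simp: indicator_def space_restrict_space)
    then show ?thesis by simp
  next
    case True
    have ab: "0 \<le> a'" "a' \<le> b'" "b' \<le> 1" using True by (auto simp: a'_def b'_def)
    have mem: "ee t \<in> - K \<longleftrightarrow> a' < t \<and> t < b'" if "0 \<le> t" "t < 1" for t
    proof
      assume "ee t \<in> - K"
      then show "a' < t \<and> t < b'" using that by (force simp: K_def)
    next
      assume t: "a' < t \<and> t < b'"
      show "ee t \<in> - K"
      proof
        assume "ee t \<in> K"
        then obtain s where s: "s \<in> {0..a'} \<union> {b'..1}" "ee t = ee s" unfolding K_def by (rule imageE)
        then have "t - s \<in> \<int>" by (simp add: ee_eq_iff)
        moreover have "\<bar>t - s\<bar> < 1" using s(1) t that ab by auto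
        ultimately have "t - s = 0" using Ints_nonzero_abs_less1 by blast
        then show False using s(1) t by auto
      qed
    qed
    have "K \<noteq> {}" unfolding K_def using ab by auto
    then have "(LINT t|unit_measure. h t * of_real (indicator (- K) (ee t))) = 0"
      using \<open>compact K\<close> by (intro coeffs_vanish_open[OF _ _ h]) (auto simp: compact_imp_closed)
    also have "(LINT t|unit_measure. h t * of_real (indicator (- K) (ee t))) = (LINT t:{a<..<b}|unit_measure. h t)"
      unfolding set_lebesgue_integral_def
    proof (rule integral_cong_AE)
      have [measurable]: "ee \<in> borel_measurable unit_measure"
        by (rule measurable_restrict_space1) measurable
      have [measurable]: "K \<in> sets borel" using \<open>compact K\<close> by (simp add: borel_compact)
      show "(\<lambda>t. h t * of_real (indicator (- K) (ee t))) \<in> borel_measurable unit_measure" by measurable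
      have [measurable]: "{a<..<b} \<inter> {0..<1} \<in> sets unit_measure" by (simp add: sets_restrict_space_iff)
      have "(\<lambda>t. indicator ({a<..<b} \<inter> {0..<1}) t *\<^sub>R h t) \<in> borel_measurable unit_measure" by measurable
      then show "(\<lambda>t. indicator {a<..<b} t *\<^sub>R h t) \<in> borel_measurable unit_measure"
        by (rule measurable_cong[THEN iffD1, rotated]) (auto simp: space_restrict_space indicator_def)
      \<comment> \<open>If a < 0 < b then t = 0 lies in the interval although \<open>ee 0\<close>
        lies in K, so this single point is discarded.\<close>
      have "AE t in lborel. t \<noteq> (0::real)" using AE_lborel_singleton by auto
      then show "AE t in unit_measure. h t * of_real (indicator (- K) (ee t)) = indicator {a<..<b} t *\<^sub>R h t"
      proof (subst AE_restrict_space_iff, simp, eventually_elim, intro impI)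
        fix t :: real assume t: "t \<noteq> 0" "t \<in> {0..<1}"
        have "ee t \<in> - K \<longleftrightarrow> t \<in> {a<..<b}" using t mem[of t] by (auto simp: a'_def b'_def)
        then show "h t * of_real (indicator (- K) (ee t)) = indicator {a<..<b} t *\<^sub>R h t"
          by (simp add: indicator_def)
      qed
    qed
    finally show ?thesis .
  qed
qed

text \<open>The open intervals form an intersection-stable generator of the Borel sets. Dynkin's
  argument extends the vanishing integrals to every Borel set, and an integrable function with this
  property is 0 almost everywhere.\<close>

lemma coeffs_vanish_AE:
  assumes h: "coeffs_vanish h"
  shows "AE t in unit_measure. h t = 0"
proof -
  define g where "g t = indicator {0..<1} t *\<^sub>R h t" for t
  have hi: "integrable unit_measure h" using h by (simp add: coeffs_vanish_def)
  then have gi: "integrable lborel g" by (simp add: g_def[abs_def] integrable_restrict_space)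
  then have set_gi: "set_integrable lborel A g" if "A \<in> sets borel" for A
    unfolding set_integrable_def using that by (intro integrable_mult_indicator) auto
  have conv: "(LINT t:A|unit_measure. h t) = (LINT t:A|lborel. g t)" for A
    unfolding set_lebesgue_integral_def g_def by (simp add: integral_restrict_space mult.commute)
  \<comment> \<open>This is the coefficient at frequency 0; it drives the step for
    complements.\<close>
  have tot: "(LINT t|lborel. g t) = 0"
  proof -
    have "(LINT t|unit_measure. h t * ee (of_int 0 * t)) = 0" using h unfolding coeffs_vanish_def by blast
    then show ?thesis by (simp add: g_def integral_restrict_space)
  qed
  have zero: "(LINT t:A|lborel. g t) = 0" if "A \<in> sets lborel" for A
  proof -
    have B: "sets borel = sigma_sets UNIV (range (\<lambda>(a, b). {a <..< b :: real}))"
      by (subst borel_eq_box) (simp add: box_real[abs_def] box_real)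
    with that have A: "A \<in> sigma_sets UNIV (range (\<lambda>(a, b). {a <..< b :: real}))" by simp
    have IS: "Int_stable (range (\<lambda>(a, b). {a <..< b :: real}))"
    proof (rule Int_stableI)
      fix X Y :: "real set"
      assume "X \<in> range (\<lambda>(a, b). {a<..<b})" "Y \<in> range (\<lambda>(a, b). {a<..<b})"
      then obtain a b c d where "X = {a<..<b}" "Y = {c<..<d}" by auto
      then have "X \<inter> Y = (\<lambda>(a, b). {a<..<b}) (max a c, min b d)" by auto
      then show "X \<inter> Y \<in> range (\<lambda>(a, b). {a<..<b})" by (metis rangeI)
    qed
    have "range (\<lambda>(a, b). {a <..< b :: real}) \<subseteq> Pow UNIV" by simp
    from IS this A show ?thesis
    proof (induction rule: sigma_sets_induct_disjoint)
      case (basic A)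
      then show ?case using coeffs_vanish_interval[OF h] unfolding conv by auto
    next
      case (compl A)
      then have A: "A \<in> sets borel" using B by simp
      have "(LINT t:A \<union> (UNIV - A)|lborel. g t) = (LINT t:A|lborel. g t) + (LINT t:UNIV - A|lborel. g t)"
        using A by (intro set_integral_Un set_gi) auto
      then show ?case using compl tot by (simp add: set_lebesgue_integral_def)
    next
      case (union A)
      then have A: "A i \<in> sets lborel" for i unfolding sets_lborel B by blast
      have "(LINT t:(\<Union>i. A i)|lborel. g t) = (\<Sum>i. LINT t:A i|lborel. g t)"
        using union A by (intro lebesgue_integral_countable_add set_gi) (auto simp: disjoint_family_on_def)
      then show ?case using union by simp
    qed (auto simp: set_lebesgue_integral_def)
  qed
  have "AE t in lborel. g t = 0"
    by (rule sigma_finite_measure.density_zero[OF sigma_finite_lborel gi zero])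
  then show ?thesis
    by (subst AE_restrict_space_iff) (auto simp: g_def indicator_def)
qed

section \<open>The exponentials as a total orthonormal sequence\<close>

lemma integral_unit_ee:
  "(LINT t|unit_measure. ee (of_int k * t)) = (if k = 0 then 1 else 0)"
proof -
  have "(LINT t|unit_measure. ee (of_int k * t)) = (LINT t|lborel. indicator {0..<1} t *\<^sub>R ee (of_int k * t))"
    by (simp add: integral_restrict_space)
  also have "\<dots> = (LINT t|lborel. indicator {0..1} t *\<^sub>R ee (of_int k * t))"
  proof (rule integral_cong_AE)
    show "AE t in lborel. indicator {0..<1} t *\<^sub>R ee (of_int k * t) = indicator {0..1} t *\<^sub>R ee (of_int k * t)"
      using AE_lborel_singleton[of "1::real"] by eventually_elim (auto simp: indicator_def)
  qed measurable
  also have "\<dots> = (if k = 0 then 1 else 0)"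
  proof (cases "k = 0")
    case False
    define F where "F t = ee (of_int k * t) / (2 * of_real pi * \<i> * of_int k)" for t
    have "has_bochner_integral lborel (\<lambda>t. indicator {0..1} t *\<^sub>R ee (of_int k * t)) (F 1 - F 0)"
    proof (rule has_bochner_integral_FTC_Icc)
      fix t :: real
      have "((\<lambda>t. ee (of_int k * t)) has_vector_derivative (2 * of_real pi * \<i> * of_int k * ee (of_int k * t))) (at t within {0..1})"
      proof -
        have "((\<lambda>z. exp (2 * of_real pi * \<i> * of_int k * z)) has_field_derivative
            2 * of_real pi * \<i> * of_int k * ee (of_int k * t)) (at (of_real t))"
          by (rule derivative_eq_intros refl | simp add: ee_def cis_conv_exp mult_ac)+
        from has_vector_derivative_real_field[OF this] show ?thesis
          by (simp add: ee_def cis_conv_exp mult_ac)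
      qed
      from has_vector_derivative_divide[OF this, of "2 * of_real pi * \<i> * of_int k"]
      show "(F has_vector_derivative ee (of_int k * t)) (at t within {0..1})"
        using False by (simp add: F_def[abs_def])
    qed (auto intro!: continuous_intros)
    then have "(LINT t|lborel. indicator {0..1} t *\<^sub>R ee (of_int k * t)) = F 1 - F 0"
      by (rule has_bochner_integral_integral_eq)
    then show ?thesis using False ee_of_int[of k] by (simp add: F_def)
  qed simp
  finally show ?thesis .
qed

text \<open>The inner product conjugates its second argument, so the minus sign makes its
  coefficients the integrals against \<open>ee (of_int k * t)\<close> of
  \<open>coeffs_vanish\<close>. The integers are enumerated because orthonormal sequences are
  indexed by natural numbers.\<close>

definition fourier_seq :: "nat \<Rightarrow> real \<Rightarrow> complex" where
  "fourier_seq n t = ee (- (of_int (int_decode n) * t))"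

lemma fourier_seq_L2: "fourier_seq n \<in> L2 unit_measure"
proof -
  interpret finite_measure unit_measure by (rule finite_measure_unit)
  show ?thesis unfolding L2_def fourier_seq_def by (auto intro!: measurable_restrict_space1)
qed

lemma total_orthonormal_fourier: "total_orthonormal unit_measure fourier_seq"
  unfolding total_orthonormal_def orthonormal_seq_def
proof (intro conjI allI ballI impI)
  show "fourier_seq n \<in> L2 unit_measure" for n by (rule fourier_seq_L2)
next
  fix m n
  have "fourier_seq m t * cnj (fourier_seq n t) = ee (of_int (int_decode n - int_decode m) * t)" for t
    by (simp add: fourier_seq_def left_diff_distrib ee_minus)
  then show "L2_inner unit_measure (fourier_seq m) (fourier_seq n) = (if m = n then 1 else 0)"
    unfolding L2_inner_def by (simp only: integral_unit_ee) (auto simp: int_decode_eq)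
next
  fix f assume f: "f \<in> L2 unit_measure" and 0: "\<forall>n. L2_inner unit_measure f (fourier_seq n) = 0"
  have "(LINT t|unit_measure. f t * ee (of_int k * t)) = 0" for k
    using 0[rule_format, of "int_encode k"] by (simp add: L2_inner_def fourier_seq_def)
  then have "coeffs_vanish f" using L2_unit_integrable[OF f] by (simp add: coeffs_vanish_def)
  then show "AE t in unit_measure. f t = 0" by (rule coeffs_vanish_AE)
qed

text \<open>Lattice sums are kept as integrals over counting measure, so that exchanging them with
  other integrals is an instance of Tonelli; this converts them to series, the form in which basis
  expansions are available.\<close>

lemma nn_integral_count_int_decode:
  "(\<integral>\<^sup>+k. f k \<partial>count_space (UNIV :: int set)) = (\<Sum>n. f (int_decode n))"
  by (simp add: nn_integral_bij_count_space[OF bij_int_decode, symmetric] nn_integral_count_space_nat)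

lemma ennreal_sums_eq:
  assumes "f sums a" "\<And>n. f n \<ge> 0"
  shows "(\<Sum>n. ennreal (f n)) = ennreal a"
  using assms by (metis sums_unique suminf_ennreal2 sums_summable)

lemma fourier_parseval_unit:
  assumes "f \<in> L2 unit_measure"
  shows "(\<integral>\<^sup>+k. ennreal ((cmod (LINT t|unit_measure. f t * ee (of_int k * t)))\<^sup>2) \<partial>count_space (UNIV :: int set))
    = (\<integral>\<^sup>+t. ennreal ((cmod (f t))\<^sup>2) \<partial>unit_measure)"
proof -
  have "(\<Sum>n. ennreal ((cmod (L2_inner unit_measure f (fourier_seq n)))\<^sup>2)) = ennreal ((L2_norm unit_measure f)\<^sup>2)"
    by (rule ennreal_sums_eq[OF total_orthonormal_expansion(2)[OF total_orthonormal_fourier assms]]) simp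
  then show ?thesis
    unfolding nn_integral_count_int_decode L2_norm_sq_nn[OF assms] L2_inner_def fourier_seq_def by simp
qed

section \<open>Periodization and the Plancherel theorem on the line\<close>

lemma nn_integral_count_indicator_floor:
  "(\<integral>\<^sup>+j. c * indicator {of_int j..<of_int j + 1} x \<partial>count_space (UNIV :: int set)) = (c::ennreal)" for x :: real
proof -
  have "(\<integral>\<^sup>+j. c * indicator {of_int j..<of_int j + 1} x \<partial>count_space (UNIV :: int set))
    = (\<integral>\<^sup>+j. c * indicator {\<lfloor>x\<rfloor>} j \<partial>count_space UNIV)"
    by (intro nn_integral_cong) (auto simp: indicator_def floor_eq_iff floor_unique intro: floor_unique[symmetric])
  then show ?thesis by simp
qed

lemma nn_integral_periodize:
  assumes [measurable]: "w \<in> borel_measurable borel"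
  shows "(\<integral>\<^sup>+x. w x \<partial>lborel) = (\<integral>\<^sup>+x. (\<integral>\<^sup>+j. w (x + of_int j) \<partial>count_space (UNIV :: int set)) \<partial>unit_measure)"
proof -
  have "(\<integral>\<^sup>+x. w x \<partial>lborel) = (\<integral>\<^sup>+x. (\<integral>\<^sup>+j. w x * indicator {of_int j..<of_int j + 1} x \<partial>count_space (UNIV :: int set)) \<partial>lborel)"
    by (simp add: nn_integral_count_indicator_floor)
  also have "\<dots> = (\<integral>\<^sup>+j. (\<integral>\<^sup>+x. w x * indicator {of_int j..<of_int j + 1} x \<partial>lborel) \<partial>count_space (UNIV :: int set))"
    by (intro nn_integral_count_space_nn_integral) auto
  also have "\<dots> = (\<integral>\<^sup>+j. (\<integral>\<^sup>+x. w (x + of_int j) * indicator {0..<1} x \<partial>lborel) \<partial>count_space (UNIV :: int set))"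
  proof (rule nn_integral_cong)
    fix j :: int
    have "(\<integral>\<^sup>+x. w x * indicator {of_int j..<of_int j + 1} x \<partial>lborel) =
      (\<integral>\<^sup>+x. w (of_int j + 1 * x) * indicator {of_int j..<of_int j + 1} (of_int j + 1 * x) \<partial>lborel)"
      by (subst nn_integral_real_affine[where c=1 and t="of_int j"]) auto
    also have "\<dots> = (\<integral>\<^sup>+x. w (x + of_int j) * indicator {0..<1} x \<partial>lborel)"
      by (intro nn_integral_cong) (auto simp: indicator_def add.commute)
    finally show "(\<integral>\<^sup>+x. w x * indicator {of_int j..<of_int j + 1} x \<partial>lborel) =
      (\<integral>\<^sup>+x. w (x + of_int j) * indicator {0..<1} x \<partial>lborel)" .
  qed
  also have "\<dots> = (\<integral>\<^sup>+x. (\<integral>\<^sup>+j. w (x + of_int j) * indicator {0..<1} x \<partial>count_space (UNIV :: int set)) \<partial>lborel)"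
    by (intro nn_integral_count_space_nn_integral[symmetric]) auto
  also have "\<dots> = (\<integral>\<^sup>+x. (\<integral>\<^sup>+j. w (x + of_int j) \<partial>count_space (UNIV :: int set)) \<partial>unit_measure)"
    by (subst nn_integral_restrict_space) (auto intro!: nn_integral_cong simp: nn_integral_multc)
  finally show ?thesis .
qed

lemma sigma_finite_count_int: "sigma_finite_measure (count_space (UNIV :: int set))"
  by (rule sigma_finite_measure_count_space_countable) simp

lemma sigma_finite_unit: "sigma_finite_measure unit_measure"
  using finite_measure_unit by (simp add: finite_measure_def)

abbreviation unit_lattice :: "(real \<times> int) measure" where
  "unit_lattice \<equiv> unit_measure \<Otimes>\<^sub>M count_space UNIV"

lemma measurable_periodize:
  "(\<lambda>(x, j). x + of_int j) \<in> unit_lattice \<rightarrow>\<^sub>M borel"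
proof -
  have id: "(\<lambda>x. x) \<in> unit_measure \<rightarrow>\<^sub>M borel" by (rule measurable_restrict_space1) simp
  have [measurable]: "(\<lambda>p. fst p) \<in> unit_lattice \<rightarrow>\<^sub>M borel"
    using measurable_compose[OF measurable_fst id] .
  have [measurable]: "(\<lambda>p. real_of_int (snd p)) \<in> unit_lattice \<rightarrow>\<^sub>M borel"
    by (rule measurable_compose[OF measurable_snd]) simp
  then show ?thesis by (simp add: split_beta')
qed

text \<open>Stated for measures, the periodization formula transfers to complex integrands, where
  the nonnegative version does not apply directly.\<close>

lemma lborel_periodize:
  "lborel = distr unit_lattice borel (\<lambda>(x, j). x + of_int j)"
proof (rule measure_eqI)
  note measurable_periodize[measurable]
  interpret C: sigma_finite_measure "count_space (UNIV :: int set)" by (rule sigma_finite_count_int)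
  fix A :: "real set" assume "A \<in> sets lborel"
  then have [measurable]: "A \<in> sets borel" by simp
  have m: "(\<lambda>p. indicator A (case p of (x, j) \<Rightarrow> x + of_int j)) \<in> borel_measurable unit_lattice"
    by measurable
  have "emeasure lborel A = (\<integral>\<^sup>+x. indicator A x \<partial>lborel)" by simp
  also have "\<dots> = (\<integral>\<^sup>+x. (\<integral>\<^sup>+j. indicator A (x + of_int j) \<partial>count_space (UNIV :: int set)) \<partial>unit_measure)"
    by (rule nn_integral_periodize) simp
  also have "\<dots> = (\<integral>\<^sup>+p. indicator A (case p of (x, j) \<Rightarrow> x + of_int j) \<partial>unit_lattice)"
    by (subst C.nn_integral_fst[OF m, symmetric]) simp
  also have "\<dots> = (\<integral>\<^sup>+x. indicator A x \<partial>distr unit_lattice borel (\<lambda>(x, j). x + of_int j))"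
    by (subst nn_integral_distr) auto
  also have "\<dots> = emeasure (distr unit_lattice borel (\<lambda>(x, j). x + of_int j)) A"
    by simp
  finally show "emeasure lborel A = emeasure (distr unit_lattice borel (\<lambda>(x, j). x + of_int j)) A" .
qed simp

lemma integral_periodize:
  fixes f :: "real \<Rightarrow> complex"
  assumes "integrable lborel f"
  shows "(LINT x|lborel. f x) = (LINT x|unit_measure. (LINT j|count_space (UNIV :: int set). f (x + of_int j)))"
proof -
  interpret pair_sigma_finite unit_measure "count_space (UNIV :: int set)"
    by (intro pair_sigma_finite.intro sigma_finite_unit sigma_finite_count_int)
  have [measurable]: "f \<in> borel_measurable borel" using assms by auto
  have int: "integrable unit_lattice (\<lambda>p. f (case p of (x, j) \<Rightarrow> x + of_int j))"
    using assms by (subst (asm) lborel_periodize) (simp add: integrable_distr_eq measurable_periodize)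
  then have int': "integrable unit_lattice (\<lambda>(x, j). f (x + of_int j))" by (simp add: split_beta')
  have "(LINT x|lborel. f x) = (LINT p|unit_lattice. f (case p of (x, j) \<Rightarrow> x + of_int j))"
    by (subst lborel_periodize) (simp add: integral_distr measurable_periodize)
  also have "\<dots> = (LINT x|unit_measure. (LINT j|count_space (UNIV :: int set). f (x + of_int j)))"
    using integral_fst[OF int'] by (simp add: split_beta')
  finally show ?thesis .
qed

text \<open>The integer translates of E are disjoint up to null sets: E is a subset, modulo
  translation and null sets, of a fundamental domain of R modulo Z.\<close>

definition packing :: "real set \<Rightarrow> bool" where
  "packing E \<longleftrightarrow> (AE x in unit_measure. \<forall>i j :: int. x + of_int i \<in> E \<longrightarrow> x + of_int j \<in> E \<longrightarrow> i = j)"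

lemma count_space_single_support:
  fixes f :: "int \<Rightarrow> complex"
  assumes "\<And>i. f i \<noteq> 0 \<Longrightarrow> i = j" and "n > 0"
  shows "(LINT i|count_space UNIV. f i) = f j" "(\<integral>\<^sup>+i. ennreal ((cmod (f i))^n) \<partial>count_space UNIV) = ennreal ((cmod (f j))^n)"
proof -
  have "f = (\<lambda>i. indicator {j} i *\<^sub>R f j)" using assms by (fastforce simp: indicator_def)
  then have "(LINT i|count_space UNIV. f i) = (LINT i|count_space UNIV. indicator {j} i *\<^sub>R f j)" by simp
  then show "(LINT i|count_space UNIV. f i) = f j" by simp
  have "(\<integral>\<^sup>+i. ennreal ((cmod (f i))^n) \<partial>count_space UNIV) = (\<integral>\<^sup>+i. ennreal ((cmod (f j))^n) * indicator {j} i \<partial>count_space UNIV)"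
    using assms by (intro nn_integral_cong) (auto simp: indicator_def)
  then show "(\<integral>\<^sup>+i. ennreal ((cmod (f i))^n) \<partial>count_space UNIV) = ennreal ((cmod (f j))^n)" by simp
qed

text \<open>At almost every x at most one summand of the periodization v is nonzero, so v carries
  the norms of u to the unit interval. Integer exponentials have period 1, so u and v also have the
  same Fourier coefficients.\<close>

lemma parseval_packing:
  assumes u: "u \<in> L2 lborel" and supp: "\<And>x. x \<notin> E \<Longrightarrow> u x = 0" and E: "packing E"
  shows "integrable lborel u" (is ?int)
    and "(\<integral>\<^sup>+k. ennreal ((cmod (LINT x|lborel. u x * ee (of_int k * x)))\<^sup>2) \<partial>count_space (UNIV :: int set))
      = (\<integral>\<^sup>+x. ennreal ((cmod (u x))\<^sup>2) \<partial>lborel)" (is ?pars)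
proof -
  interpret C: sigma_finite_measure "count_space (UNIV :: int set)" by (rule sigma_finite_count_int)
  have [measurable]: "u \<in> borel_measurable borel" using u by (auto simp: L2_def)
  define v where "v x = (LINT j|count_space (UNIV :: int set). u (x + of_int j))" for x
  have "(\<lambda>p. u (case p of (x, j) \<Rightarrow> x + of_int j)) \<in> borel_measurable unit_lattice"
    by (rule measurable_compose[OF measurable_periodize]) simp
  then have v_meas[measurable]: "v \<in> borel_measurable unit_measure"
    unfolding v_def by (intro C.borel_measurable_lebesgue_integral) (simp add: split_beta')
  have single: "AE x in unit_measure. \<exists>j. \<forall>i::int. u (x + of_int i) \<noteq> 0 \<longrightarrow> i = j"
    using E unfolding packing_def
  proof eventually_elim
    case (elim x)
    show ?case
    proof (cases "\<exists>j::int. x + of_int j \<in> E")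
      case True
      then obtain j :: int where "x + of_int j \<in> E" by auto
      with elim supp show ?thesis by blast
    next
      case False
      with supp show ?thesis by blast
    qed
  qed
  \<comment> \<open>The case n = 2 transports the L2 norm; the case n = 1 gives integrability of u,
    since L2 is contained in L1 on the unit interval.\<close>
  have pw: "(\<integral>\<^sup>+x. ennreal ((cmod (v x))^n) \<partial>unit_measure) = (\<integral>\<^sup>+x. ennreal ((cmod (u x))^n) \<partial>lborel)" if "n > 0" for n
  proof -
    have "(\<integral>\<^sup>+x. ennreal ((cmod (u x))^n) \<partial>lborel)
      = (\<integral>\<^sup>+x. (\<integral>\<^sup>+j. ennreal ((cmod (u (x + of_int j)))^n) \<partial>count_space (UNIV :: int set)) \<partial>unit_measure)"
      by (rule nn_integral_periodize) simp
    also have "\<dots> = (\<integral>\<^sup>+x. ennreal ((cmod (v x))^n) \<partial>unit_measure)"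
    proof (rule nn_integral_cong_AE, use single in eventually_elim)
      fix x assume "\<exists>j. \<forall>i::int. u (x + of_int i) \<noteq> 0 \<longrightarrow> i = j"
      then obtain j where "\<And>i::int. u (x + of_int i) \<noteq> 0 \<Longrightarrow> i = j" by auto
      from count_space_single_support[of "\<lambda>i. u (x + of_int i)", OF this that]
      show "(\<integral>\<^sup>+j. ennreal ((cmod (u (x + of_int j)))^n) \<partial>count_space (UNIV :: int set)) = ennreal ((cmod (v x))^n)"
        by (simp add: v_def)
    qed
    finally show ?thesis by simp
  qed
  have v: "v \<in> L2 unit_measure"
    using pw[of 2] L2_nn_finite[OF u] by (intro L2I_nn) auto
  have "(\<integral>\<^sup>+x. ennreal (cmod (u x)) \<partial>lborel) < \<infinity>"
    using pw[of 1] L2_unit_integrable[OF v] by (simp add: integrable_iff_bounded)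
  then show int: ?int by (intro integrableI_bounded) auto
  have coeff: "(LINT x|lborel. u x * ee (of_int k * x)) = (LINT x|unit_measure. v x * ee (of_int k * x))" for k :: int
  proof -
    have "(LINT x|lborel. u x * ee (of_int k * x))
      = (LINT x|unit_measure. (LINT j|count_space (UNIV :: int set). u (x + of_int j) * ee (of_int k * (x + of_int j))))"
      by (rule integral_periodize) (simp add: int integrable_mult_ee)
    also have "\<dots> = (LINT x|unit_measure. (LINT j|count_space (UNIV :: int set). u (x + of_int j) * ee (of_int k * x)))"
    proof (intro Bochner_Integration.integral_cong refl arg_cong2[where f="(*)"])
      fix x :: real and j :: int
      show "ee (of_int k * (x + of_int j)) = ee (of_int k * x)"
        using ee_of_int[of "k * j"] by (simp add: distrib_left ee_add)
    qed
    finally show ?thesis by (simp add: v_def)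
  qed
  show ?pars unfolding coeff fourier_parseval_unit[OF v] using pw[of 2] by simp
qed

section \<open>Plancherel's theorem on the line\<close>

definition FT :: "(real \<Rightarrow> complex) \<Rightarrow> real \<Rightarrow> complex" where
  "FT u \<xi> = (LINT t|lborel. u t * ee (\<xi> * t))"

lemma FT_measurable [measurable]:
  assumes [measurable]: "u \<in> borel_measurable borel"
  shows "FT u \<in> borel_measurable borel"
  unfolding FT_def[abs_def] by (intro lborel.borel_measurable_lebesgue_integral) measurable

lemma packing_diameter:
  assumes "\<And>x y. x \<in> E \<Longrightarrow> y \<in> E \<Longrightarrow> \<bar>x - y\<bar> < 1"
  shows "packing E"
  unfolding packing_def
proof (rule always_eventually, intro allI impI)
  fix x :: real and i j :: int
  assume "x + of_int i \<in> E" "x + of_int j \<in> E"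
  from assms[OF this] have "\<bar>of_int i - of_int j :: real\<bar> < 1" by simp
  then show "i = j" by linarith
qed

text \<open>Parseval's identity, applied to the modulations of \<open>u\<close> by \<open>\<theta> \<in> [0, 1)\<close> and averaged over
  \<open>\<theta>\<close>, turns the sum over the integers into an integral over the line.\<close>

lemma plancherel_compact:
  assumes u: "u \<in> L2 lborel" and N: "N > 0" and supp: "\<And>x. \<bar>x\<bar> > N \<Longrightarrow> u x = 0"
  shows "(\<integral>\<^sup>+\<xi>. ennreal ((cmod (FT u \<xi>))\<^sup>2) \<partial>lborel) = (\<integral>\<^sup>+t. ennreal ((cmod (u t))\<^sup>2) \<partial>lborel)"
proof -
  have [measurable]: "u \<in> borel_measurable borel" using u by (auto simp: L2_def)
  \<comment> \<open>Rescaling by c puts the support into [-1/3, 1/3], whose diameter 2/3 is below 1,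
    so that it packs modulo the integers.\<close>
  define c where "c = 3 * N"
  have c: "c > 0" using N by (simp add: c_def)
  define w where "w x = ennreal ((cmod (FT u (x / c)))\<^sup>2)" for x
  have [measurable]: "w \<in> borel_measurable borel" unfolding w_def by measurable
  have [measurable]: "(\<lambda>x. x) \<in> unit_measure \<rightarrow>\<^sub>M borel" by (rule measurable_restrict_space1) simp
  let ?n = "\<integral>\<^sup>+t. ennreal ((cmod (u t))\<^sup>2) \<partial>lborel"
  have scale: "(\<integral>\<^sup>+t. ennreal ((cmod (u (c * t)))\<^sup>2) \<partial>lborel) = ennreal (1 / c) * ?n"
    by (subst (2) nn_integral_real_affine[where c=c and t=0])
      (use c in \<open>auto simp: mult.assoc[symmetric] simp flip: ennreal_mult\<close>)
  \<comment> \<open>The sum of the squared transform over a shifted lattice does not depend on the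
    shift, so averaging over the shift is immediate.\<close>
  have slice: "(\<integral>\<^sup>+k. w (\<theta> + of_int k) \<partial>count_space (UNIV :: int set)) = ennreal c * ?n" for \<theta>
  proof -
    define v where "v t = u (c * t) * ee (\<theta> * t)" for t
    have [measurable]: "v \<in> borel_measurable borel" unfolding v_def by measurable
    have nv: "(\<integral>\<^sup>+t. ennreal ((cmod (v t))\<^sup>2) \<partial>lborel) = ennreal (1 / c) * ?n"
      using scale by (simp add: v_def norm_mult)
    have v: "v \<in> L2 lborel"
      by (rule L2I_nn) (use L2_nn_finite[OF u] nv c in \<open>auto simp: ennreal_mult_less_top\<close>)
    have "v t = 0" if "t \<notin> {-(1/3)..1/3}" for t
    proof -
      have "\<bar>c * t\<bar> > N" using that N by (auto simp: c_def abs_mult) 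
      then show ?thesis by (simp add: v_def supp)
    qed
    then have P: "(\<integral>\<^sup>+k. ennreal ((cmod (LINT x|lborel. v x * ee (of_int k * x)))\<^sup>2) \<partial>count_space (UNIV :: int set))
      = ennreal (1 / c) * ?n"
      unfolding nv[symmetric] by (rule parseval_packing(2)[where E="{-(1/3)..1/3}", OF v _ packing_diameter]) auto
    have vk: "(LINT x|lborel. v x * ee (of_int k * x)) = of_real (1 / c) * FT u ((\<theta> + of_int k) / c)" for k :: int
    proof -
      have "FT u ((\<theta> + of_int k) / c) = \<bar>c\<bar> *\<^sub>R (LINT x|lborel. u (0 + c * x) * ee ((\<theta> + of_int k) / c * (0 + c * x)))"
        unfolding FT_def by (rule lborel_integral_real_affine) (use c in auto)
      also have "(\<lambda>x. u (0 + c * x) * ee ((\<theta> + of_int k) / c * (0 + c * x))) = (\<lambda>x. v x * ee (of_int k * x))"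
      proof
        fix x
        have "(\<theta> + of_int k) / c * (0 + c * x) = \<theta> * x + of_int k * x"
          using c by (simp add: field_simps)
        then show "u (0 + c * x) * ee ((\<theta> + of_int k) / c * (0 + c * x)) = v x * ee (of_int k * x)"
          by (simp only: v_def ee_add) simp
      qed
      finally show ?thesis using c by (simp add: scaleR_conv_of_real)
    qed
    have "w (\<theta> + of_int k) = ennreal (c\<^sup>2) * ennreal ((cmod (LINT x|lborel. v x * ee (of_int k * x)))\<^sup>2)" for k :: int
      unfolding vk w_def using c by (simp add: norm_mult norm_divide power_mult_distrib power_divide flip: ennreal_mult)
    then have "(\<integral>\<^sup>+k. w (\<theta> + of_int k) \<partial>count_space (UNIV :: int set)) = ennreal (c\<^sup>2) * (ennreal (1 / c) * ?n)"
      by (simp add: nn_integral_cmult P)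
    also have "\<dots> = ennreal c * ?n"
      using c by (simp add: mult.assoc[symmetric] power2_eq_square flip: ennreal_mult)
    finally show ?thesis .
  qed
  have one: "emeasure unit_measure {0..<1} = 1"
    by (simp add: emeasure_restrict_space)
  have "(\<integral>\<^sup>+x. w x \<partial>lborel) = ennreal c * ?n"
    by (subst nn_integral_periodize) (simp_all add: slice one)
  moreover have "(\<integral>\<^sup>+x. w x \<partial>lborel) = ennreal c * (\<integral>\<^sup>+\<xi>. ennreal ((cmod (FT u \<xi>))\<^sup>2) \<partial>lborel)"
    by (subst nn_integral_real_affine[where c=c and t=0]) (use c in \<open>simp_all add: w_def\<close>)
  ultimately show ?thesis using c
    by (simp add: ennreal_mult_cancel_left)
qed

text \<open>Truncations to [-N, N] satisfy the theorem already. Their transforms converge pointwise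
  because u is integrable, and Fatou's lemma, applied to differences of two truncations, upgrades
  this to convergence in the mean.\<close>

theorem plancherel_real:
  assumes u: "u \<in> L2 lborel" and int: "integrable lborel u"
  shows "(\<integral>\<^sup>+\<xi>. ennreal ((cmod (FT u \<xi>))\<^sup>2) \<partial>lborel) = (\<integral>\<^sup>+t. ennreal ((cmod (u t))\<^sup>2) \<partial>lborel)"
proof -
  have [measurable]: "u \<in> borel_measurable borel" using u by (auto simp: L2_def)
  define U where "U N t = indicator {-real N..real N} t *\<^sub>R u t" for N :: nat and t
  have [measurable]: "U N \<in> borel_measurable borel" for N unfolding U_def by measurable
  have U_le: "cmod (U N t) \<le> cmod (u t)" for N t by (simp add: U_def indicator_def)
  have U_lim: "(\<lambda>N. U N t) \<longlonglongrightarrow> u t" for t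
  proof (rule tendsto_eventually)
    obtain N0 :: nat where "\<bar>t\<bar> \<le> real N0" using real_arch_simple by blast
    then show "\<forall>\<^sub>F N in sequentially. U N t = u t"
      by (intro eventually_sequentiallyI[of N0]) (auto simp: U_def indicator_def)
  qed
  have U2: "U N \<in> L2 lborel" for N
  proof (rule L2I_nn)
    have "(\<integral>\<^sup>+x. ennreal ((cmod (U N x))\<^sup>2) \<partial>lborel) \<le> (\<integral>\<^sup>+x. ennreal ((cmod (u x))\<^sup>2) \<partial>lborel)"
      by (intro nn_integral_mono ennreal_leI power_mono U_le) auto
    then show "(\<integral>\<^sup>+x. ennreal ((cmod (U N x))\<^sup>2) \<partial>lborel) < \<infinity>"
      using L2_nn_finite[OF u] by (rule le_less_trans)
  qed simp
  have plU: "(\<integral>\<^sup>+\<xi>. ennreal ((cmod (FT v \<xi>))\<^sup>2) \<partial>lborel) = (\<integral>\<^sup>+t. ennreal ((cmod (v t))\<^sup>2) \<partial>lborel)"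
    if "v \<in> L2 lborel" "\<And>x. \<bar>x\<bar> > real N \<Longrightarrow> v x = 0" for v and N :: nat
    \<comment> \<open>The added 1 keeps the radius positive for N = 0.\<close>
    by (rule plancherel_compact[of v "real N + 1"]) (use that in auto)
  have iU: "integrable lborel (\<lambda>t. U N t * ee (\<xi> * t))" for N \<xi>
    by (rule Bochner_Integration.integrable_bound[OF int]) (auto simp: norm_mult U_le)
  have FTlim: "(\<lambda>N. FT (U N) \<xi>) \<longlonglongrightarrow> FT u \<xi>" for \<xi>
    unfolding FT_def
    by (rule integral_dominated_convergence[where w="\<lambda>t. cmod (u t)"])
      (auto intro!: tendsto_intros U_lim int simp: norm_mult U_le)
  have diff_bound: "(\<integral>\<^sup>+\<xi>. ennreal ((cmod (FT u \<xi> - FT (U N) \<xi>))\<^sup>2) \<partial>lborel)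
      \<le> ennreal ((L2_norm lborel (\<lambda>t. u t - U N t))\<^sup>2)" for N
  proof -
    have "(\<integral>\<^sup>+\<xi>. ennreal ((cmod (FT u \<xi> - FT (U N) \<xi>))\<^sup>2) \<partial>lborel)
      = (\<integral>\<^sup>+\<xi>. liminf (\<lambda>K. ennreal ((cmod (FT (\<lambda>t. U K t - U N t) \<xi>))\<^sup>2)) \<partial>lborel)"
    proof (rule nn_integral_cong)
      fix \<xi>
      have "FT (\<lambda>t. U K t - U N t) \<xi> = FT (U K) \<xi> - FT (U N) \<xi>" for K
        using iU unfolding FT_def by (simp add: left_diff_distrib)
      then have "(\<lambda>K. ennreal ((cmod (FT (\<lambda>t. U K t - U N t) \<xi>))\<^sup>2)) \<longlonglongrightarrow> ennreal ((cmod (FT u \<xi> - FT (U N) \<xi>))\<^sup>2)"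
        by (auto intro!: tendsto_intros FTlim)
      from lim_imp_Liminf[OF _ this]
      show "ennreal ((cmod (FT u \<xi> - FT (U N) \<xi>))\<^sup>2) = liminf (\<lambda>K. ennreal ((cmod (FT (\<lambda>t. U K t - U N t) \<xi>))\<^sup>2))"
        by simp
    qed
    also have "\<dots> \<le> liminf (\<lambda>K. \<integral>\<^sup>+\<xi>. ennreal ((cmod (FT (\<lambda>t. U K t - U N t) \<xi>))\<^sup>2) \<partial>lborel)"
      by (rule nn_integral_liminf) measurable
    also have "\<dots> \<le> ennreal ((L2_norm lborel (\<lambda>t. u t - U N t))\<^sup>2)"
    proof (rule order_trans[OF Liminf_le_Limsup], simp, rule Limsup_bounded)
      show "\<forall>\<^sub>F K in sequentially. (\<integral>\<^sup>+\<xi>. ennreal ((cmod (FT (\<lambda>t. U K t - U N t) \<xi>))\<^sup>2) \<partial>lborel)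
          \<le> ennreal ((L2_norm lborel (\<lambda>t. u t - U N t))\<^sup>2)"
      proof (rule eventually_sequentiallyI[of N])
        fix K assume "N \<le> K"
        have "(\<integral>\<^sup>+\<xi>. ennreal ((cmod (FT (\<lambda>t. U K t - U N t) \<xi>))\<^sup>2) \<partial>lborel)
            = (\<integral>\<^sup>+t. ennreal ((cmod (U K t - U N t))\<^sup>2) \<partial>lborel)"
          by (rule plU[of _ K, OF L2_diff[OF U2 U2]]) (use \<open>N \<le> K\<close> in \<open>auto simp: U_def indicator_def\<close>)
        also have "\<dots> \<le> (\<integral>\<^sup>+t. ennreal ((cmod (u t - U N t))\<^sup>2) \<partial>lborel)"
          using \<open>N \<le> K\<close> by (intro nn_integral_mono ennreal_leI power_mono) (auto simp: U_def indicator_def)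
        also have "\<dots> = ennreal ((L2_norm lborel (\<lambda>t. u t - U N t))\<^sup>2)"
          by (rule L2_norm_sq_nn[symmetric]) (intro L2_diff u U2)
        finally show "(\<integral>\<^sup>+\<xi>. ennreal ((cmod (FT (\<lambda>t. U K t - U N t) \<xi>))\<^sup>2) \<partial>lborel)
          \<le> ennreal ((L2_norm lborel (\<lambda>t. u t - U N t))\<^sup>2)" .
      qed
    qed
    finally show ?thesis .
  qed
  have plUN: "(\<integral>\<^sup>+\<xi>. ennreal ((cmod (FT (U N) \<xi>))\<^sup>2) \<partial>lborel) = (\<integral>\<^sup>+t. ennreal ((cmod (U N t))\<^sup>2) \<partial>lborel)" for N
    by (rule plU[OF U2, of N]) (auto simp: U_def indicator_def)
  have FU: "FT (U N) \<in> L2 lborel" for N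
    by (rule L2I_nn) (use L2_nn_finite[OF U2] in \<open>auto simp: plUN\<close>)
  have FD: "(\<lambda>\<xi>. FT u \<xi> - FT (U N) \<xi>) \<in> L2 lborel" for N
    by (rule L2I_nn) (auto intro: le_less_trans[OF diff_bound])
  have Fu: "FT u \<in> L2 lborel" using L2_add[OF FD FU, of 0 0] by simp
  have Ulim2: "(\<lambda>N. L2_norm lborel (\<lambda>t. u t - U N t)) \<longlonglongrightarrow> 0"
  proof -
    have "(\<lambda>N. LINT t|lborel. (cmod (u t - U N t))\<^sup>2) \<longlonglongrightarrow> (LINT t|(lborel :: real measure). (0::real))"
    proof (rule integral_dominated_convergence[where w="\<lambda>t. (cmod (u t))\<^sup>2" and f="\<lambda>t. 0"
        and s="\<lambda>N t. (cmod (u t - U N t))\<^sup>2"])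
      have "(\<lambda>N. (cmod (u t - U N t))\<^sup>2) \<longlonglongrightarrow> (cmod (u t - u t))\<^sup>2" for t
        by (intro tendsto_intros U_lim)
      then show "AE t in lborel. (\<lambda>N. (cmod (u t - U N t))\<^sup>2) \<longlonglongrightarrow> 0" by simp
    qed (auto simp: L2_sq_integrable[OF u] U_def indicator_def)
    then have "(\<lambda>N. sqrt (LINT t|lborel. (cmod (u t - U N t))\<^sup>2)) \<longlonglongrightarrow> sqrt 0"
      by (intro tendsto_real_sqrt) simp
    then show ?thesis by (simp add: L2_norm_def)
  qed
  have le: "L2_norm lborel (\<lambda>\<xi>. FT u \<xi> - FT (U N) \<xi>) \<le> L2_norm lborel (\<lambda>t. u t - U N t)" for N
  proof (rule power2_le_imp_le)
    show "(L2_norm lborel (\<lambda>\<xi>. FT u \<xi> - FT (U N) \<xi>))\<^sup>2 \<le> (L2_norm lborel (\<lambda>t. u t - U N t))\<^sup>2"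
      using diff_bound[of N] by (subst (asm) L2_norm_sq_nn[OF FD, symmetric]) simp
  qed simp
  have A: "(\<lambda>N. L2_norm lborel (FT (U N))) \<longlonglongrightarrow> L2_norm lborel (FT u)"
  proof (rule L2_norm_tendsto[OF FU Fu])
    show "(\<lambda>N. L2_norm lborel (\<lambda>\<xi>. FT (U N) \<xi> - FT u \<xi>)) \<longlonglongrightarrow> 0"
      by (rule Lim_null_comparison[OF _ Ulim2]) (simp add: le L2_norm_minus[of _ _ "FT u"])
  qed
  have eq: "L2_norm lborel (FT (U N)) = L2_norm lborel (U N)" for N
  proof -
    have "ennreal ((L2_norm lborel (FT (U N)))\<^sup>2) = ennreal ((L2_norm lborel (U N))\<^sup>2)"
      unfolding L2_norm_sq_nn[OF FU] L2_norm_sq_nn[OF U2]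
      by (rule plUN)
    then show ?thesis by simp
  qed
  have B: "(\<lambda>N. L2_norm lborel (U N)) \<longlonglongrightarrow> L2_norm lborel u"
    by (rule L2_norm_tendsto[OF U2 u]) (use Ulim2 in \<open>simp add: L2_norm_minus[of _ _ u]\<close>)
  have "L2_norm lborel (FT u) = L2_norm lborel u"
    using LIMSEQ_unique[OF A[unfolded eq] B] .
  then show ?thesis by (simp flip: L2_norm_sq_nn[OF u] L2_norm_sq_nn[OF Fu])
qed

section \<open>Gabor systems\<close>

definition ubox :: "real \<Rightarrow> complex" where
  "ubox t = indicator {0..<1} t"

lemma ubox_measurable [measurable]: "ubox \<in> borel_measurable borel"
  unfolding ubox_def[abs_def] by measurable

lemma cnj_ubox [simp]: "cnj (ubox t) = ubox t"
  by (simp add: ubox_def indicator_def)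

lemma norm_ubox_le: "cmod (ubox t) \<le> 1"
  by (simp add: ubox_def indicator_def)

text \<open>The image of the unit box under the Schroedinger representation with parameter l at the
  group element (x, y, 0).\<close>

definition gabor :: "real \<Rightarrow> real \<Rightarrow> real \<Rightarrow> real \<Rightarrow> complex" where
  "gabor l x y t = ee (- (l * y * t)) * ubox (t - x)"

lemma gabor_measurable [measurable]: "gabor l x y \<in> borel_measurable borel"
  unfolding gabor_def[abs_def] by measurable

lemma gabor_norm: "(\<integral>\<^sup>+t. ennreal ((cmod (gabor l x y t))\<^sup>2) \<partial>lborel) = 1"
proof -
  have "(\<integral>\<^sup>+t. ennreal ((cmod (gabor l x y t))\<^sup>2) \<partial>lborel) = (\<integral>\<^sup>+t. indicator {x..<x+1} t \<partial>lborel)"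
    by (intro nn_integral_cong) (auto simp: gabor_def norm_mult ubox_def indicator_def)
  then show ?thesis by simp
qed

lemma gabor_L2: "gabor l x y \<in> L2 lborel"
  by (rule L2I_nn) (auto simp: gabor_norm)

lemma L2_norm_gabor: "L2_norm lborel (gabor l x y) = 1"
proof -
  have "ennreal ((L2_norm lborel (gabor l x y))\<^sup>2) = ennreal 1"
    using L2_norm_sq_nn[OF gabor_L2[of l x y]] gabor_norm[of l x y] by simp
  then have "(L2_norm lborel (gabor l x y))\<^sup>2 = 1"
    by (subst (asm) ennreal_inj) auto
  then show ?thesis by (simp add: power2_eq_1_iff) (metis L2_norm_nonneg not_one_le_zero neg_0_le_iff_le)
qed

text \<open>The substitution s = l t turns the modulations into integer exponentials and the strip
  into an interval of length |l| <= 1, which packs. Each coefficient acquires a factor |l| and the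
  norm a Jacobian |l|, so the bound is |l| / l^2 = 1 / |l|.\<close>

lemma gabor_parseval_strip:
  assumes l: "l \<noteq> 0" "\<bar>l\<bar> \<le> 1" and v: "v \<in> L2 lborel"
  shows "(\<integral>\<^sup>+k. ennreal ((cmod (L2_inner lborel v (gabor l x (of_int k))))\<^sup>2) \<partial>count_space (UNIV :: int set))
    = ennreal (1 / \<bar>l\<bar>) * (\<integral>\<^sup>+t. ennreal ((cmod (v t))\<^sup>2) * indicator {x..<x+1} t \<partial>lborel)"
proof -
  have [measurable]: "v \<in> borel_measurable borel" using v by (auto simp: L2_def)
  define u where "u s = v (s / l) * ubox (s / l - x)" for s
  have [measurable]: "u \<in> borel_measurable borel" unfolding u_def[abs_def] by measurable
  let ?n = "\<integral>\<^sup>+t. ennreal ((cmod (v t))\<^sup>2) * indicator {x..<x+1} t \<partial>lborel"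
  have nu: "(\<integral>\<^sup>+s. ennreal ((cmod (u s))\<^sup>2) \<partial>lborel) = ennreal \<bar>l\<bar> * ?n"
  proof -
    have "(\<integral>\<^sup>+s. ennreal ((cmod (u s))\<^sup>2) \<partial>lborel) = ennreal \<bar>l\<bar> * (\<integral>\<^sup>+t. ennreal ((cmod (u (0 + l * t)))\<^sup>2) \<partial>lborel)"
      by (rule nn_integral_real_affine) (use l in auto)
    also have "(\<integral>\<^sup>+t. ennreal ((cmod (u (0 + l * t)))\<^sup>2) \<partial>lborel) = ?n"
      using l by (intro nn_integral_cong) (auto simp: u_def norm_mult ubox_def indicator_def)
    finally show ?thesis .
  qed
  have "?n \<le> (\<integral>\<^sup>+t. ennreal ((cmod (v t))\<^sup>2) \<partial>lborel)"
    by (intro nn_integral_mono) (auto simp: indicator_def)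
  then have "?n < \<infinity>" using L2_nn_finite[OF v] by (rule le_less_trans)
  then have u: "u \<in> L2 lborel"
    by (intro L2I_nn) (auto simp: nu ennreal_mult_less_top)
  have pack: "packing {s. s / l - x \<in> {0..<1}}"
  proof (rule packing_diameter)
    fix s t assume "s \<in> {s. s / l - x \<in> {0..<1}}" "t \<in> {s. s / l - x \<in> {0..<1}}"
    then have "\<bar>s / l - t / l\<bar> < 1" by auto
    then have "\<bar>s - t\<bar> < \<bar>l\<bar>" using l by (simp add: diff_divide_distrib[symmetric] abs_divide pos_divide_less_eq)
    then show "\<bar>s - t\<bar> < 1" using l by linarith
  qed
  have supp: "u s = 0" if "s \<notin> {s. s / l - x \<in> {0..<1}}" for s
    using that by (auto simp: u_def ubox_def)
  have coeff: "(LINT s|lborel. u s * ee (of_int k * s)) = of_real \<bar>l\<bar> * L2_inner lborel v (gabor l x (of_int k))" for k :: int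
  proof -
    have "(LINT s|lborel. u s * ee (of_int k * s)) = \<bar>l\<bar> *\<^sub>R (LINT t|lborel. u (0 + l * t) * ee (of_int k * (0 + l * t)))"
      by (rule lborel_integral_real_affine) (use l in auto)
    also have "(\<lambda>t. u (0 + l * t) * ee (of_int k * (0 + l * t))) = (\<lambda>t. v t * cnj (gabor l x (of_int k) t))"
      using l by (auto simp: u_def gabor_def fun_eq_iff mult_ac)
    finally show ?thesis by (simp add: L2_inner_def scaleR_conv_of_real)
  qed
  have "(\<integral>\<^sup>+k. ennreal ((cmod (L2_inner lborel v (gabor l x (of_int k))))\<^sup>2) \<partial>count_space (UNIV :: int set))
    = (\<integral>\<^sup>+k. ennreal (1 / l\<^sup>2) * ennreal ((cmod (LINT s|lborel. u s * ee (of_int k * s)))\<^sup>2) \<partial>count_space (UNIV :: int set))"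
    unfolding coeff using l by (intro nn_integral_cong) (simp add: norm_mult power_mult_distrib flip: ennreal_mult)
  also have "\<dots> = ennreal (1 / l\<^sup>2) * (ennreal \<bar>l\<bar> * ?n)"
    using parseval_packing(2)[OF u supp pack] by (simp add: nn_integral_cmult nu)
  also have "\<dots> = ennreal (1 / \<bar>l\<bar>) * ?n"
  proof -
    have "1 / l\<^sup>2 * \<bar>l\<bar> = 1 / \<bar>l\<bar>" using l by (simp add: power2_eq_square divide_simps abs_if)
    then show ?thesis by (simp add: mult.assoc[symmetric] flip: ennreal_mult)
  qed
  finally show ?thesis .
qed

lemma gabor_parseval:
  assumes l: "l \<noteq> 0" "\<bar>l\<bar> \<le> 1" and v: "v \<in> L2 lborel"
  shows "(\<integral>\<^sup>+n. (\<integral>\<^sup>+k. ennreal ((cmod (L2_inner lborel v (gabor l (of_int n) (of_int k))))\<^sup>2)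
        \<partial>count_space (UNIV :: int set)) \<partial>count_space (UNIV :: int set))
    = ennreal (1 / \<bar>l\<bar>) * ennreal ((L2_norm lborel v)\<^sup>2)"
proof -
  have [measurable]: "v \<in> borel_measurable borel" using v by (auto simp: L2_def)
  have "(\<integral>\<^sup>+n. (\<integral>\<^sup>+t. ennreal ((cmod (v t))\<^sup>2) * indicator {of_int n..<of_int n+1} t \<partial>lborel) \<partial>count_space (UNIV :: int set))
    = (\<integral>\<^sup>+t. (\<integral>\<^sup>+n. ennreal ((cmod (v t))\<^sup>2) * indicator {of_int n..<of_int n+1} t \<partial>count_space (UNIV :: int set)) \<partial>lborel)"
    by (intro nn_integral_count_space_nn_integral[symmetric]) auto
  also have "\<dots> = ennreal ((L2_norm lborel v)\<^sup>2)"
    by (simp add: nn_integral_count_indicator_floor L2_norm_sq_nn[OF v])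
  finally show ?thesis
    by (simp add: gabor_parseval_strip[OF l v] nn_integral_cmult)
qed

section \<open>A Gabor orthonormal basis and the Hilbert-Schmidt basis\<close>

definition int2_decode :: "nat \<Rightarrow> int \<times> int" where
  "int2_decode j = map_prod int_decode int_decode (prod_decode j)"

lemma bij_int2_decode: "bij int2_decode"
proof -
  have "bij (map_prod int_decode int_decode)"
    unfolding bij_def by (auto intro!: prod.inj_map surj_int_decode inj_int_decode map_prod_surj)
  then show ?thesis
    unfolding int2_decode_def[abs_def] using bij_comp[OF bij_prod_decode] by (simp add: comp_def)
qed

definition gabor_basis :: "nat \<Rightarrow> real \<Rightarrow> complex" where
  "gabor_basis j = (case int2_decode j of (n, k) \<Rightarrow> gabor 1 (of_int n) (of_int k))"

lemma gabor_orthonormal: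
  "L2_inner lborel (gabor 1 (of_int n) (of_int k)) (gabor 1 (of_int n') (of_int k'))
    = (if n = n' \<and> k = k' then 1 else 0)"
proof (cases "n = n'")
  case False
  have "ubox (t - of_int n) * ubox (t - of_int n') = 0" for t
  proof -
    have "\<not> (t - of_int n \<in> {0..<1} \<and> t - of_int n' \<in> {0..<1})"
    proof
      assume "t - of_int n \<in> {0..<1} \<and> t - of_int n' \<in> {0..<1}"
      then have "\<bar>of_int n - of_int n' :: real\<bar> < 1" by auto
      with False show False by linarith
    qed
    then show ?thesis by (auto simp: ubox_def)
  qed
  then have z: "gabor 1 (of_int n) (of_int k) t * cnj (gabor 1 (of_int n') (of_int k') t) = 0" for t
    by (auto simp: gabor_def)
  show ?thesis using False unfolding L2_inner_def z by simp
next
  case True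
  have "L2_inner lborel (gabor 1 (of_int n) (of_int k)) (gabor 1 (of_int n') (of_int k'))
    = (LINT t|lborel. ee (of_int (k' - k) * t) * ubox (t - of_int n))"
    unfolding L2_inner_def True gabor_def ubox_def
    by (intro Bochner_Integration.integral_cong) (auto simp: indicator_def algebra_simps simp flip: ee_add)
  also have "\<dots> = (LINT t|lborel. ee (of_int (k' - k) * (of_int n + 1 * t)) * ubox ((of_int n + 1 * t) - of_int n))"
    by (subst lborel_integral_real_affine[where c=1 and t="of_int n"]) auto
  also have "\<dots> = (LINT t|lborel. indicator {0..<1} t *\<^sub>R ee (of_int (k' - k) * t))"
  proof (rule Bochner_Integration.integral_cong[OF refl])
    fix t
    have "ee (of_int (k' - k) * (of_int n + 1 * t)) = ee (of_int ((k' - k) * n)) * ee (of_int (k' - k) * t)"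
      by (simp add: algebra_simps flip: ee_add)
    then show "ee (of_int (k' - k) * (of_int n + 1 * t)) * ubox ((of_int n + 1 * t) - of_int n) = indicator {0..<1} t *\<^sub>R ee (of_int (k' - k) * t)"
      by (simp only: ee_of_int) (simp add: ubox_def indicator_def)
  qed
  also have "\<dots> = (LINT t|unit_measure. ee (of_int (k' - k) * t))"
    by (simp add: integral_restrict_space)
  finally show ?thesis using True unfolding integral_unit_ee by auto
qed

lemma orthonormal_basis_iff: "orthonormal_basis e \<longleftrightarrow> total_orthonormal lborel e"
  by (auto simp: orthonormal_basis_def total_orthonormal_def orthonormal_seq_def)

text \<open>At l = 1 the Gabor frame bound is 1, so a vector orthogonal to the whole system has norm
  0. Existence of a basis is what gives the choice inside \<open>HS_norm_sq\<close> its
  meaning.\<close>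

lemma orthonormal_basis_gabor: "orthonormal_basis gabor_basis"
  unfolding orthonormal_basis_def
proof (intro conjI allI ballI impI)
  fix j show "gabor_basis j \<in> L2R"
    by (auto simp: gabor_basis_def gabor_L2 split: prod.split)
next
  fix i j
  obtain n k n' k' where d: "int2_decode i = (n, k)" "int2_decode j = (n', k')" by fastforce
  have "i = j \<longleftrightarrow> int2_decode i = int2_decode j"
    using bij_int2_decode by (auto simp: bij_def inj_eq)
  then show "L2_inner lborel (gabor_basis i) (gabor_basis j) = (if i = j then 1 else 0)"
    by (simp add: gabor_basis_def d gabor_orthonormal)
next
  fix v assume v: "v \<in> L2R" and 0: "\<forall>n. L2_inner lborel v (gabor_basis n) = 0"
  have "L2_inner lborel v (gabor 1 (of_int n) (of_int k)) = 0" for n k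
  proof -
    obtain j where "int2_decode j = (n, k)" using bij_int2_decode by (metis bij_pointE)
    then show ?thesis using 0[rule_format, of j] by (simp add: gabor_basis_def)
  qed
  then have "ennreal ((L2_norm lborel v)\<^sup>2) = 0"
    using gabor_parseval[of 1 v] v by simp
  then have "L2_norm lborel v = 0" by (simp add: ennreal_eq_0_iff)
  then show "AE t in lborel. v t = 0" using L2_norm_eq_0_iff[OF v] by simp
qed

definition hs_basis :: "nat \<Rightarrow> real \<Rightarrow> complex" where
  "hs_basis = (SOME e. orthonormal_basis e)"

lemma total_hs_basis: "total_orthonormal lborel hs_basis"
  unfolding hs_basis_def orthonormal_basis_iff[symmetric]
  by (rule someI[where P=orthonormal_basis, OF orthonormal_basis_gabor])

lemma orthonormal_hs_basis: "orthonormal_seq lborel hs_basis"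
  using total_hs_basis by (simp add: total_orthonormal_def)

lemma hs_basis_L2: "hs_basis n \<in> L2 lborel"
  by (rule orthonormal_seqD(1)[OF orthonormal_hs_basis])

lemma hs_basis_measurable [measurable]: "hs_basis n \<in> borel_measurable borel"
  using L2_measurable[OF hs_basis_L2] by simp

lemma hs_parseval:
  assumes "v \<in> L2 lborel"
  shows "ennreal ((L2_norm lborel v)\<^sup>2) = (\<Sum>n. ennreal ((cmod (L2_inner lborel v (hs_basis n)))\<^sup>2))"
  by (rule ennreal_sums_eq[symmetric, OF total_orthonormal_expansion(2)[OF total_hs_basis assms]]) simp

lemma HS_norm_sq_eq: "HS_norm_sq T = (\<Sum>n. ennreal ((L2_norm lborel (T (hs_basis n)))\<^sup>2))"
  by (simp add: HS_norm_sq_def hs_basis_def Let_def)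

section \<open>Hilbert--Schmidt operators\<close>

lemma operator_L2: "bounded_operator T \<Longrightarrow> \<phi> \<in> L2R \<Longrightarrow> T \<phi> \<in> L2R"
  by (simp add: bounded_operator_def)

lemma operator_linear:
  "bounded_operator T \<Longrightarrow> \<phi> \<in> L2R \<Longrightarrow> \<psi> \<in> L2R \<Longrightarrow>
    AE t in lborel. T (\<lambda>s. a * \<phi> s + b * \<psi> s) t = a * T \<phi> t + b * T \<psi> t"
  unfolding bounded_operator_def by blast

lemma operator_bound:
  assumes "bounded_operator T"
  obtains C where "C \<ge> 0" "\<And>\<phi>. \<phi> \<in> L2R \<Longrightarrow> L2_norm lborel (T \<phi>) \<le> C * L2_norm lborel \<phi>"
proof -
  obtain C where C: "\<And>\<phi>. \<phi> \<in> L2R \<Longrightarrow> L2_norm lborel (T \<phi>) \<le> C * L2_norm lborel \<phi>"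
    using assms unfolding bounded_operator_def by blast
  have "L2_norm lborel (T \<phi>) \<le> \<bar>C\<bar> * L2_norm lborel \<phi>" if "\<phi> \<in> L2R" for \<phi>
    using C[OF that] mult_right_mono[of C "\<bar>C\<bar>" "L2_norm lborel \<phi>", OF abs_ge_self L2_norm_nonneg] by linarith
  then show thesis by (intro that[of "\<bar>C\<bar>"]) auto
qed

lemma operator_sum:
  assumes T: "bounded_operator T" and f: "\<And>i. f i \<in> L2R"
  shows "AE t in lborel. T (\<lambda>s. \<Sum>i<N. c i * f i s) t = (\<Sum>i<(N::nat). c i * T (f i) t)"
proof (induction N)
  case 0
  show ?case using operator_linear[OF T L2_zero L2_zero, of 0 0] by simp
next
  case (Suc N)
  have L: "(\<lambda>s. \<Sum>i<N. c i * f i s) \<in> L2R" by (intro L2_sum L2_scale f)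
  from operator_linear[OF T L f[of N], of 1 "c N"] Suc show ?case
    by eventually_elim simp
qed

lemma operator_diff:
  assumes "bounded_operator T" "\<phi> \<in> L2R" "\<psi> \<in> L2R"
  shows "AE t in lborel. T (\<lambda>s. \<phi> s - \<psi> s) t = T \<phi> t - T \<psi> t"
  using operator_linear[OF assms, of 1 "-1"] by simp

text \<open>Boundedness carries the basis expansion of the argument through T. Linearity holds only
  almost everywhere, so finite sums are compared under the inner product rather than
  pointwise.\<close>

lemma operator_inner_sums:
  assumes T: "bounded_operator T" and \<phi>: "\<phi> \<in> L2R" and \<psi>: "\<psi> \<in> L2R"
  shows "(\<lambda>i. L2_inner lborel \<phi> (hs_basis i) * L2_inner lborel (T (hs_basis i)) \<psi>) sums L2_inner lborel (T \<phi>) \<psi>"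
proof -
  let ?c = "\<lambda>i. L2_inner lborel \<phi> (hs_basis i)"
  define p where "p N s = (\<Sum>i<N. ?c i * hs_basis i s)" for N s
  have p: "p N \<in> L2R" for N unfolding p_def by (intro L2_sum L2_scale hs_basis_L2)
  note L2_measurable[OF operator_L2[OF T], measurable] L2_measurable[OF \<psi>, measurable]
  note meas = L2_measurable[OF operator_L2[OF T]]
  obtain C where C: "C \<ge> 0" "\<And>\<phi>. \<phi> \<in> L2R \<Longrightarrow> L2_norm lborel (T \<phi>) \<le> C * L2_norm lborel \<phi>"
    by (rule operator_bound[OF T]) blast
  have lim: "(\<lambda>N. L2_norm lborel (\<lambda>x. T (p N) x - T \<phi> x)) \<longlonglongrightarrow> 0"
  proof (rule Lim_null_comparison)
    show "\<forall>\<^sub>F N in sequentially. norm (L2_norm lborel (\<lambda>x. T (p N) x - T \<phi> x)) \<le> C * L2_norm lborel (\<lambda>s. p N s - \<phi> s)"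
    proof (intro always_eventually allI)
      fix N
      have "L2_norm lborel (\<lambda>x. T (p N) x - T \<phi> x) = L2_norm lborel (T (\<lambda>s. p N s - \<phi> s))"
        using AE_symmetric[OF operator_diff[OF T p \<phi>]]
        by (intro L2_norm_cong_AE borel_measurable_diff meas p \<phi> L2_diff) auto
      also have "\<dots> \<le> C * L2_norm lborel (\<lambda>s. p N s - \<phi> s)"
        by (rule C(2)) (intro L2_diff p \<phi>)
      finally show "norm (L2_norm lborel (\<lambda>x. T (p N) x - T \<phi> x)) \<le> C * L2_norm lborel (\<lambda>s. p N s - \<phi> s)"
        by simp
    qed
    show "(\<lambda>N. C * L2_norm lborel (\<lambda>s. p N s - \<phi> s)) \<longlonglongrightarrow> 0"
      unfolding p_def by (rule tendsto_mult_right_zero[OF total_orthonormal_expansion(1)[OF total_hs_basis \<phi>]])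
  qed
  have "(\<lambda>N. L2_inner lborel (T (p N)) \<psi>) \<longlonglongrightarrow> L2_inner lborel (T \<phi>) \<psi>"
    by (rule L2_inner_tendsto_left[OF operator_L2[OF T p] operator_L2[OF T \<phi>] \<psi> lim])
  moreover have "L2_inner lborel (T (p N)) \<psi> = (\<Sum>i<N. ?c i * L2_inner lborel (T (hs_basis i)) \<psi>)" for N
  proof -
    have "L2_inner lborel (T (p N)) \<psi> = L2_inner lborel (\<lambda>t. \<Sum>i<N. ?c i * T (hs_basis i) t) \<psi>"
    proof (rule L2_inner_cong_AE)
      show "AE t in lborel. T (p N) t = (\<Sum>i<N. ?c i * T (hs_basis i) t)"
        using operator_sum[OF T hs_basis_L2, where N=N and c="?c"] unfolding p_def[abs_def] .
      show "(\<lambda>t. \<Sum>i<N. ?c i * T (hs_basis i) t) \<in> borel_measurable lborel"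
        by (rule L2_measurable) (intro L2_sum L2_scale operator_L2[OF T] hs_basis_L2)
    qed (rule meas p L2_measurable[OF \<psi>])+
    also have "\<dots> = (\<Sum>i<N. ?c i * L2_inner lborel (T (hs_basis i)) \<psi>)"
      by (subst L2_inner_sum_left) (auto intro!: L2_scale operator_L2[OF T] hs_basis_L2 \<psi> simp: L2_inner_scale_left)
    finally show ?thesis .
  qed
  ultimately show ?thesis by (simp add: sums_def)
qed

lemma HS_partial_sum_le:
  assumes "HS_norm_sq T < \<infinity>"
  shows "(\<Sum>i<N. (L2_norm lborel (T (hs_basis i)))\<^sup>2) \<le> enn2real (HS_norm_sq T)"
proof -
  have "ennreal (\<Sum>i<N. (L2_norm lborel (T (hs_basis i)))\<^sup>2) \<le> HS_norm_sq T"
    unfolding HS_norm_sq_eq sum_ennreal[symmetric, OF zero_le_power2] by (rule sum_le_suminf) auto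
  also have "HS_norm_sq T = ennreal (enn2real (HS_norm_sq T))" using assms by simp
  finally show ?thesis by (subst (asm) ennreal_le_iff) auto
qed

text \<open>The operator norm is at most the Hilbert-Schmidt norm: expand the argument in the basis
  and apply the Cauchy-Schwarz inequality to the two coefficient sequences.\<close>

lemma HS_operator_bound:
  assumes T: "bounded_operator T" and fin: "HS_norm_sq T < \<infinity>" and \<phi>: "\<phi> \<in> L2R" and \<psi>: "\<psi> \<in> L2R"
  shows "cmod (L2_inner lborel (T \<phi>) \<psi>) \<le> sqrt (enn2real (HS_norm_sq T)) * L2_norm lborel \<phi> * L2_norm lborel \<psi>"
proof (rule LIMSEQ_le_const2)
  let ?c = "\<lambda>i. L2_inner lborel \<phi> (hs_basis i)" and ?d = "\<lambda>i. L2_inner lborel (T (hs_basis i)) \<psi>"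
  show "(\<lambda>N. cmod (\<Sum>i<N. ?c i * ?d i)) \<longlonglongrightarrow> cmod (L2_inner lborel (T \<phi>) \<psi>)"
    using operator_inner_sums[OF T \<phi> \<psi>] unfolding sums_def by (rule tendsto_norm)
  have "cmod (\<Sum>i<N. ?c i * ?d i) \<le> sqrt (enn2real (HS_norm_sq T)) * L2_norm lborel \<phi> * L2_norm lborel \<psi>" for N
  proof -
    have "cmod (\<Sum>i<N. ?c i * ?d i) \<le> (\<Sum>i<N. \<bar>cmod (?c i)\<bar> * \<bar>cmod (?d i)\<bar>)"
      by (rule order_trans[OF norm_sum]) (simp add: norm_mult)
    also have "\<dots> \<le> L2_set (\<lambda>i. cmod (?c i)) {..<N} * L2_set (\<lambda>i. cmod (?d i)) {..<N}"
      by (rule L2_set_mult_ineq)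
    also have "\<dots> \<le> L2_norm lborel \<phi> * (sqrt (enn2real (HS_norm_sq T)) * L2_norm lborel \<psi>)"
    proof (rule mult_mono)
      have "(\<Sum>i<N. (cmod (?c i))\<^sup>2) \<le> (L2_norm lborel \<phi>)\<^sup>2"
        using sums_unique[OF total_orthonormal_expansion(2)[OF total_hs_basis \<phi>]]
          sums_summable[OF total_orthonormal_expansion(2)[OF total_hs_basis \<phi>]]
        by (metis sum_le_suminf finite_lessThan zero_le_power2)
      then show "L2_set (\<lambda>i. cmod (?c i)) {..<N} \<le> L2_norm lborel \<phi>"
        unfolding L2_set_def by (intro real_le_lsqrt) auto
      have "(\<Sum>i<N. (cmod (?d i))\<^sup>2) \<le> (\<Sum>i<N. (L2_norm lborel (T (hs_basis i)) * L2_norm lborel \<psi>)\<^sup>2)"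
        by (intro sum_mono power_mono L2_Cauchy_Schwarz operator_L2[OF T] hs_basis_L2 \<psi>) auto
      also have "\<dots> = (\<Sum>i<N. (L2_norm lborel (T (hs_basis i)))\<^sup>2) * (L2_norm lborel \<psi>)\<^sup>2"
        by (simp add: power_mult_distrib sum_distrib_right)
      also have "\<dots> \<le> enn2real (HS_norm_sq T) * (L2_norm lborel \<psi>)\<^sup>2"
        by (intro mult_right_mono HS_partial_sum_le fin) auto
      finally have "sqrt (\<Sum>i<N. (cmod (?d i))\<^sup>2) \<le> sqrt (enn2real (HS_norm_sq T) * (L2_norm lborel \<psi>)\<^sup>2)"
        by (rule real_sqrt_le_mono)
      then show "L2_set (\<lambda>i. cmod (?d i)) {..<N} \<le> sqrt (enn2real (HS_norm_sq T)) * L2_norm lborel \<psi>"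
        by (simp add: L2_set_def real_sqrt_mult)
    qed auto
    finally show ?thesis by (simp add: mult_ac)
  qed
  then show "\<exists>N. \<forall>n\<ge>N. cmod (\<Sum>i<n. ?c i * ?d i) \<le> sqrt (enn2real (HS_norm_sq T)) * L2_norm lborel \<phi> * L2_norm lborel \<psi>"
    by blast
qed

text \<open>The vector w is the adjoint of T applied to the test vector. Its coefficients are
  prescribed by the images of the basis, and the Hilbert-Schmidt condition makes them
  square-summable.\<close>

lemma operator_riesz:
  assumes T: "bounded_operator T" and fin: "HS_norm_sq T < \<infinity>" and \<psi>: "\<psi> \<in> L2R"
  obtains w where "w \<in> L2R" "\<And>\<phi>. \<phi> \<in> L2R \<Longrightarrow> L2_inner lborel (T \<phi>) \<psi> = L2_inner lborel \<phi> w"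
proof -
  let ?d = "\<lambda>i. L2_inner lborel (T (hs_basis i)) \<psi>"
  have "summable (\<lambda>i. (cmod (cnj (?d i)))\<^sup>2)"
  proof (rule bounded_imp_summable)
    fix n
    have "(\<Sum>i\<le>n. (cmod (?d i))\<^sup>2) \<le> (\<Sum>i<Suc n. (L2_norm lborel (T (hs_basis i)) * L2_norm lborel \<psi>)\<^sup>2)"
      unfolding lessThan_Suc_atMost
      by (intro sum_mono power_mono L2_Cauchy_Schwarz operator_L2[OF T] hs_basis_L2 \<psi>) auto
    also have "\<dots> = (\<Sum>i<Suc n. (L2_norm lborel (T (hs_basis i)))\<^sup>2) * (L2_norm lborel \<psi>)\<^sup>2"
      by (simp add: power_mult_distrib sum_distrib_right distrib_right)
    also have "\<dots> \<le> enn2real (HS_norm_sq T) * (L2_norm lborel \<psi>)\<^sup>2"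
      by (intro mult_right_mono HS_partial_sum_le fin) auto
    finally show "(\<Sum>i\<le>n. (cmod (cnj (?d i)))\<^sup>2) \<le> enn2real (HS_norm_sq T) * (L2_norm lborel \<psi>)\<^sup>2" by simp
  qed simp
  then obtain w where w: "w \<in> L2R" "\<And>n. L2_inner lborel w (hs_basis n) = cnj (?d n)"
    by (rule riesz_fischer[OF orthonormal_hs_basis]) blast
  have "L2_inner lborel (T \<phi>) \<psi> = L2_inner lborel \<phi> w" if \<phi>: "\<phi> \<in> L2R" for \<phi>
  proof (rule sums_unique2[OF operator_inner_sums[OF T \<phi> \<psi>]])
    let ?c = "\<lambda>i. L2_inner lborel \<phi> (hs_basis i)"
    have "(\<lambda>N. L2_inner lborel (\<lambda>x. \<Sum>i<N. ?c i * hs_basis i x) w) \<longlonglongrightarrow> L2_inner lborel \<phi> w"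
      by (rule L2_inner_tendsto_left[OF _ \<phi> w(1) total_orthonormal_expansion(1)[OF total_hs_basis \<phi>]])
        (intro L2_sum L2_scale hs_basis_L2)
    moreover have "L2_inner lborel (\<lambda>x. \<Sum>i<N. ?c i * hs_basis i x) w = (\<Sum>i<N. ?c i * ?d i)" for N
      by (subst L2_inner_sum_left)
        (auto intro!: L2_scale hs_basis_L2 w simp: L2_inner_scale_left L2_inner_cnj[of _ "hs_basis _" w] w(2))
    ultimately show "(\<lambda>i. ?c i * ?d i) sums L2_inner lborel \<phi> w" by (simp add: sums_def)
  qed
  with w(1) show thesis by (rule that)
qed

text \<open>With w n the adjoint image of the n-th basis vector, the frame identity is applied to
  each w n. Summing over n gives the Hilbert-Schmidt norm of the adjoint, and exchanging the double
  sum of matrix coefficients returns that of T.\<close>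

lemma HS_frame:
  fixes B :: "'m :: countable \<Rightarrow> real \<Rightarrow> complex"
  assumes T: "bounded_operator T" and fin: "HS_norm_sq T < \<infinity>" and B: "\<And>m. B m \<in> L2R"
    and frame: "\<And>v. v \<in> L2R \<Longrightarrow>
      (\<integral>\<^sup>+m. ennreal ((cmod (L2_inner lborel v (B m)))\<^sup>2) \<partial>count_space UNIV) = a * ennreal ((L2_norm lborel v)\<^sup>2)"
  shows "(\<integral>\<^sup>+m. ennreal ((L2_norm lborel (T (B m)))\<^sup>2) \<partial>count_space UNIV) = a * HS_norm_sq T"
proof -
  have "\<exists>w\<in>L2R. \<forall>\<phi>\<in>L2R. L2_inner lborel (T \<phi>) (hs_basis n) = L2_inner lborel \<phi> w" for n
    by (rule operator_riesz[OF T fin hs_basis_L2[of n]]) blast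
  then obtain w where w: "\<And>n. w n \<in> L2R"
      "\<And>n \<phi>. \<phi> \<in> L2R \<Longrightarrow> L2_inner lborel (T \<phi>) (hs_basis n) = L2_inner lborel \<phi> (w n)"
    by metis
  have cw: "cmod (L2_inner lborel (T \<phi>) (hs_basis n)) = cmod (L2_inner lborel (w n) \<phi>)" if "\<phi> \<in> L2R" for n \<phi>
    using w(2)[OF that, of n] L2_inner_cnj[of lborel "w n" \<phi>] by simp
  have "(\<integral>\<^sup>+m. ennreal ((L2_norm lborel (T (B m)))\<^sup>2) \<partial>count_space UNIV)
    = (\<integral>\<^sup>+m. (\<Sum>n. ennreal ((cmod (L2_inner lborel (w n) (B m)))\<^sup>2)) \<partial>count_space UNIV)"
    unfolding hs_parseval[OF operator_L2[OF T B]] cw[OF B] ..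
  also have "\<dots> = (\<Sum>n. \<integral>\<^sup>+m. ennreal ((cmod (L2_inner lborel (w n) (B m)))\<^sup>2) \<partial>count_space UNIV)"
    by (rule nn_integral_suminf) simp
  also have "\<dots> = (\<Sum>n. a * (\<Sum>i. ennreal ((cmod (L2_inner lborel (T (hs_basis i)) (hs_basis n)))\<^sup>2)))"
    unfolding frame[OF w(1)] hs_parseval[OF w(1)] cw[OF hs_basis_L2] ..
  also have "\<dots> = a * (\<Sum>n. \<Sum>i. ennreal ((cmod (L2_inner lborel (T (hs_basis i)) (hs_basis n)))\<^sup>2))"
    by simp
  also have "(\<Sum>n. \<Sum>i. ennreal ((cmod (L2_inner lborel (T (hs_basis i)) (hs_basis n)))\<^sup>2))
    = (\<Sum>i. \<Sum>n. ennreal ((cmod (L2_inner lborel (T (hs_basis i)) (hs_basis n)))\<^sup>2))"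
    unfolding nn_integral_count_space_nat[symmetric] by (intro nn_integral_count_space_nn_integral) auto
  also have "\<dots> = HS_norm_sq T"
    unfolding HS_norm_sq_eq hs_parseval[OF operator_L2[OF T hs_basis_L2]] ..
  finally show ?thesis .
qed

lemma bounded_operator_diff:
  assumes "bounded_operator G" "bounded_operator T"
  shows "bounded_operator (\<lambda>\<phi> t. G \<phi> t - T \<phi> t)"
  unfolding bounded_operator_def
proof (intro conjI ballI allI)
  fix \<phi> assume \<phi>: "\<phi> \<in> L2R"
  then show "(\<lambda>t. G \<phi> t - T \<phi> t) \<in> L2R" by (intro L2_diff operator_L2[OF assms(1)] operator_L2[OF assms(2)])
  fix \<psi> a b assume \<psi>: "\<psi> \<in> L2R"
  from operator_linear[OF assms(1) \<phi> \<psi>, of a b] operator_linear[OF assms(2) \<phi> \<psi>, of a b]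
  show "AE t in lborel. G (\<lambda>s. a * \<phi> s + b * \<psi> s) t - T (\<lambda>s. a * \<phi> s + b * \<psi> s) t
    = a * (G \<phi> t - T \<phi> t) + b * (G \<psi> t - T \<psi> t)"
    by eventually_elim (simp add: algebra_simps)
next
  obtain C where C: "\<And>\<phi>. \<phi> \<in> L2R \<Longrightarrow> L2_norm lborel (G \<phi>) \<le> C * L2_norm lborel \<phi>"
    by (rule operator_bound[OF assms(1)]) blast
  obtain D where D: "\<And>\<phi>. \<phi> \<in> L2R \<Longrightarrow> L2_norm lborel (T \<phi>) \<le> D * L2_norm lborel \<phi>"
    by (rule operator_bound[OF assms(2)]) blast
  have "L2_norm lborel (\<lambda>t. G \<phi> t - T \<phi> t) \<le> (C + D) * L2_norm lborel \<phi>" if "\<phi> \<in> L2R" for \<phi>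
  proof -
    have "L2_norm lborel (\<lambda>t. G \<phi> t + (- 1) * T \<phi> t) \<le> L2_norm lborel (G \<phi>) + L2_norm lborel (\<lambda>t. (- 1) * T \<phi> t)"
      by (intro L2_triangle L2_scale operator_L2[OF assms(1)] operator_L2[OF assms(2)] that)
    then show ?thesis using C[OF that] D[OF that] unfolding L2_norm_scale by (simp add: distrib_right)
  qed
  then show "\<exists>C. \<forall>\<phi>\<in>L2R. L2_norm lborel (\<lambda>t. G \<phi> t - T \<phi> t) \<le> C * L2_norm lborel \<phi>" by blast
qed

text \<open>A triangle inequality for squares with loss factor 1 + epsilon. It integrates and sums
  termwise, hence lifts to Hilbert-Schmidt and field norms in \<open>ennreal\<close> without taking
  roots; epsilon tends to 0 at the end.\<close>

lemma cmod_sq_eps: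
  assumes "\<epsilon> > 0"
  shows "(cmod a)\<^sup>2 \<le> (1 + \<epsilon>) * (cmod b)\<^sup>2 + (1 + 1/\<epsilon>) * (cmod (a - b))\<^sup>2"
proof -
  let ?x = "cmod b" and ?y = "cmod (a - b)"
  have "cmod a \<le> ?x + ?y" using norm_triangle_ineq[of b "a - b"] by simp
  then have "(cmod a)\<^sup>2 \<le> (?x + ?y)\<^sup>2" by (intro power_mono) auto
  also have "0 \<le> (\<epsilon> * ?x - ?y)\<^sup>2 / \<epsilon>" using assms by simp
  then have "(?x + ?y)\<^sup>2 \<le> (1 + \<epsilon>) * ?x\<^sup>2 + (1 + 1/\<epsilon>) * ?y\<^sup>2"
    using assms by (simp add: power2_eq_square field_simps)
  finally show ?thesis .
qed

lemma L2_norm_sq_eps: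
  assumes "f \<in> L2 M" "g \<in> L2 M" "\<epsilon> > 0"
  shows "(L2_norm M f)\<^sup>2 \<le> (1 + \<epsilon>) * (L2_norm M g)\<^sup>2 + (1 + 1/\<epsilon>) * (L2_norm M (\<lambda>x. f x - g x))\<^sup>2"
proof -
  have "(LINT x|M. (cmod (f x))\<^sup>2) \<le> (LINT x|M. (1 + \<epsilon>) * (cmod (g x))\<^sup>2 + (1 + 1/\<epsilon>) * (cmod (f x - g x))\<^sup>2)"
    using L2_sq_integrable[OF assms(1)] L2_sq_integrable[OF assms(2)] L2_sq_integrable[OF L2_diff[OF assms(1,2)]]
    by (intro integral_mono cmod_sq_eps assms) auto
  also have "\<dots> = (1 + \<epsilon>) * (L2_norm M g)\<^sup>2 + (1 + 1/\<epsilon>) * (L2_norm M (\<lambda>x. f x - g x))\<^sup>2"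
    using L2_sq_integrable[OF assms(2)] L2_sq_integrable[OF L2_diff[OF assms(1,2)]]
    by (simp add: L2_norm_sq)
  finally show ?thesis by (simp add: L2_norm_sq)
qed

lemma HS_norm_sq_eps:
  assumes G: "bounded_operator G" and T: "bounded_operator T" and e: "\<epsilon> > 0"
  shows "HS_norm_sq G \<le> ennreal (1 + \<epsilon>) * HS_norm_sq T + ennreal (1 + 1/\<epsilon>) * HS_norm_sq (\<lambda>\<phi> t. G \<phi> t - T \<phi> t)"
proof -
  have "HS_norm_sq G \<le> (\<Sum>n. ennreal (1 + \<epsilon>) * ennreal ((L2_norm lborel (T (hs_basis n)))\<^sup>2)
      + ennreal (1 + 1/\<epsilon>) * ennreal ((L2_norm lborel (\<lambda>t. G (hs_basis n) t - T (hs_basis n) t))\<^sup>2))"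
    unfolding HS_norm_sq_eq
  proof (rule suminf_le)
    fix n
    show "ennreal ((L2_norm lborel (G (hs_basis n)))\<^sup>2) \<le> ennreal (1 + \<epsilon>) * ennreal ((L2_norm lborel (T (hs_basis n)))\<^sup>2)
      + ennreal (1 + 1/\<epsilon>) * ennreal ((L2_norm lborel (\<lambda>t. G (hs_basis n) t - T (hs_basis n) t))\<^sup>2)"
      using L2_norm_sq_eps[OF operator_L2[OF G hs_basis_L2] operator_L2[OF T hs_basis_L2] e, of n n] e
      by (simp add: ennreal_leI flip: ennreal_mult ennreal_plus)
  qed auto
  also have "\<dots> = ennreal (1 + \<epsilon>) * HS_norm_sq T + ennreal (1 + 1/\<epsilon>) * HS_norm_sq (\<lambda>\<phi> t. G \<phi> t - T \<phi> t)"
    unfolding HS_norm_sq_eq by (subst suminf_add[symmetric]) auto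
  finally show ?thesis .
qed

section \<open>Measurable fields of operators\<close>

definition weakly_measurable :: "(real \<Rightarrow> operator) \<Rightarrow> bool" where
  "weakly_measurable T \<longleftrightarrow> (\<forall>l. l \<noteq> 0 \<longrightarrow> bounded_operator (T l)) \<and>
     (\<forall>\<phi>\<in>L2R. \<forall>\<psi>\<in>L2R. (\<lambda>l. L2_inner lborel (T l \<phi>) \<psi>) \<in> borel_measurable borel)"

text \<open>Parseval for each column writes the norm as a double series of measurable matrix
  coefficients. The indicator removes l = 0, where the operator need not be bounded.\<close>

lemma measurable_HS_norm_sq:
  assumes T: "weakly_measurable T"
  shows "(\<lambda>l. indicator (- {0}) l * HS_norm_sq (T l)) \<in> borel_measurable borel"
proof -
  have [measurable]: "(\<lambda>l. L2_inner lborel (T l (hs_basis n)) (hs_basis m)) \<in> borel_measurable borel" for n m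
    using T hs_basis_L2 by (auto simp: weakly_measurable_def)
  have "indicator (- {0}) l * HS_norm_sq (T l)
    = indicator (- {0}) l * (\<Sum>n. \<Sum>m. ennreal ((cmod (L2_inner lborel (T l (hs_basis n)) (hs_basis m)))\<^sup>2))" for l
  proof (cases "l = 0")
    case False
    then have "bounded_operator (T l)" using T by (auto simp: weakly_measurable_def)
    then show ?thesis unfolding HS_norm_sq_eq by (simp add: hs_parseval[OF operator_L2[OF _ hs_basis_L2]])
  qed simp
  then show ?thesis by simp
qed

text \<open>Weak measurability concerns fixed vectors. For vectors moving with l, the pairing is
  expanded in the basis on both sides, which leaves measurable coefficients and a pointwise limit of
  sums.\<close>

lemma measurable_operator_inner:
  assumes T: "weakly_measurable T"
    and [measurable]: "(\<lambda>(l, t). \<alpha> l t) \<in> borel_measurable (borel \<Otimes>\<^sub>M borel)" "(\<lambda>(l, t). \<beta> l t) \<in> borel_measurable (borel \<Otimes>\<^sub>M borel)"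
    and L: "\<And>l. \<alpha> l \<in> L2R" "\<And>l. \<beta> l \<in> L2R"
  shows "(\<lambda>l. indicator (- {0}) l * L2_inner lborel (T l (\<beta> l)) (\<alpha> l)) \<in> borel_measurable borel"
proof -
  have [measurable]: "(\<lambda>l. L2_inner lborel (T l (hs_basis n)) (hs_basis m)) \<in> borel_measurable borel" for n m
    using T hs_basis_L2 by (auto simp: weakly_measurable_def)
  have [measurable]: "(\<lambda>l. L2_inner lborel (\<alpha> l) (hs_basis n)) \<in> borel_measurable borel"
    "(\<lambda>l. L2_inner lborel (\<beta> l) (hs_basis n)) \<in> borel_measurable borel" for n
    unfolding L2_inner_def by (intro lborel.borel_measurable_lebesgue_integral; measurable)+
  have "(\<lambda>i. L2_inner lborel v (hs_basis i) * cnj (L2_inner lborel u (hs_basis i))) sums L2_inner lborel v u"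
    if "v \<in> L2R" "u \<in> L2R" for u v
  proof -
    have "(\<lambda>N. L2_inner lborel (\<lambda>x. \<Sum>i<N. L2_inner lborel v (hs_basis i) * hs_basis i x) u) \<longlonglongrightarrow> L2_inner lborel v u"
      by (rule L2_inner_tendsto_left[OF _ that total_orthonormal_expansion(1)[OF total_hs_basis that(1)]])
        (intro L2_sum L2_scale hs_basis_L2)
    moreover have "L2_inner lborel (\<lambda>x. \<Sum>i<N. L2_inner lborel v (hs_basis i) * hs_basis i x) u
      = (\<Sum>i<N. L2_inner lborel v (hs_basis i) * cnj (L2_inner lborel u (hs_basis i)))" for N
      by (subst L2_inner_sum_left)
        (auto intro!: L2_scale hs_basis_L2 that simp: L2_inner_scale_left L2_inner_cnj[of _ "hs_basis _" u])
    ultimately show ?thesis by (simp add: sums_def)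
  qed
  note ex = sums_unique[OF this]
  have eq: "indicator (- {0}) l * L2_inner lborel (T l (\<beta> l)) (\<alpha> l)
    = indicator (- {0}) l * (\<Sum>i. L2_inner lborel (\<beta> l) (hs_basis i) *
        (\<Sum>j. L2_inner lborel (T l (hs_basis i)) (hs_basis j) * cnj (L2_inner lborel (\<alpha> l) (hs_basis j))))" for l
  proof (cases "l = 0")
    case False
    then have b: "bounded_operator (T l)" using T by (auto simp: weakly_measurable_def)
    show ?thesis
      by (simp add: sums_unique[OF operator_inner_sums[OF b L(2) L(1)], symmetric]
        ex[OF operator_L2[OF b hs_basis_L2] L(1), symmetric])
  qed simp
  show ?thesis unfolding eq by measurable
qed

section \<open>The group Fourier transform\<close>

lemma nn_integral_swap:
  fixes f :: "'a :: euclidean_space \<Rightarrow> 'b :: euclidean_space \<Rightarrow> ennreal"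
  assumes [measurable]: "(\<lambda>(x, y). f x y) \<in> borel_measurable (borel \<Otimes>\<^sub>M borel)"
  shows "(\<integral>\<^sup>+x. (\<integral>\<^sup>+y. f x y \<partial>lborel) \<partial>lborel) = (\<integral>\<^sup>+y. (\<integral>\<^sup>+x. f x y \<partial>lborel) \<partial>lborel)"
  by (rule lborel_pair.Fubini'[symmetric]) measurable

lemma nn_integral_lborel_pair:
  fixes F :: "'a :: euclidean_space \<times> 'b :: euclidean_space \<Rightarrow> ennreal"
  assumes "F \<in> borel_measurable borel"
  shows "(\<integral>\<^sup>+p. F p \<partial>lborel) = (\<integral>\<^sup>+x. (\<integral>\<^sup>+y. F (x, y) \<partial>lborel) \<partial>lborel)"
proof -
  have "F \<in> borel_measurable (lborel \<Otimes>\<^sub>M lborel)"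
    using assms by (simp add: lborel_prod)
  from lborel.nn_integral_fst[OF this] show ?thesis by (simp add: lborel_prod)
qed

lemma AE_slices_integrable:
  fixes h :: "'a :: euclidean_space \<times> 'b :: euclidean_space \<Rightarrow> complex"
  assumes "integrable lborel h"
  shows "AE x in lborel. integrable lborel (\<lambda>y. h (x, y))"
proof -
  have "integrable (lborel \<Otimes>\<^sub>M lborel) h" using assms by (simp add: lborel_prod)
  then show ?thesis by (rule lborel_pair.AE_integrable_fst')
qed

lemma integral_lborel_pair:
  fixes h :: "'a :: euclidean_space \<times> 'b :: euclidean_space \<Rightarrow> complex"
  assumes "integrable lborel h"
  shows "(LINT p|lborel. h p) = (LINT x|lborel. (LINT y|lborel. h (x, y)))"
    and "integrable lborel (\<lambda>x. LINT y|lborel. h (x, y))"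
proof -
  have h: "integrable (lborel \<Otimes>\<^sub>M lborel) h" using assms by (simp add: lborel_prod)
  show "(LINT p|lborel. h p) = (LINT x|lborel. (LINT y|lborel. h (x, y)))"
    using lborel_pair.integral_fst'[OF h] by (simp add: lborel_prod)
  show "integrable lborel (\<lambda>x. LINT y|lborel. h (x, y))"
    using lborel_pair.integrable_fst'[OF h] .
qed

lemma AE_slices_L2:
  fixes h :: "'a :: euclidean_space \<times> 'b :: euclidean_space \<Rightarrow> complex"
  assumes h: "h \<in> L2 lborel"
  shows "AE x in lborel. (\<lambda>y. h (x, y)) \<in> L2 lborel"
proof -
  have m: "h \<in> borel_measurable borel" using h by (auto simp: L2_def)
  then have [measurable]: "h \<in> borel_measurable (borel \<Otimes>\<^sub>M borel)" by (simp add: borel_prod)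
  have "(\<integral>\<^sup>+x. (\<integral>\<^sup>+y. ennreal ((cmod (h (x, y)))\<^sup>2) \<partial>lborel) \<partial>lborel) < \<infinity>"
    using L2_nn_finite[OF h] m by (subst (asm) nn_integral_lborel_pair) auto
  then have "AE x in lborel. (\<integral>\<^sup>+y. ennreal ((cmod (h (x, y)))\<^sup>2) \<partial>lborel) \<noteq> \<infinity>"
    by (intro nn_integral_PInf_AE) (auto intro!: lborel.borel_measurable_nn_integral)
  then show ?thesis
    by eventually_elim (rule L2I_nn, auto simp: less_top)
qed

lemma plancherel_reflect:
  assumes u: "u \<in> L2 lborel" and int: "integrable lborel u"
  shows "(\<integral>\<^sup>+\<xi>. ennreal ((cmod (FT u (- \<xi>)))\<^sup>2) \<partial>lborel) = (\<integral>\<^sup>+t. ennreal ((cmod (u t))\<^sup>2) \<partial>lborel)"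
proof -
  have [measurable]: "u \<in> borel_measurable borel" using u by (auto simp: L2_def)
  show ?thesis
    unfolding plancherel_real[OF assms, symmetric]
    by (subst (2) nn_integral_real_affine[where c="-1" and t=0]) simp_all
qed

text \<open>The signs are those of the Schroedinger representation: the central variable carries a
  plus sign, the modulation variable a minus sign.\<close>

definition FT2 :: "(real \<times> real \<Rightarrow> complex) \<Rightarrow> real \<Rightarrow> real \<Rightarrow> complex" where
  "FT2 h l w = (LINT q|lborel. h q * ee (l * snd q) * ee (- (w * fst q)))"

text \<open>The one-dimensional theorem is used twice: in z for almost every y, then in y for almost
  every l. Tonelli shows that the partial transform is square-integrable for almost every l, which
  is enough.\<close>

lemma plancherel_plane:
  assumes h: "h \<in> L2 lborel" and int: "integrable lborel h"
  shows "(\<integral>\<^sup>+l. (\<integral>\<^sup>+w. ennreal ((cmod (FT2 h l w))\<^sup>2) \<partial>lborel) \<partial>lborel) = (\<integral>\<^sup>+q. ennreal ((cmod (h q))\<^sup>2) \<partial>lborel)"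
proof -
  have m: "h \<in> borel_measurable borel" using h by (auto simp: L2_def)
  then have [measurable]: "h \<in> borel_measurable (borel \<Otimes>\<^sub>M borel)" by (simp add: borel_prod)
  define H where "H l y = FT (\<lambda>z. h (y, z)) l" for l y
  have [measurable]: "(\<lambda>(l, y). H l y) \<in> borel_measurable (borel \<Otimes>\<^sub>M borel)"
    unfolding H_def FT_def split_beta' by (intro lborel.borel_measurable_lebesgue_integral) measurable
  have Hm: "H l \<in> borel_measurable lborel" for l by measurable
  have ih: "integrable lborel (\<lambda>q. h q * ee (l * snd q))" for l
    by (intro integrable_mult_ee int) (simp add: borel_prod[symmetric])
  have ih2: "integrable lborel (\<lambda>q. h q * ee (l * snd q) * ee (- (w * fst q)))" for l w
    by (intro integrable_mult_ee[OF ih]) (simp add: borel_prod[symmetric])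
  have Hi: "integrable lborel (H l)" for l
    using integral_lborel_pair(2)[OF ih[of l]] by (simp add: H_def[abs_def] FT_def)
  have q: "FT2 h l w = FT (H l) (- w)" for l w
  proof -
    have "FT2 h l w = (LINT y|lborel. (LINT z|lborel. h (y, z) * ee (l * z) * ee (- (w * y))))"
      unfolding FT2_def by (subst integral_lborel_pair(1)[OF ih2]) simp
    then show ?thesis by (simp add: FT_def H_def)
  qed
  have HH: "(\<integral>\<^sup>+l. (\<integral>\<^sup>+y. ennreal ((cmod (H l y))\<^sup>2) \<partial>lborel) \<partial>lborel) = (\<integral>\<^sup>+q. ennreal ((cmod (h q))\<^sup>2) \<partial>lborel)"
  proof -
    have "(\<integral>\<^sup>+l. (\<integral>\<^sup>+y. ennreal ((cmod (H l y))\<^sup>2) \<partial>lborel) \<partial>lborel) = (\<integral>\<^sup>+y. (\<integral>\<^sup>+l. ennreal ((cmod (H l y))\<^sup>2) \<partial>lborel) \<partial>lborel)"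
      by (rule nn_integral_swap) measurable
    also have "\<dots> = (\<integral>\<^sup>+y. (\<integral>\<^sup>+z. ennreal ((cmod (h (y, z)))\<^sup>2) \<partial>lborel) \<partial>lborel)"
    proof (rule nn_integral_cong_AE, use AE_slices_L2[OF h] AE_slices_integrable[OF int] in eventually_elim)
      fix y assume "(\<lambda>z. h (y, z)) \<in> L2R" "integrable lborel (\<lambda>z. h (y, z))"
      from plancherel_real[OF this]
      show "(\<integral>\<^sup>+l. ennreal ((cmod (H l y))\<^sup>2) \<partial>lborel) = (\<integral>\<^sup>+z. ennreal ((cmod (h (y, z)))\<^sup>2) \<partial>lborel)"
        by (simp add: H_def)
    qed
    also have "\<dots> = (\<integral>\<^sup>+q. ennreal ((cmod (h q))\<^sup>2) \<partial>lborel)"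
      by (rule nn_integral_lborel_pair[symmetric]) (use m in measurable)
    finally show ?thesis .
  qed
  have "AE l in lborel. (\<integral>\<^sup>+y. ennreal ((cmod (H l y))\<^sup>2) \<partial>lborel) \<noteq> \<infinity>"
    using L2_nn_finite[OF h] by (intro nn_integral_PInf_AE) (auto simp: HH intro!: lborel.borel_measurable_nn_integral)
  then have "AE l in lborel. H l \<in> L2R"
    by eventually_elim (rule L2I_nn[OF Hm], auto simp: less_top)
  then have "(\<integral>\<^sup>+l. (\<integral>\<^sup>+w. ennreal ((cmod (FT2 h l w))\<^sup>2) \<partial>lborel) \<partial>lborel) = (\<integral>\<^sup>+l. (\<integral>\<^sup>+y. ennreal ((cmod (H l y))\<^sup>2) \<partial>lborel) \<partial>lborel)"
    unfolding q by (intro nn_integral_cong_AE; eventually_elim) (rule plancherel_reflect[OF _ Hi])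
  then show ?thesis by (simp add: HH)
qed

section \<open>The Heisenberg group, Haar measure and representation in coordinates\<close>

type_synonym R3 = "real \<times> real \<times> real"

definition heis3 :: "R3 \<Rightarrow> real^4^4" where
  "heis3 = (\<lambda>(x, y, z). heis x y z)"

lemma heis3_simp [simp]: "heis3 (x, y, z) = heis x y z"
  by (simp add: heis3_def)

lemma heis_entries [simp]:
  "heis x y z $ 1 $ 2 = x" "heis x y z $ 2 $ 4 = y" "heis x y z $ 1 $ 4 = z"
  by (simp_all add: heis_def vector_4')

lemma heis3_measurable: "heis3 \<in> lborel \<rightarrow>\<^sub>M restrict_space borel heisenberg"
  unfolding heis3_def by (rule measurable_heis)

lemma haar_eq: "haar = distr lborel (restrict_space borel heisenberg) heis3"
  by (simp add: haar_def heis3_def)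

lemma haar_measurable_iff:
  "f \<in> borel_measurable haar \<longleftrightarrow> f \<in> borel_measurable (restrict_space borel heisenberg)"
  by (simp add: haar_eq)

lemma haar_measurableD:
  "f \<in> borel_measurable haar \<Longrightarrow> (\<lambda>p. f (heis3 p)) \<in> borel_measurable borel"
  using measurable_compose[OF heis3_measurable] by (simp add: haar_eq)

lemma integral_haar:
  fixes f :: "_ \<Rightarrow> 'b :: {banach, second_countable_topology}"
  shows "f \<in> borel_measurable haar \<Longrightarrow> (LINT n|haar. f n) = (LINT p|lborel. f (heis3 p))"
  unfolding haar_eq by (rule integral_distr[OF heis3_measurable]) simp

lemma integrable_haar_iff:
  fixes f :: "_ \<Rightarrow> 'b :: {banach, second_countable_topology}"
  shows "f \<in> borel_measurable haar \<Longrightarrow> integrable haar f \<longleftrightarrow> integrable lborel (\<lambda>p. f (heis3 p))"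
  unfolding haar_eq by (rule integrable_distr_eq[OF heis3_measurable]) simp

lemma L2_haar_iff:
  "f \<in> borel_measurable haar \<Longrightarrow> f \<in> L2 haar \<longleftrightarrow> (\<lambda>p. f (heis3 p)) \<in> L2 lborel"
  unfolding L2_def using haar_measurableD[of f] integrable_haar_iff[of "\<lambda>x. (cmod (f x))\<^sup>2"] by auto

lemma L2_norm_haar: "f \<in> borel_measurable haar \<Longrightarrow> L2_norm haar f = L2_norm lborel (\<lambda>p. f (heis3 p))"
  unfolding L2_norm_def by (subst integral_haar) auto

lemma L2_inner_haar:
  assumes [measurable]: "f \<in> borel_measurable haar" "g \<in> borel_measurable haar"
  shows "L2_inner haar f g = L2_inner lborel (\<lambda>p. f (heis3 p)) (\<lambda>p. g (heis3 p))"
  unfolding L2_inner_def by (subst integral_haar) auto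

lemma space_haar: "space haar = heisenberg"
  by (simp add: haar_eq space_restrict_space)

definition rep3 :: "real \<Rightarrow> R3 \<Rightarrow> (real \<Rightarrow> complex) \<Rightarrow> real \<Rightarrow> complex" where
  "rep3 l = (\<lambda>(x, y, z) \<phi> t. ee (l * z) * ee (- (l * y * t)) * \<phi> (t - x))"

lemma schroedinger_rep3: "schroedinger_rep l (heis3 p) \<phi> = rep3 l p \<phi>"
proof -
  obtain x y z where p: "p = (x, y, z)" by (cases p) auto
  have "exp (- 2 * of_real pi * \<i> * of_real (l * y * t)) = ee (- (l * y * t))" for t
    using ee_exp[of "- (l * y * t)"] by simp
  then show ?thesis
    by (simp only: p heis3_simp schroedinger_rep_heis ee_exp rep3_def split_conv)
qed

lemma rep3_meas_pair [measurable (raw)]: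
  assumes [measurable]: "\<phi> \<in> borel_measurable borel" "p \<in> M \<rightarrow>\<^sub>M borel" "t \<in> borel_measurable M"
  shows "(\<lambda>x. rep3 l (p x) \<phi> (t x)) \<in> borel_measurable M"
proof -
  have "p \<in> M \<rightarrow>\<^sub>M borel \<Otimes>\<^sub>M (borel \<Otimes>\<^sub>M borel)" using assms(2) by (simp add: borel_prod)
  note [measurable] = this
  show ?thesis unfolding rep3_def split_beta' by measurable
qed

lemma cmod_rep3: "cmod (rep3 l (x, y, z) \<phi> t) = cmod (\<phi> (t - x))"
  by (simp add: rep3_def norm_mult)

lemma L2_translate:
  assumes "\<phi> \<in> L2R"
  shows "(\<lambda>t. \<phi> (t - x)) \<in> L2R" "L2_norm lborel (\<lambda>t. \<phi> (t - x)) = L2_norm lborel \<phi>"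
proof -
  have [measurable]: "\<phi> \<in> borel_measurable borel" using assms by (auto simp: L2_def)
  have eq: "(\<integral>\<^sup>+t. ennreal ((cmod (\<phi> (t - x)))\<^sup>2) \<partial>lborel) = (\<integral>\<^sup>+t. ennreal ((cmod (\<phi> t))\<^sup>2) \<partial>lborel)"
    by (subst (2) nn_integral_real_affine[where c=1 and t="-x"]) simp_all
  show L: "(\<lambda>t. \<phi> (t - x)) \<in> L2R"
    by (rule L2I_nn) (use L2_nn_finite[OF assms] eq in auto)
  show "L2_norm lborel (\<lambda>t. \<phi> (t - x)) = L2_norm lborel \<phi>"
  proof -
    have "ennreal ((L2_norm lborel (\<lambda>t. \<phi> (t - x)))\<^sup>2) = ennreal ((L2_norm lborel \<phi>)\<^sup>2)"
      by (simp only: L2_norm_sq_nn[OF L] L2_norm_sq_nn[OF assms] eq)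
    then show ?thesis by simp
  qed
qed

lemma rep3_L2:
  assumes "\<phi> \<in> L2R"
  shows "rep3 l p \<phi> \<in> L2R" "L2_norm lborel (rep3 l p \<phi>) = L2_norm lborel \<phi>"
proof -
  obtain x y z where p: "p = (x, y, z)" by (cases p) auto
  have [measurable]: "\<phi> \<in> borel_measurable borel" using assms by (auto simp: L2_def)
  have "L2_norm lborel (rep3 l p \<phi>) = L2_norm lborel (\<lambda>t. \<phi> (t - x))"
    by (simp add: L2_norm_def p cmod_rep3)
  then show "L2_norm lborel (rep3 l p \<phi>) = L2_norm lborel \<phi>"
    by (simp add: L2_translate assms)
  have "(\<lambda>t. rep3 l p \<phi> t) \<in> borel_measurable borel" by measurable
  then show "rep3 l p \<phi> \<in> L2R"
    using L2_translate(1)[OF assms, of x] by (simp add: L2_def p cmod_rep3)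
qed

text \<open>For fixed p, unitarity and the Cauchy-Schwarz inequality bound the t-integral by |g p|
  times the two norms. This licenses every later exchange of the group integral with an inner
  product.\<close>

lemma rep3_pairing_integrable:
  assumes g: "integrable lborel g" and \<phi>: "\<phi> \<in> L2R" and \<psi>: "\<psi> \<in> L2R"
  shows "integrable (lborel \<Otimes>\<^sub>M lborel) (\<lambda>(p, t). g p * rep3 l p \<phi> t * cnj (\<psi> t))"
proof -
  have [measurable]: "\<phi> \<in> borel_measurable borel" "\<psi> \<in> borel_measurable borel" "g \<in> borel_measurable borel"
    using \<phi> \<psi> g by (auto simp: L2_def)
  have m: "(\<lambda>(p, t). g p * rep3 l p \<phi> t * cnj (\<psi> t)) \<in> borel_measurable (lborel \<Otimes>\<^sub>M lborel)"
    by measurable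
  have "(\<integral>\<^sup>+w. ennreal (norm (case w of (p, t) \<Rightarrow> g p * rep3 l p \<phi> t * cnj (\<psi> t))) \<partial>(lborel \<Otimes>\<^sub>M lborel))
    = (\<integral>\<^sup>+p. (\<integral>\<^sup>+t. ennreal (cmod (g p)) * ennreal (cmod (rep3 l p \<phi> t) * cmod (\<psi> t)) \<partial>lborel) \<partial>lborel)"
    by (subst lborel.nn_integral_fst[symmetric]) (auto simp: norm_mult mult.assoc ennreal_mult)
  also have "\<dots> \<le> (\<integral>\<^sup>+p. ennreal (cmod (g p)) * ennreal (L2_norm lborel \<phi> * L2_norm lborel \<psi>) \<partial>lborel)"
  proof (rule nn_integral_mono)
    fix p
    have "(\<integral>\<^sup>+t. ennreal (cmod (rep3 l p \<phi> t) * cmod (\<psi> t)) \<partial>lborel) = ennreal (LINT t|lborel. cmod (rep3 l p \<phi> t) * cmod (\<psi> t))"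
      by (rule nn_integral_eq_integral[OF L2_mult_integrable[OF rep3_L2(1)[OF \<phi>] \<psi>]]) simp
    also have "\<dots> \<le> ennreal (L2_norm lborel \<phi> * L2_norm lborel \<psi>)"
      using L2_Cauchy_Schwarz_norms[OF rep3_L2(1)[OF \<phi>] \<psi>] by (intro ennreal_leI) (simp add: rep3_L2(2)[OF \<phi>])
    finally show "(\<integral>\<^sup>+t. ennreal (cmod (g p)) * ennreal (cmod (rep3 l p \<phi> t) * cmod (\<psi> t)) \<partial>lborel)
      \<le> ennreal (cmod (g p)) * ennreal (L2_norm lborel \<phi> * L2_norm lborel \<psi>)"
      by (subst nn_integral_cmult) (auto intro!: mult_left_mono)
  qed
  also have "\<dots> < \<infinity>"
    using g by (subst nn_integral_multc) (auto simp: ennreal_mult_less_top integrable_iff_bounded)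
  finally show ?thesis using m by (intro integrableI_bounded) auto
qed

text \<open>A concrete representative of the weakly defined operator integral; at points t where the
  integrand is not integrable it takes the default value 0.\<close>

definition opFT :: "(R3 \<Rightarrow> complex) \<Rightarrow> real \<Rightarrow> operator" where
  "opFT g l \<phi> t = (LINT p|lborel. g p * rep3 l p \<phi> t)"

lemma opFT_weak:
  assumes g: "integrable lborel g" and \<phi>: "\<phi> \<in> L2R" and \<psi>: "\<psi> \<in> L2R"
  shows "L2_inner lborel (opFT g l \<phi>) \<psi> = (LINT p|lborel. g p * L2_inner lborel (rep3 l p \<phi>) \<psi>)"
proof -
  note I = rep3_pairing_integrable[OF assms, of l]
  have "L2_inner lborel (opFT g l \<phi>) \<psi> = (LINT t|lborel. (LINT p|lborel. g p * rep3 l p \<phi> t * cnj (\<psi> t)))"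
    by (simp add: L2_inner_def opFT_def)
  also have "\<dots> = (LINT p|lborel. (LINT t|lborel. g p * rep3 l p \<phi> t * cnj (\<psi> t)))"
    by (rule lborel_pair.Fubini_integral[OF I])
  also have "\<dots> = (LINT p|lborel. g p * L2_inner lborel (rep3 l p \<phi>) \<psi>)"
    by (simp add: L2_inner_def mult.assoc)
  finally show ?thesis .
qed

text \<open>Duality: testing \<open>v\<close> against its own truncations bounds its norm.\<close>

lemma L2_duality:
  fixes v :: "real \<Rightarrow> complex"
  assumes [measurable]: "v \<in> borel_measurable borel" and K: "K \<ge> 0"
    and bd: "\<And>\<psi>. \<psi> \<in> L2R \<Longrightarrow> cmod (LINT t|lborel. v t * cnj (\<psi> t)) \<le> K * L2_norm lborel \<psi>"
  shows "v \<in> L2R" "L2_norm lborel v \<le> K"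
proof -
  \<comment> \<open>Cutting off both the position and the size makes the truncation bounded with
    bounded support, hence an admissible test function.\<close>
  define A where "A N = {t. \<bar>t\<bar> \<le> real N \<and> cmod (v t) \<le> real N}" for N
  have [measurable]: "A N \<in> sets borel" for N unfolding A_def by measurable
  define \<psi> where "\<psi> N t = indicator (A N) t * v t" for N t
  have [measurable]: "\<psi> N \<in> borel_measurable borel" for N unfolding \<psi>_def[abs_def] by measurable
  have \<psi>: "\<psi> N \<in> L2R" for N
  proof (rule L2I_nn)
    have "(\<integral>\<^sup>+t. ennreal ((cmod (\<psi> N t))\<^sup>2) \<partial>lborel) \<le> (\<integral>\<^sup>+t. ennreal ((real N)\<^sup>2) * indicator {-real N..real N} t \<partial>lborel)"
      by (intro nn_integral_mono) (auto simp: \<psi>_def A_def indicator_def intro!: ennreal_leI power_mono)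
    also have "\<dots> < \<infinity>" by (simp add: nn_integral_cmult ennreal_mult_less_top)
    finally show "(\<integral>\<^sup>+t. ennreal ((cmod (\<psi> N t))\<^sup>2) \<partial>lborel) < \<infinity>" .
  qed simp
  have le: "L2_norm lborel (\<psi> N) \<le> K" for N
  proof -
    have "(LINT t|lborel. v t * cnj (\<psi> N t)) = L2_inner lborel (\<psi> N) (\<psi> N)"
      unfolding L2_inner_def by (intro Bochner_Integration.integral_cong) (auto simp: \<psi>_def indicator_def)
    then have "(L2_norm lborel (\<psi> N))\<^sup>2 \<le> K * L2_norm lborel (\<psi> N)"
      using bd[OF \<psi>, of N] by (simp add: L2_inner_self norm_power)
    then show ?thesis using K L2_norm_nonneg[of lborel "\<psi> N"]
      by (cases "L2_norm lborel (\<psi> N) = 0") (auto simp: power2_eq_square dest: mult_right_le_imp_le)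
  qed
  have "(\<integral>\<^sup>+t. ennreal ((cmod (v t))\<^sup>2) \<partial>lborel) = (\<integral>\<^sup>+t. liminf (\<lambda>N. ennreal ((cmod (\<psi> N t))\<^sup>2)) \<partial>lborel)"
  proof (rule nn_integral_cong)
    fix t
    obtain N0 :: nat where N0: "max \<bar>t\<bar> (cmod (v t)) \<le> real N0" using real_arch_simple by blast
    have "\<forall>\<^sub>F N in sequentially. \<psi> N t = v t"
      by (rule eventually_sequentiallyI[of N0]) (use N0 in \<open>auto simp: \<psi>_def A_def indicator_def\<close>)
    then have "(\<lambda>N. ennreal ((cmod (\<psi> N t))\<^sup>2)) \<longlonglongrightarrow> ennreal ((cmod (v t))\<^sup>2)"
      by (intro tendsto_eventually) (auto elim: eventually_mono)
    from lim_imp_Liminf[OF _ this]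
    show "ennreal ((cmod (v t))\<^sup>2) = liminf (\<lambda>N. ennreal ((cmod (\<psi> N t))\<^sup>2))" by simp
  qed
  also have "\<dots> \<le> liminf (\<lambda>N. \<integral>\<^sup>+t. ennreal ((cmod (\<psi> N t))\<^sup>2) \<partial>lborel)"
    by (rule nn_integral_liminf) measurable
  also have "\<dots> \<le> ennreal (K\<^sup>2)"
    unfolding L2_norm_sq_nn[OF \<psi>, symmetric]
    by (rule order_trans[OF Liminf_le_Limsup], simp, rule Limsup_bounded)
      (auto intro!: always_eventually ennreal_leI power_mono le)
  finally have fin: "(\<integral>\<^sup>+t. ennreal ((cmod (v t))\<^sup>2) \<partial>lborel) \<le> ennreal (K\<^sup>2)" .
  show v: "v \<in> L2R" by (rule L2I_nn) (auto intro: le_less_trans[OF fin])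
  have "(L2_norm lborel v)\<^sup>2 \<le> K\<^sup>2"
    using fin unfolding L2_norm_sq_nn[OF v, symmetric] by simp
  then show "L2_norm lborel v \<le> K" using K by (rule power2_le_imp_le)
qed

lemma opFT_measurable [measurable]:
  assumes "g \<in> borel_measurable borel" "\<phi> \<in> borel_measurable borel"
  shows "opFT g l \<phi> \<in> borel_measurable borel"
proof -
  note assms[measurable]
  show ?thesis unfolding opFT_def[abs_def] by (intro lborel.borel_measurable_lebesgue_integral) measurable
qed

text \<open>Minkowski's integral inequality, obtained by duality: the weak formula bounds every
  pairing of the image with a test function.\<close>

lemma opFT_L2:
  assumes g: "integrable lborel g" and \<phi>: "\<phi> \<in> L2R"
  shows "opFT g l \<phi> \<in> L2R" "L2_norm lborel (opFT g l \<phi>) \<le> (LINT p|lborel. cmod (g p)) * L2_norm lborel \<phi>"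
proof -
  have m: "opFT g l \<phi> \<in> borel_measurable borel" using g \<phi> by (intro opFT_measurable) (auto simp: L2_def)
  have K: "0 \<le> (LINT p|lborel. cmod (g p)) * L2_norm lborel \<phi>" by simp
  have [measurable]: "\<phi> \<in> borel_measurable borel" "g \<in> borel_measurable borel" using \<phi> g by (auto simp: L2_def)
  have bd: "cmod (LINT t|lborel. opFT g l \<phi> t * cnj (\<psi> t)) \<le> ((LINT p|lborel. cmod (g p)) * L2_norm lborel \<phi>) * L2_norm lborel \<psi>"
    if \<psi>: "\<psi> \<in> L2R" for \<psi>
  proof -
    have [measurable]: "\<psi> \<in> borel_measurable borel" using \<psi> by (auto simp: L2_def)
    have "cmod (L2_inner lborel (opFT g l \<phi>) \<psi>) \<le> (LINT p|lborel. cmod (g p * L2_inner lborel (rep3 l p \<phi>) \<psi>))"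
      unfolding opFT_weak[OF g \<phi> \<psi>] by (rule integral_norm_bound)
    also have "\<dots> \<le> (LINT p|lborel. cmod (g p) * (L2_norm lborel \<phi> * L2_norm lborel \<psi>))"
    proof (rule integral_mono_AE')
      show "integrable lborel (\<lambda>p. cmod (g p) * (L2_norm lborel \<phi> * L2_norm lborel \<psi>))" using g by auto
      show "AE p in lborel. cmod (g p * L2_inner lborel (rep3 l p \<phi>) \<psi>) \<le> cmod (g p) * (L2_norm lborel \<phi> * L2_norm lborel \<psi>)"
        using L2_Cauchy_Schwarz[OF rep3_L2(1)[OF \<phi>] \<psi>]
        by (auto simp: norm_mult rep3_L2(2)[OF \<phi>] intro!: mult_left_mono)
    qed auto
    finally show ?thesis by (simp add: L2_inner_def mult_ac)
  qed
  show "opFT g l \<phi> \<in> L2R" "L2_norm lborel (opFT g l \<phi>) \<le> (LINT p|lborel. cmod (g p)) * L2_norm lborel \<phi>"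
    using L2_duality[OF m K bd] by auto
qed

lemma L2_weak_unique:
  assumes "v \<in> L2 M" "u \<in> L2 M" "\<And>\<psi>. \<psi> \<in> L2 M \<Longrightarrow> L2_inner M v \<psi> = L2_inner M u \<psi>"
  shows "AE t in M. v t = u t"
proof -
  have d: "(\<lambda>t. v t - u t) \<in> L2 M" by (intro L2_diff assms)
  have "complex_of_real ((L2_norm M (\<lambda>t. v t - u t))\<^sup>2) = 0"
    unfolding L2_inner_self[symmetric]
    using L2_inner_diff_left[OF assms(1,2) d] assms(3)[OF d] by simp
  then have "L2_norm M (\<lambda>t. v t - u t) = 0" by simp
  then show ?thesis using L2_norm_eq_0_iff[OF d] by auto
qed

lemma rep3_linear: "rep3 l p (\<lambda>s. a * \<phi> s + b * \<psi> s) = (\<lambda>t. a * rep3 l p \<phi> t + b * rep3 l p \<psi> t)"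
  by (cases p) (auto simp: rep3_def fun_eq_iff algebra_simps)

lemma g_inner_integrable:
  assumes g: "integrable lborel g" and \<phi>: "\<phi> \<in> L2R" and \<psi>: "\<psi> \<in> L2R"
  shows "integrable lborel (\<lambda>p. g p * L2_inner lborel (rep3 l p \<phi>) \<psi>)"
  using lborel_pair.integrable_fst[OF rep3_pairing_integrable[OF assms, of l]]
  by (simp add: L2_inner_def mult.assoc)

lemma opFT_bounded:
  assumes g: "integrable lborel g"
  shows "bounded_operator (opFT g l)"
  unfolding bounded_operator_def
proof (intro conjI ballI allI)
  show "opFT g l \<phi> \<in> L2R" if "\<phi> \<in> L2R" for \<phi> by (rule opFT_L2[OF g that])
  show "\<exists>C. \<forall>\<phi>\<in>L2R. L2_norm lborel (opFT g l \<phi>) \<le> C * L2_norm lborel \<phi>"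
    using opFT_L2(2)[OF g] by blast
  fix \<phi> \<psi> :: "real \<Rightarrow> complex" and a b assume \<phi>: "\<phi> \<in> L2R" and \<psi>: "\<psi> \<in> L2R"
  show "AE t in lborel. opFT g l (\<lambda>s. a * \<phi> s + b * \<psi> s) t = a * opFT g l \<phi> t + b * opFT g l \<psi> t"
  proof (rule L2_weak_unique)
    have L: "(\<lambda>s. a * \<phi> s + b * \<psi> s) \<in> L2R" by (intro L2_add L2_scale \<phi> \<psi>)
    show "opFT g l (\<lambda>s. a * \<phi> s + b * \<psi> s) \<in> L2R" by (rule opFT_L2[OF g L])
    show "(\<lambda>t. a * opFT g l \<phi> t + b * opFT g l \<psi> t) \<in> L2R"
      by (intro L2_add L2_scale opFT_L2[OF g] \<phi> \<psi>)
    fix \<theta> assume \<theta>: "\<theta> \<in> L2R"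
    have "L2_inner lborel (opFT g l (\<lambda>s. a * \<phi> s + b * \<psi> s)) \<theta>
      = (LINT p|lborel. a * (g p * L2_inner lborel (rep3 l p \<phi>) \<theta>) + b * (g p * L2_inner lborel (rep3 l p \<psi>) \<theta>))"
      unfolding opFT_weak[OF g L \<theta>] rep3_linear
      by (intro Bochner_Integration.integral_cong refl)
        (simp add: L2_inner_add_left L2_inner_scale_left L2_scale rep3_L2 \<phi> \<psi> \<theta> algebra_simps)
    also have "\<dots> = a * L2_inner lborel (opFT g l \<phi>) \<theta> + b * L2_inner lborel (opFT g l \<psi>) \<theta>"
      using g_inner_integrable[OF g \<phi> \<theta>] g_inner_integrable[OF g \<psi> \<theta>]
      by (simp add: opFT_weak[OF g _ \<theta>] \<phi> \<psi>)
    also have "\<dots> = L2_inner lborel (\<lambda>t. a * opFT g l \<phi> t + b * opFT g l \<psi> t) \<theta>"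
      by (simp add: L2_inner_add_left L2_inner_scale_left L2_scale opFT_L2[OF g] \<phi> \<psi> \<theta>)
    finally show "L2_inner lborel (opFT g l (\<lambda>s. a * \<phi> s + b * \<psi> s)) \<theta> =
      L2_inner lborel (\<lambda>t. a * opFT g l \<phi> t + b * opFT g l \<psi> t) \<theta>" .
  qed
qed

text \<open>Weak pairings determine a vector of L2 up to a null set, so the defining condition can
  be replaced by comparison with the concrete integral \<open>opFT\<close>.\<close>

lemma has_fourier_transform_iff:
  assumes g: "integrable haar g"
  shows "has_fourier_transform g l A \<longleftrightarrow> bounded_operator A \<and>
    (\<forall>\<phi>\<in>L2R. AE t in lborel. A \<phi> t = opFT (\<lambda>p. g (heis3 p)) l \<phi> t)"
proof -
  have [measurable]: "g \<in> borel_measurable haar" using g by auto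
  let ?g = "\<lambda>p. g (heis3 p)"
  have g3: "integrable lborel ?g" using g by (simp add: integrable_haar_iff)
  have pair: "(LINT n|haar. g n * L2_inner lborel (schroedinger_rep l n \<phi>) \<psi>) = L2_inner lborel (opFT ?g l \<phi>) \<psi>"
    if \<phi>: "\<phi> \<in> L2R" and \<psi>: "\<psi> \<in> L2R" for \<phi> \<psi>
  proof -
    have [measurable]: "\<phi> \<in> borel_measurable borel" "\<psi> \<in> borel_measurable borel" using \<phi> \<psi> by (auto simp: L2_def)
    have c: "continuous_on UNIV (\<lambda>n::real^4^4. n $ i $ j)" for i j by (intro continuous_intros)
    have [measurable]: "(\<lambda>n::real^4^4. n $ i $ j) \<in> borel_measurable haar" for i j
      unfolding haar_measurable_iff by (rule measurable_restrict_space1, rule borel_measurable_continuous_onI[OF c])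
    have [measurable]: "(\<lambda>(n, t). schroedinger_rep l n \<phi> t) \<in> borel_measurable (haar \<Otimes>\<^sub>M lborel)"
      unfolding schroedinger_rep_def by measurable
    have "(\<lambda>n. L2_inner lborel (schroedinger_rep l n \<phi>) \<psi>) \<in> borel_measurable haar"
      unfolding L2_inner_def by (rule lborel.borel_measurable_lebesgue_integral) measurable
    then show ?thesis
      by (subst integral_haar) (auto simp: schroedinger_rep3 opFT_weak[OF g3 \<phi> \<psi>])
  qed
  show ?thesis
  proof
    assume A: "has_fourier_transform g l A"
    then have b: "bounded_operator A" by (simp add: has_fourier_transform_def)
    moreover have "AE t in lborel. A \<phi> t = opFT ?g l \<phi> t" if \<phi>: "\<phi> \<in> L2R" for \<phi>
    proof (rule L2_weak_unique)
      show "A \<phi> \<in> L2R" by (rule operator_L2[OF b \<phi>])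
      show "opFT ?g l \<phi> \<in> L2R" by (rule opFT_L2[OF g3 \<phi>])
      show "L2_inner lborel (A \<phi>) \<psi> = L2_inner lborel (opFT ?g l \<phi>) \<psi>" if "\<psi> \<in> L2R" for \<psi>
        using A \<phi> that by (simp add: has_fourier_transform_def pair)
    qed
    ultimately show "bounded_operator A \<and> (\<forall>\<phi>\<in>L2R. AE t in lborel. A \<phi> t = opFT ?g l \<phi> t)" by blast
  next
    assume A: "bounded_operator A \<and> (\<forall>\<phi>\<in>L2R. AE t in lborel. A \<phi> t = opFT ?g l \<phi> t)"
    have "L2_inner lborel (A \<phi>) \<psi> = L2_inner lborel (opFT ?g l \<phi>) \<psi>" if "\<phi> \<in> L2R" "\<psi> \<in> L2R" for \<phi> \<psi>
      by (rule L2_inner_cong_AE[OF L2_measurable L2_measurable L2_measurable])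
        (use A that in \<open>auto intro: operator_L2 opFT_L2[OF g3]\<close>)
    then show "has_fourier_transform g l A"
      using A by (simp add: has_fourier_transform_def pair)
  qed
qed

section \<open>Integral kernels and Plancherel's theorem for functions in L1 and L2\<close>

lemma measurable_pair_lborel:
  fixes f :: "'a \<times> 'b :: euclidean_space \<Rightarrow> 'c"
  shows "f \<in> M \<Otimes>\<^sub>M lborel \<rightarrow>\<^sub>M N \<longleftrightarrow> f \<in> M \<Otimes>\<^sub>M borel \<rightarrow>\<^sub>M N"
proof -
  have "sets (M \<Otimes>\<^sub>M (lborel :: 'b measure)) = sets (M \<Otimes>\<^sub>M borel)"
    by (rule sets_pair_measure_cong) auto
  from measurable_cong_sets[OF this refl, of N] show ?thesis by simp
qed

definition FTslice :: "(R3 \<Rightarrow> complex) \<Rightarrow> real \<Rightarrow> real \<Rightarrow> real \<Rightarrow> complex" where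
  "FTslice g l x w = FT2 (\<lambda>q. g (x, q)) l w"

lemma FTslice_measurable:
  assumes "g \<in> borel_measurable borel"
  shows "(\<lambda>(l, x, w). FTslice g l x w) \<in> borel_measurable (borel \<Otimes>\<^sub>M borel \<Otimes>\<^sub>M borel)"
proof -
  have [measurable]: "g \<in> borel_measurable (borel \<Otimes>\<^sub>M borel \<Otimes>\<^sub>M borel)" using assms by (simp add: borel_prod)
  have "(\<lambda>((l, x, w), q). g (x, q) * ee (l * snd q) * ee (- (w * fst q)))
    \<in> borel_measurable ((borel \<Otimes>\<^sub>M borel \<Otimes>\<^sub>M borel) \<Otimes>\<^sub>M (borel \<Otimes>\<^sub>M borel))"
    unfolding split_beta' by measurable
  then have m: "(\<lambda>(p, q). g (fst (snd p), q) * ee (fst p * snd q) * ee (- (snd (snd p) * fst q)))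
    \<in> borel_measurable ((borel \<Otimes>\<^sub>M borel \<Otimes>\<^sub>M borel) \<Otimes>\<^sub>M lborel)"
    by (simp add: borel_prod split_beta' measurable_pair_lborel)
  show ?thesis
    unfolding FTslice_def FT2_def split_beta' by (rule lborel.borel_measurable_lebesgue_integral[OF m])
qed

lemma FTslice_measurable' [measurable (raw)]:
  assumes "g \<in> borel_measurable borel" "a \<in> borel_measurable M" "b \<in> borel_measurable M" "c \<in> borel_measurable M"
  shows "(\<lambda>x. FTslice g (a x) (b x) (c x)) \<in> borel_measurable M"
proof -
  have "(\<lambda>x. (a x, b x, c x)) \<in> M \<rightarrow>\<^sub>M borel \<Otimes>\<^sub>M borel \<Otimes>\<^sub>M borel" using assms by measurable
  from measurable_compose[OF this FTslice_measurable[OF assms(1)]] show ?thesis by simp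
qed

text \<open>Fubini, applied with the indicator of [-N, N] as test function, gives integrability for
  almost every t in that interval; countably many N cover the line.\<close>

lemma AE_rep3_integrable:
  assumes g: "integrable lborel g" and \<phi>: "\<phi> \<in> L2R"
  shows "AE t in lborel. integrable lborel (\<lambda>p. g p * rep3 l p \<phi> t)"
proof -
  have "AE t in lborel. integrable lborel (\<lambda>p. g p * rep3 l p \<phi> t * cnj (indicator {- real N..real N} t))" for N
  proof -
    have "(\<lambda>t. indicator {- real N..real N} t) \<in> L2R"
    proof (rule L2I_nn)
      have "(\<integral>\<^sup>+t. ennreal ((cmod (indicator {- real N..real N} t))\<^sup>2) \<partial>lborel) = (\<integral>\<^sup>+t. indicator {- real N..real N} t \<partial>lborel)"
        by (rule nn_integral_cong) (simp add: indicator_def)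
      then show "(\<integral>\<^sup>+t. ennreal ((cmod (indicator {- real N..real N} t))\<^sup>2) \<partial>lborel) < \<infinity>" by simp
    qed simp
    from lborel_pair.AE_integrable_snd[OF rep3_pairing_integrable[OF g \<phi> this, of l]]
    show ?thesis by simp
  qed
  then have "AE t in lborel. \<forall>N. integrable lborel (\<lambda>p. g p * rep3 l p \<phi> t * cnj (indicator {- real N..real N} t))"
    by (simp add: AE_all_countable)
  then show ?thesis
  proof eventually_elim
    case (elim t)
    obtain N :: nat where "\<bar>t\<bar> \<le> real N" using real_arch_simple by blast
    then have "t \<in> {- real N..real N}" by auto
    then show ?case using elim[rule_format, of N] by simp
  qed
qed

text \<open>For almost every t the group integral may be taken iteratively. The (y, z) part is a
  partial Fourier transform of g, and s = t - x makes it a kernel in (t, s).\<close>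

lemma opFT_kernel:
  assumes g: "integrable lborel g" and \<phi>: "\<phi> \<in> L2R"
  shows "AE t in lborel. opFT g l \<phi> t = (LINT s|lborel. \<phi> s * FTslice g l (t - s) (l * t))"
  using AE_rep3_integrable[OF assms, of l]
proof eventually_elim
  case (elim t)
  have "opFT g l \<phi> t = (LINT x|lborel. (LINT q|lborel. g (x, q) * rep3 l (x, q) \<phi> t))"
    unfolding opFT_def by (rule integral_lborel_pair(1)[OF elim])
  also have "\<dots> = (LINT x|lborel. \<phi> (t - x) * FTslice g l x (l * t))"
  proof (rule Bochner_Integration.integral_cong[OF refl])
    fix x
    have "(LINT q|lborel. g (x, q) * rep3 l (x, q) \<phi> t) = (LINT q|lborel. \<phi> (t - x) * (g (x, q) * ee (l * snd q) * ee (- (l * t * fst q))))"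
      by (intro Bochner_Integration.integral_cong refl) (auto simp: rep3_def split_beta' mult_ac)
    then show "(LINT q|lborel. g (x, q) * rep3 l (x, q) \<phi> t) = \<phi> (t - x) * FTslice g l x (l * t)"
      by (simp add: FTslice_def FT2_def)
  qed
  also have "\<dots> = \<bar>-1\<bar> *\<^sub>R (LINT s|lborel. \<phi> (t - (t + (-1) * s)) * FTslice g l (t + (-1) * s) (l * t))"
    by (rule lborel_integral_real_affine) simp
  finally show ?case by simp
qed

text \<open>For almost every t the conjugated kernel row is in L2, and its basis coefficients are
  the conjugated values at t of the images of the basis. Parseval in each row and integration over t
  give the norm.\<close>

lemma HS_opFT:
  assumes g: "integrable lborel g"
    and fin: "(\<integral>\<^sup>+t. (\<integral>\<^sup>+s. ennreal ((cmod (FTslice g l (t - s) (l * t)))\<^sup>2) \<partial>lborel) \<partial>lborel) < \<infinity>"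
  shows "HS_norm_sq (opFT g l) = (\<integral>\<^sup>+t. (\<integral>\<^sup>+s. ennreal ((cmod (FTslice g l (t - s) (l * t)))\<^sup>2) \<partial>lborel) \<partial>lborel)"
proof -
  have [measurable]: "g \<in> borel_measurable borel" using g by auto
  let ?K = "\<lambda>t s. FTslice g l (t - s) (l * t)"
  have [measurable]: "(\<lambda>t. \<integral>\<^sup>+s. ennreal ((cmod (?K t s))\<^sup>2) \<partial>lborel) \<in> borel_measurable borel"
    by (rule lborel.borel_measurable_nn_integral[unfolded measurable_lborel1]) measurable
  have "AE t in lborel. (\<integral>\<^sup>+s. ennreal ((cmod (?K t s))\<^sup>2) \<partial>lborel) \<noteq> \<infinity>"
    using fin by (intro nn_integral_PInf_AE) auto
  moreover have "AE t in lborel. \<forall>n. opFT g l (hs_basis n) t = (LINT s|lborel. hs_basis n s * ?K t s)"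
    unfolding AE_all_countable using opFT_kernel[OF g hs_basis_L2] by blast
  ultimately have ae: "AE t in lborel. (\<Sum>n. ennreal ((cmod (opFT g l (hs_basis n) t))\<^sup>2)) = (\<integral>\<^sup>+s. ennreal ((cmod (?K t s))\<^sup>2) \<partial>lborel)"
  proof eventually_elim
    case (elim t)
    have L: "(\<lambda>s. cnj (?K t s)) \<in> L2R"
      by (rule L2I_nn) (use elim(1) in \<open>auto simp: less_top\<close>)
    have "cmod (opFT g l (hs_basis n) t) = cmod (L2_inner lborel (\<lambda>s. cnj (?K t s)) (hs_basis n))" for n
    proof -
      have "L2_inner lborel (\<lambda>s. cnj (?K t s)) (hs_basis n) = cnj (opFT g l (hs_basis n) t)"
        using elim(2) unfolding L2_inner_def by (simp add: mult.commute flip: Bochner_Integration.integral_cnj)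
      then show ?thesis by simp
    qed
    then show ?case
      by (simp add: hs_parseval[OF L, symmetric] L2_norm_sq_nn[OF L])
  qed
  have "HS_norm_sq (opFT g l) = (\<Sum>n. \<integral>\<^sup>+t. ennreal ((cmod (opFT g l (hs_basis n) t))\<^sup>2) \<partial>lborel)"
    unfolding HS_norm_sq_eq by (simp add: L2_norm_sq_nn opFT_L2(1)[OF g hs_basis_L2])
  also have "\<dots> = (\<integral>\<^sup>+t. (\<Sum>n. ennreal ((cmod (opFT g l (hs_basis n) t))\<^sup>2)) \<partial>lborel)"
    by (rule nn_integral_suminf[symmetric]) measurable
  also have "\<dots> = (\<integral>\<^sup>+t. (\<integral>\<^sup>+s. ennreal ((cmod (?K t s))\<^sup>2) \<partial>lborel) \<partial>lborel)"
    by (rule nn_integral_cong_AE[OF ae])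
  finally show ?thesis .
qed

text \<open>The change of variables x = t - s, w = l t has Jacobian 1 / |l|, which the Plancherel
  weight |l| cancels. What remains is Plancherel in the plane on each slice of fixed x.\<close>

lemma kernel_total:
  assumes gi: "integrable lborel g" and g: "g \<in> L2 lborel"
  shows "(\<integral>\<^sup>+l. (\<integral>\<^sup>+t. (\<integral>\<^sup>+s. ennreal ((cmod (FTslice g l (t - s) (l * t)))\<^sup>2) \<partial>lborel) \<partial>lborel) * ennreal \<bar>l\<bar> \<partial>lborel)
    = ennreal ((L2_norm lborel g)\<^sup>2)"
proof -
  have m[measurable]: "g \<in> borel_measurable borel" using gi by auto
  have "(\<integral>\<^sup>+t. (\<integral>\<^sup>+s. ennreal ((cmod (FTslice g l (t - s) (l * t)))\<^sup>2) \<partial>lborel) \<partial>lborel) * ennreal \<bar>l\<bar>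
     = (\<integral>\<^sup>+x. (\<integral>\<^sup>+w. ennreal ((cmod (FTslice g l x w))\<^sup>2) \<partial>lborel) \<partial>lborel)" if l: "l \<noteq> 0" for l
  proof -
    have "(\<integral>\<^sup>+t. (\<integral>\<^sup>+s. ennreal ((cmod (FTslice g l (t - s) (l * t)))\<^sup>2) \<partial>lborel) \<partial>lborel)
      = (\<integral>\<^sup>+t. (\<integral>\<^sup>+x. ennreal ((cmod (FTslice g l x (l * t)))\<^sup>2) \<partial>lborel) \<partial>lborel)"
    proof (rule nn_integral_cong)
      fix t
      show "(\<integral>\<^sup>+s. ennreal ((cmod (FTslice g l (t - s) (l * t)))\<^sup>2) \<partial>lborel) = (\<integral>\<^sup>+x. ennreal ((cmod (FTslice g l x (l * t)))\<^sup>2) \<partial>lborel)"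
        by (subst (2) nn_integral_real_affine[where c="-1" and t=t]) simp_all
    qed
    also have "\<dots> = (\<integral>\<^sup>+x. (\<integral>\<^sup>+t. ennreal ((cmod (FTslice g l x (l * t)))\<^sup>2) \<partial>lborel) \<partial>lborel)"
      by (rule nn_integral_swap) measurable
    also have "\<dots> * ennreal \<bar>l\<bar> = (\<integral>\<^sup>+x. (\<integral>\<^sup>+t. ennreal ((cmod (FTslice g l x (l * t)))\<^sup>2) \<partial>lborel) * ennreal \<bar>l\<bar> \<partial>lborel)"
      by (rule nn_integral_multc[symmetric]) (rule lborel.borel_measurable_nn_integral, measurable)
    also have "\<dots> = (\<integral>\<^sup>+x. (\<integral>\<^sup>+w. ennreal ((cmod (FTslice g l x w))\<^sup>2) \<partial>lborel) \<partial>lborel)"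
    proof (rule nn_integral_cong)
      fix x
      show "(\<integral>\<^sup>+t. ennreal ((cmod (FTslice g l x (l * t)))\<^sup>2) \<partial>lborel) * ennreal \<bar>l\<bar> = (\<integral>\<^sup>+w. ennreal ((cmod (FTslice g l x w))\<^sup>2) \<partial>lborel)"
        by (subst (2) nn_integral_real_affine[where c=l and t=0]) (use l in \<open>simp_all add: mult.commute\<close>)
    qed
    finally show ?thesis .
  qed
  then have "AE l in lborel. (\<integral>\<^sup>+t. (\<integral>\<^sup>+s. ennreal ((cmod (FTslice g l (t - s) (l * t)))\<^sup>2) \<partial>lborel) \<partial>lborel) * ennreal \<bar>l\<bar>
     = (\<integral>\<^sup>+x. (\<integral>\<^sup>+w. ennreal ((cmod (FTslice g l x w))\<^sup>2) \<partial>lborel) \<partial>lborel)"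
    using AE_lborel_singleton[of "0::real"] by (auto elim: eventually_mono)
  then have "(\<integral>\<^sup>+l. (\<integral>\<^sup>+t. (\<integral>\<^sup>+s. ennreal ((cmod (FTslice g l (t - s) (l * t)))\<^sup>2) \<partial>lborel) \<partial>lborel) * ennreal \<bar>l\<bar> \<partial>lborel)
    = (\<integral>\<^sup>+l. (\<integral>\<^sup>+x. (\<integral>\<^sup>+w. ennreal ((cmod (FTslice g l x w))\<^sup>2) \<partial>lborel) \<partial>lborel) \<partial>lborel)"
    by (rule nn_integral_cong_AE)
  also have "\<dots> = (\<integral>\<^sup>+x. (\<integral>\<^sup>+l. (\<integral>\<^sup>+w. ennreal ((cmod (FTslice g l x w))\<^sup>2) \<partial>lborel) \<partial>lborel) \<partial>lborel)"
    by (rule nn_integral_swap) (unfold split_beta', rule lborel.borel_measurable_nn_integral, measurable)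
  also have "\<dots> = (\<integral>\<^sup>+x. (\<integral>\<^sup>+q. ennreal ((cmod (g (x, q)))\<^sup>2) \<partial>lborel) \<partial>lborel)"
  proof (rule nn_integral_cong_AE, use AE_slices_L2[OF g] AE_slices_integrable[OF gi] in eventually_elim)
    fix x assume "(\<lambda>q. g (x, q)) \<in> L2 lborel" "integrable lborel (\<lambda>q. g (x, q))"
    from plancherel_plane[OF this]
    show "(\<integral>\<^sup>+l. (\<integral>\<^sup>+w. ennreal ((cmod (FTslice g l x w))\<^sup>2) \<partial>lborel) \<partial>lborel) = (\<integral>\<^sup>+q. ennreal ((cmod (g (x, q)))\<^sup>2) \<partial>lborel)"
      by (simp add: FTslice_def)
  qed
  also have "\<dots> = ennreal ((L2_norm lborel g)\<^sup>2)"
    by (subst nn_integral_lborel_pair[symmetric]) (simp_all add: L2_norm_sq_nn[OF g])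
  finally show ?thesis .
qed

lemma opFT_plancherel:
  assumes gi: "integrable lborel g" and g: "g \<in> L2 lborel"
  shows "AE l in lborel. HS_norm_sq (opFT g l) < \<infinity>"
    and "field_norm_sq (opFT g) = ennreal ((L2_norm lborel g)\<^sup>2)"
proof -
  have m[measurable]: "g \<in> borel_measurable borel" using gi by auto
  let ?I = "\<lambda>l. \<integral>\<^sup>+t. (\<integral>\<^sup>+s. ennreal ((cmod (FTslice g l (t - s) (l * t)))\<^sup>2) \<partial>lborel) \<partial>lborel"
  have I1: "(\<lambda>(l, t). \<integral>\<^sup>+s. ennreal ((cmod (FTslice g l (t - s) (l * t)))\<^sup>2) \<partial>lborel) \<in> borel_measurable (borel \<Otimes>\<^sub>M borel)"
    unfolding split_beta' by (rule lborel.borel_measurable_nn_integral) measurable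
  have "?I \<in> borel_measurable borel"
    by (rule lborel.borel_measurable_nn_integral) (use I1 in measurable)
  then have [measurable]: "(\<lambda>l. ?I l * ennreal \<bar>l\<bar>) \<in> borel_measurable lborel" by measurable
  have "AE l in lborel. ?I l * ennreal \<bar>l\<bar> \<noteq> \<infinity>"
    using kernel_total[OF assms] by (intro nn_integral_PInf_AE) auto
  \<comment> \<open>The weighted integrand is finite almost everywhere; off l = 0 the factor |l| is
    positive, so the unweighted one is finite as well.\<close>
  with AE_lborel_singleton[of "0::real"] have fin: "AE l in lborel. ?I l < \<infinity>"
    by eventually_elim (auto simp: ennreal_mult_eq_top_iff less_top)
  then have eq: "AE l in lborel. HS_norm_sq (opFT g l) = ?I l"
    by eventually_elim (rule HS_opFT[OF gi])
  show "AE l in lborel. HS_norm_sq (opFT g l) < \<infinity>"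
    using fin eq by eventually_elim simp
  have "field_norm_sq (opFT g) = (\<integral>\<^sup>+l. ?I l * ennreal \<bar>l\<bar> \<partial>lborel)"
    unfolding field_norm_sq_def by (rule nn_integral_cong_AE) (use eq in eventually_elim, simp)
  then show "field_norm_sq (opFT g) = ennreal ((L2_norm lborel g)\<^sup>2)"
    by (simp add: kernel_total[OF assms])
qed

lemma opFT_weakly_measurable:
  assumes g: "integrable lborel g"
  shows "weakly_measurable (opFT g)"
  unfolding weakly_measurable_def
proof (intro conjI allI impI ballI)
  show "bounded_operator (opFT g l)" for l by (rule opFT_bounded[OF g])
  fix \<phi> \<psi> assume \<phi>: "\<phi> \<in> L2R" and \<psi>: "\<psi> \<in> L2R"
  have [measurable]: "\<phi> \<in> borel_measurable borel" "\<psi> \<in> borel_measurable borel" "g \<in> borel_measurable borel"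
    using \<phi> \<psi> g by (auto simp: L2_def)
  have g3 [measurable]: "g \<in> borel_measurable (borel \<Otimes>\<^sub>M borel \<Otimes>\<^sub>M borel)"
    by (simp add: borel_prod)
  have m1: "(\<lambda>((l, t), p). g p * rep3 l p \<phi> t) \<in> borel_measurable ((borel \<Otimes>\<^sub>M borel) \<Otimes>\<^sub>M (borel \<Otimes>\<^sub>M borel \<Otimes>\<^sub>M borel))"
    unfolding rep3_def split_beta' by measurable
  have [measurable]: "(\<lambda>(l, t). opFT g l \<phi> t) \<in> borel_measurable (borel \<Otimes>\<^sub>M borel)"
    unfolding opFT_def split_beta' by (rule lborel.borel_measurable_lebesgue_integral) (use m1 in \<open>simp add: borel_prod split_beta' measurable_pair_lborel\<close>)
  have "(\<lambda>(l, t). opFT g l \<phi> t * cnj (\<psi> t)) \<in> borel_measurable (borel \<Otimes>\<^sub>M lborel)"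
    unfolding measurable_pair_lborel by measurable
  then show "(\<lambda>l. L2_inner lborel (opFT g l \<phi>) \<psi>) \<in> borel_measurable borel"
    unfolding L2_inner_def by (intro lborel.borel_measurable_lebesgue_integral)
qed

section \<open>Wave packets\<close>

lemma rep3_ubox: "rep3 l (x, y, z) ubox t = ee (l * z) * gabor l x y t"
  by (simp add: rep3_def gabor_def)

lemma ubox_L2: "ubox \<in> L2R" and L2_norm_ubox [simp]: "L2_norm lborel ubox = 1"
proof -
  have "gabor 1 0 0 = ubox" by (auto simp: gabor_def fun_eq_iff)
  then show "ubox \<in> L2R" "L2_norm lborel ubox = 1"
    using gabor_L2[of 1 0 0] L2_norm_gabor[of 1 0 0] by auto
qed

lemma rep3_ubox_L2: "rep3 l p ubox \<in> L2R" "L2_norm lborel (rep3 l p ubox) = 1"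
  using rep3_L2[OF ubox_L2] by simp_all

lemma cmod_rep3_ubox_le: "cmod (rep3 l p ubox t) \<le> 1"
  by (cases p) (simp add: cmod_rep3 norm_ubox_le)

section \<open>The group law in coordinates and functions lifted to the group\<close>

definition mul3 :: "R3 \<Rightarrow> R3 \<Rightarrow> R3" where
  "mul3 = (\<lambda>(x, y, z) (w, v, u). (x + w, y + v, z + u + x * v))"

definition inv3 :: "R3 \<Rightarrow> R3" where
  "inv3 = (\<lambda>(x, y, z). (- x, - y, x * y - z))"

lemma heis3_mul: "heis3 p ** heis3 q = heis3 (mul3 p q)"
  by (cases p; cases q) (simp add: mul3_def heis_mult)

lemma heis3_inv: "matrix_inv (heis3 p) = heis3 (inv3 p)"
  by (cases p) (simp add: inv3_def heis_inverse)

lemma rep3_mul: "rep3 l (mul3 p q) \<phi> = rep3 l p (rep3 l q \<phi>)"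
proof -
  obtain x y z w v u where pq: "p = (x, y, z)" "q = (w, v, u)" by (cases p; cases q) auto
  show ?thesis
  proof
    fix t
    have "ee (l * (z + u + x * v)) * ee (- (l * (y + v) * t)) =
        ee (l * z) * ee (- (l * y * t)) * (ee (l * u) * ee (- (l * v * (t - x))))"
      by (simp add: algebra_simps flip: ee_add)
    then show "rep3 l (mul3 p q) \<phi> t = rep3 l p (rep3 l q \<phi>) t"
      by (simp add: pq mul3_def rep3_def diff_diff_eq mult.assoc)
  qed
qed

lemma rep3_inverse: "rep3 l u (rep3 l (inv3 u) \<phi>) = \<phi>"
proof -
  have "mul3 u (inv3 u) = (0, 0, 0)" by (cases u) (simp add: mul3_def inv3_def)
  then show ?thesis unfolding rep3_mul[symmetric] by (simp add: rep3_def)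
qed

lemma rep3_unitary: "L2_inner lborel (rep3 l p \<phi>) (rep3 l p \<psi>) = L2_inner lborel \<phi> \<psi>"
proof -
  obtain x y z where p: "p = (x, y, z)" by (cases p) auto
  have "ee a * ee b * A * cnj (ee a * ee b * B) = A * cnj B" for a b A B
  proof -
    have "ee a * ee (- a) = 1" "ee b * ee (- b) = 1" by (simp_all flip: ee_add)
    moreover have "ee a * ee b * A * cnj (ee a * ee b * B) = (ee a * ee (- a)) * (ee b * ee (- b)) * (A * cnj B)"
      by (simp add: mult_ac)
    ultimately show ?thesis by simp
  qed
  then have "rep3 l p \<phi> t * cnj (rep3 l p \<psi> t) = \<phi> (t - x) * cnj (\<psi> (t - x))" for t
    by (simp only: p rep3_def split_conv)
  then have "L2_inner lborel (rep3 l p \<phi>) (rep3 l p \<psi>) = (LINT t|lborel. \<phi> (t - x) * cnj (\<psi> (t - x)))"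
    by (simp only: L2_inner_def)
  also have "\<dots> = (LINT t|lborel. \<phi> t * cnj (\<psi> t))"
    by (subst lborel_integral_real_affine[where c=1 and t=x]) simp_all
  finally show ?thesis by (simp add: L2_inner_def)
qed

definition coords :: "real^4^4 \<Rightarrow> R3" where
  "coords n = (n $ 1 $ 2, n $ 2 $ 4, n $ 1 $ 4)"

lemma coords_heis3 [simp]: "coords (heis3 p) = p"
  by (cases p) (simp add: coords_def)

lemma heisenberg_heis3: "n \<in> heisenberg \<longleftrightarrow> n = heis3 (coords n)"
proof
  assume "n \<in> heisenberg"
  then obtain x y z where "n = heis3 (x, y, z)" by (auto simp: heisenberg_def)
  then show "n = heis3 (coords n)" by (simp only: coords_heis3)
next
  assume "n = heis3 (coords n)"
  then show "n \<in> heisenberg" unfolding heisenberg_def coords_def by auto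
qed

lemma coords_measurable: "coords \<in> haar \<rightarrow>\<^sub>M borel"
proof -
  have "continuous_on UNIV coords"
    unfolding coords_def by (intro continuous_intros)
  then have "coords \<in> borel \<rightarrow>\<^sub>M borel" by (rule borel_measurable_continuous_onI)
  then have "coords \<in> restrict_space borel heisenberg \<rightarrow>\<^sub>M borel" by (rule measurable_restrict_space1)
  then show ?thesis by (simp add: haar_eq)
qed

text \<open>Off the group this only reads three matrix entries; Haar measure is carried by
  \<open>heisenberg\<close>, so these values are immaterial.\<close>

definition lift :: "(R3 \<Rightarrow> complex) \<Rightarrow> real^4^4 \<Rightarrow> complex" where
  "lift F n = F (coords n)"

lemma lift_heis3 [simp]: "lift F (heis3 p) = F p"
  by (simp add: lift_def)

lemma lift_measurable: "F \<in> borel_measurable borel \<Longrightarrow> lift F \<in> borel_measurable haar"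
  unfolding lift_def[abs_def] by (rule measurable_compose[OF coords_measurable])

lemma lift_L2: "F \<in> L2 lborel \<Longrightarrow> lift F \<in> L2 haar"
  by (subst L2_haar_iff) (auto intro!: lift_measurable simp: L2_def)

section \<open>Wave packets: the inversion integral and its norm\<close>

locale band =
  fixes S :: "real set"
  assumes S_borel [measurable]: "S \<in> sets borel"
    and S_sub: "S \<subseteq> {-1..1}" and S_nz: "0 \<notin> S"
begin

definition cf :: "real \<Rightarrow> real" where
  "cf l = indicator S l * sqrt \<bar>l\<bar>"

lemma cf_measurable [measurable]: "cf \<in> borel_measurable borel"
  unfolding cf_def[abs_def] by measurable

lemma cf_bounds: "0 \<le> cf l" "cf l \<le> 1" "l \<notin> {-1..1} \<Longrightarrow> cf l = 0"
  using S_sub by (auto simp: cf_def indicator_def abs_le_iff)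

lemma abs_cf_le: "\<bar>l\<bar> * cf l \<le> 1" "\<bar>l\<bar> * cf l \<ge> 0" "\<bar>l\<bar> * cf l \<le> indicator {-1..1} l"
proof -
  show "\<bar>l\<bar> * cf l \<le> 1" 
    using cf_bounds[of l] by (cases "l \<in> {-1..1}") (auto intro!: mult_le_one)
  then show "\<bar>l\<bar> * cf l \<le> indicator {-1..1} l"
    using cf_bounds[of l] by (cases "l \<in> {-1..1}") auto
qed (simp add: cf_bounds)

definition mcoeff :: "R3 \<Rightarrow> R3 \<Rightarrow> R3 \<Rightarrow> real \<Rightarrow> complex" where
  "mcoeff u v p l = L2_inner lborel (rep3 l p (rep3 l v ubox)) (rep3 l u ubox)"

text \<open>The Plancherel inversion formula for the rank-one field \<open>field u v\<close>: the
  trace of the adjoint of the representation at p times the field, integrated against |l|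
  dl.\<close>

definition packet :: "R3 \<Rightarrow> R3 \<Rightarrow> R3 \<Rightarrow> complex" where
  "packet u v p = (LINT l|lborel. of_real (\<bar>l\<bar> * cf l) * cnj (mcoeff u v p l))"

lemma mcoeff_le: "cmod (mcoeff u v p l) \<le> 1"
  using L2_Cauchy_Schwarz[OF rep3_L2(1)[OF rep3_ubox_L2(1)] rep3_ubox_L2(1), of l p l v l u]
  by (simp add: mcoeff_def rep3_L2[OF rep3_ubox_L2(1)] rep3_ubox_L2)

lemma mcoeff_measurable: "(\<lambda>((x, y, z), l). mcoeff u v (x, y, z) l) \<in> borel_measurable ((borel \<Otimes>\<^sub>M borel \<Otimes>\<^sub>M borel) \<Otimes>\<^sub>M borel)"
proof -
  have "(\<lambda>(((x, y, z), l), t). rep3 l (x, y, z) (rep3 l v ubox) t * cnj (rep3 l u ubox t))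
     \<in> borel_measurable (((borel \<Otimes>\<^sub>M borel \<Otimes>\<^sub>M borel) \<Otimes>\<^sub>M borel) \<Otimes>\<^sub>M lborel)"
    unfolding measurable_pair_lborel rep3_def split_beta' by measurable
  then show ?thesis
    unfolding mcoeff_def L2_inner_def split_beta'
    by (intro lborel.borel_measurable_lebesgue_integral) (simp only: split_beta')
qed

lemma mcoeff_measurable2 [measurable (raw)]:
  assumes "p \<in> M \<rightarrow>\<^sub>M borel" "l \<in> borel_measurable M"
  shows "(\<lambda>x. mcoeff u v (p x) (l x)) \<in> borel_measurable M"
proof -
  have "p \<in> M \<rightarrow>\<^sub>M borel \<Otimes>\<^sub>M borel \<Otimes>\<^sub>M borel" using assms(1) by (simp add: borel_prod)
  then have "(\<lambda>x. (p x, l x)) \<in> M \<rightarrow>\<^sub>M (borel \<Otimes>\<^sub>M borel \<Otimes>\<^sub>M borel) \<Otimes>\<^sub>M borel" using assms(2) by measurable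
  from measurable_compose[OF this mcoeff_measurable] show ?thesis by (simp add: split_beta')
qed

lemma packet_measurable [measurable]: "packet u v \<in> borel_measurable borel"
  unfolding packet_def[abs_def]
  by (rule lborel.borel_measurable_lebesgue_integral) (simp only: measurable_pair_lborel split_beta', measurable)

lemma packet_pairing_integrable:
  assumes g: "integrable lborel g"
  shows "integrable (lborel \<Otimes>\<^sub>M lborel) (\<lambda>(p, l). g p * (of_real (\<bar>l\<bar> * cf l) * mcoeff u v p l))"
proof -
  have [measurable]: "g \<in> borel_measurable borel" using g by auto
  have m: "(\<lambda>(p, l). g p * (of_real (\<bar>l\<bar> * cf l) * mcoeff u v p l)) \<in> borel_measurable (lborel \<Otimes>\<^sub>M lborel)"
    by measurable
  have "(\<integral>\<^sup>+w. ennreal (norm (case w of (p, l) \<Rightarrow> g p * (of_real (\<bar>l\<bar> * cf l) * mcoeff u v p l))) \<partial>(lborel \<Otimes>\<^sub>M lborel))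
    = (\<integral>\<^sup>+p. (\<integral>\<^sup>+l. ennreal (cmod (g p) * (\<bar>l\<bar> * cf l * cmod (mcoeff u v p l))) \<partial>lborel) \<partial>lborel)"
    by (subst lborel.nn_integral_fst[symmetric]) (auto simp: norm_mult cf_bounds)
  also have "\<dots> \<le> (\<integral>\<^sup>+p. (\<integral>\<^sup>+l. ennreal (cmod (g p)) * indicator {-1..1::real} l \<partial>lborel) \<partial>lborel)"
  proof (intro nn_integral_mono)
    fix p and l :: real
    have "\<bar>l\<bar> * cf l * cmod (mcoeff u v p l) \<le> indicator {-1..1} l * 1"
      by (intro mult_mono abs_cf_le mcoeff_le) auto
    then have "ennreal (cmod (g p) * (\<bar>l\<bar> * cf l * cmod (mcoeff u v p l))) \<le> ennreal (cmod (g p) * indicator {-1..1} l)"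
      by (intro ennreal_leI mult_left_mono) auto
    then show "ennreal (cmod (g p) * (\<bar>l\<bar> * cf l * cmod (mcoeff u v p l))) \<le> ennreal (cmod (g p)) * indicator {-1..1} l"
      by (simp add: ennreal_mult ennreal_indicator)
  qed
  also have "\<dots> < \<infinity>"
    using g by (simp add: nn_integral_cmult nn_integral_multc ennreal_mult_less_top integrable_iff_bounded)
  finally show ?thesis using m by (intro integrableI_bounded) auto
qed

text \<open>Fubini moves the group integral inside the l-integral, where it becomes a matrix
  coefficient of the Fourier transform. The right-hand side is the inner product of
  \<open>opFT g\<close> with the field, obtained before the transform of the packet is
  known.\<close>

lemma packet_pairing:
  assumes g: "integrable lborel g"
  shows "L2_inner lborel g (packet u v) = (LINT l|lborel. of_real (\<bar>l\<bar> * cf l) * L2_inner lborel (opFT g l (rep3 l v ubox)) (rep3 l u ubox))"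
    and "integrable lborel (\<lambda>l. of_real (\<bar>l\<bar> * cf l) * L2_inner lborel (opFT g l (rep3 l v ubox)) (rep3 l u ubox))"
proof -
  note I = packet_pairing_integrable[OF g, of u v]
  have eq: "(LINT p|lborel. g p * (of_real (\<bar>l\<bar> * cf l) * mcoeff u v p l))
    = of_real (\<bar>l\<bar> * cf l) * L2_inner lborel (opFT g l (rep3 l v ubox)) (rep3 l u ubox)" for l
  proof -
    have "(LINT p|lborel. g p * (of_real (\<bar>l\<bar> * cf l) * mcoeff u v p l))
      = (LINT p|lborel. of_real (\<bar>l\<bar> * cf l) * (g p * mcoeff u v p l))"
      by (intro Bochner_Integration.integral_cong refl) (rule mult.left_commute)
    also have "\<dots> = of_real (\<bar>l\<bar> * cf l) * (LINT p|lborel. g p * mcoeff u v p l)"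
      by (rule integral_mult_right_zero)
    finally show ?thesis by (simp only: opFT_weak[OF g rep3_ubox_L2(1) rep3_ubox_L2(1)] mcoeff_def)
  qed
  have "L2_inner lborel g (packet u v) = (LINT p|lborel. (LINT l|lborel. g p * (of_real (\<bar>l\<bar> * cf l) * mcoeff u v p l)))"
    unfolding L2_inner_def packet_def by (simp flip: Bochner_Integration.integral_cnj)
  also have "\<dots> = (LINT l|lborel. (LINT p|lborel. g p * (of_real (\<bar>l\<bar> * cf l) * mcoeff u v p l)))"
    by (rule lborel_pair.Fubini_integral[OF I, symmetric])
  finally show "L2_inner lborel g (packet u v) = (LINT l|lborel. of_real (\<bar>l\<bar> * cf l) * L2_inner lborel (opFT g l (rep3 l v ubox)) (rep3 l u ubox))"
    by (simp only: eq)
  show "integrable lborel (\<lambda>l. of_real (\<bar>l\<bar> * cf l) * L2_inner lborel (opFT g l (rep3 l v ubox)) (rep3 l u ubox))"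
    using lborel_pair.integrable_snd[OF I] by (simp only: eq)
qed

text \<open>The integrand is c(l)^2 times the Plancherel density |l|, so this is the squared norm of
  every field \<open>field u v\<close>.\<close>

definition mass :: ennreal where
  "mass = (\<integral>\<^sup>+l. ennreal (l\<^sup>2) * indicator S l \<partial>lborel)"

lemma mass_le: "mass \<le> ennreal (2 / 3)"
proof -
  have "has_bochner_integral lborel (\<lambda>l. indicator {-1..1} l *\<^sub>R (l\<^sup>2)) (1 ^ 3 / 3 - (- 1) ^ 3 / (3::real))"
  proof (rule has_bochner_integral_FTC_Icc)
    fix x :: real
    show "((\<lambda>l. l ^ 3 / 3) has_vector_derivative x\<^sup>2) (at x within {-1..1})"
      unfolding has_real_derivative_iff_has_vector_derivative[symmetric]
      by (auto intro!: derivative_eq_intros)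
  qed (auto intro!: continuous_intros)
  then have "(\<integral>\<^sup>+l. ennreal (indicator {-1..1} l *\<^sub>R (l\<^sup>2)) \<partial>lborel) = ennreal (2 / 3)"
    by (subst nn_integral_eq_integral) (auto simp: has_bochner_integral_iff)
  moreover have "mass \<le> (\<integral>\<^sup>+l. ennreal (indicator {-1..1} l *\<^sub>R (l\<^sup>2)) \<partial>lborel)"
    unfolding mass_def using S_sub by (intro nn_integral_mono) (auto simp: indicator_def)
  ultimately show ?thesis by simp
qed

text \<open>The integrand of a matrix coefficient with its y and z phases removed. Its Fourier
  transform is a cross-ambiguity function of the two moved unit boxes.\<close>

definition vfun :: "R3 \<Rightarrow> R3 \<Rightarrow> real \<Rightarrow> real \<Rightarrow> real \<Rightarrow> complex" where
  "vfun u v l x t = rep3 l u ubox t * cnj (rep3 l v ubox (t - x))"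

lemma cnj_mcoeff: "cnj (mcoeff u v (x, y, z) l) = FT (vfun u v l x) (l * y) * ee (- (l * z))"
proof -
  have "cnj (mcoeff u v (x, y, z) l) = (LINT t|lborel. (vfun u v l x t * ee (l * y * t)) * ee (- (l * z)))"
    unfolding mcoeff_def L2_inner_def Bochner_Integration.integral_cnj[symmetric] vfun_def
    by (intro Bochner_Integration.integral_cong refl) (simp add: rep3_def mult_ac)
  then show ?thesis by (simp add: FT_def)
qed

lemma vfun_measurable [measurable]: "vfun u v l x \<in> borel_measurable borel"
  unfolding vfun_def[abs_def] by measurable

lemma vfun_nn: "(\<integral>\<^sup>+x. (\<integral>\<^sup>+t. ennreal ((cmod (vfun u v l x t))\<^sup>2) \<partial>lborel) \<partial>lborel) = 1"
proof -
  have n: "(\<integral>\<^sup>+t. ennreal ((cmod (rep3 l p ubox t))\<^sup>2) \<partial>lborel) = 1" for p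
    using L2_norm_sq_nn[OF rep3_ubox_L2(1)[of l p]] by (simp add: rep3_ubox_L2)
  have "(\<integral>\<^sup>+x. (\<integral>\<^sup>+t. ennreal ((cmod (vfun u v l x t))\<^sup>2) \<partial>lborel) \<partial>lborel)
    = (\<integral>\<^sup>+t. (\<integral>\<^sup>+x. ennreal ((cmod (vfun u v l x t))\<^sup>2) \<partial>lborel) \<partial>lborel)"
    by (rule nn_integral_swap) (unfold vfun_def, measurable)
  also have "\<dots> = (\<integral>\<^sup>+t. ennreal ((cmod (rep3 l u ubox t))\<^sup>2) * 1 \<partial>lborel)"
  proof (rule nn_integral_cong)
    fix t
    have "(\<integral>\<^sup>+x. ennreal ((cmod (vfun u v l x t))\<^sup>2) \<partial>lborel)
      = ennreal ((cmod (rep3 l u ubox t))\<^sup>2) * (\<integral>\<^sup>+x. ennreal ((cmod (rep3 l v ubox (t - x)))\<^sup>2) \<partial>lborel)"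
      by (subst nn_integral_cmult[symmetric]) (auto simp: vfun_def norm_mult power_mult_distrib ennreal_mult)
    also have "(\<integral>\<^sup>+x. ennreal ((cmod (rep3 l v ubox (t - x)))\<^sup>2) \<partial>lborel) = (\<integral>\<^sup>+x. ennreal ((cmod (rep3 l v ubox x))\<^sup>2) \<partial>lborel)"
      by (subst (2) nn_integral_real_affine[where c="-1" and t=t]) simp_all
    finally show "(\<integral>\<^sup>+x. ennreal ((cmod (vfun u v l x t))\<^sup>2) \<partial>lborel) = ennreal ((cmod (rep3 l u ubox t))\<^sup>2) * 1"
      by (simp add: n)
  qed
  finally show ?thesis by (simp add: n)
qed

lemma bounded_support_L2:
  fixes w :: "real \<Rightarrow> complex"
  assumes [measurable]: "w \<in> borel_measurable borel" and b: "\<And>t. cmod (w t) \<le> indicator {a..b} t"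
  shows "w \<in> L2R" "integrable lborel w"
proof -
  have i: "integrable lborel (indicator {a..b} :: real \<Rightarrow> real)"
    by (rule integrable_real_indicator) (auto simp: emeasure_lborel_Icc_eq)
  show "integrable lborel w"
    by (rule Bochner_Integration.integrable_bound[OF i]) (auto simp: b)
  have "(cmod (w t))\<^sup>2 \<le> indicator {a..b} t" for t
    using b[of t] power_le_one[of "cmod (w t)" 2] by (auto simp: indicator_def split: if_splits)
  then have "integrable lborel (\<lambda>t. (cmod (w t))\<^sup>2)"
    by (intro Bochner_Integration.integrable_bound[OF i]) auto
  then show "w \<in> L2R" by (simp add: L2_def)
qed

lemma vfun_L2: "vfun u v l x \<in> L2R" "integrable lborel (vfun u v l x)"
proof -
  obtain a b c where u: "u = (a, b, c)" by (cases u) auto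
  have "cmod (vfun u v l x t) \<le> indicator {a..a+1} t * 1" for t
    unfolding vfun_def norm_mult complex_mod_cnj
    by (intro mult_mono cmod_rep3_ubox_le) (auto simp: u cmod_rep3 ubox_def indicator_def)
  then have b: "cmod (vfun u v l x t) \<le> indicator {a..a+1} t" for t by simp
  show "vfun u v l x \<in> L2R" "integrable lborel (vfun u v l x)"
    by (rule bounded_support_L2[OF vfun_measurable b])+
qed

text \<open>In z the packet is a Fourier transform in l, and in y, up to a phase, one of
  \<open>vfun\<close> evaluated at l y. Plancherel in z yields (|l| c(l))^2 = |l|^3 on S, and
  Plancherel in y with its rescaling yields 1 / |l|. Integrability of the packet is not assumed, so
  the theorem for \<open>opFT\<close> cannot be quoted.\<close>

lemma packet_norm_nn: "(\<integral>\<^sup>+p. ennreal ((cmod (packet u v p))\<^sup>2) \<partial>lborel) = mass"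
proof -
  define V where "V l x y = FT (vfun u v l x) (l * y)" for l x y
  define k where "k l = \<bar>l\<bar> * cf l" for l
  have [measurable]: "k \<in> borel_measurable borel" unfolding k_def[abs_def] by measurable
  have VJ: "(\<lambda>(l, x, y). V l x y) \<in> borel_measurable (borel \<Otimes>\<^sub>M borel \<Otimes>\<^sub>M borel)"
  proof -
    have "(\<lambda>((l, x, y), t). vfun u v l x t * ee (l * y * t)) \<in> borel_measurable ((borel \<Otimes>\<^sub>M borel \<Otimes>\<^sub>M borel) \<Otimes>\<^sub>M lborel)"
      unfolding measurable_pair_lborel vfun_def rep3_def split_beta' by measurable
    then show ?thesis unfolding V_def FT_def split_beta'
      by (intro lborel.borel_measurable_lebesgue_integral) (simp only: split_beta')
  qed
  have [measurable (raw)]: "(\<lambda>q. V (a q) (b q) (c q)) \<in> borel_measurable M"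
    if "a \<in> borel_measurable M" "b \<in> borel_measurable M" "c \<in> borel_measurable M" for a b c and M :: "'m measure"
  proof -
    have "(\<lambda>q. (a q, b q, c q)) \<in> M \<rightarrow>\<^sub>M borel \<Otimes>\<^sub>M borel \<Otimes>\<^sub>M borel" using that by measurable
    from measurable_compose[OF this VJ] show ?thesis by simp
  qed
  have cm: "cnj (mcoeff u v (x, y, z) l) = V l x y * ee (- (l * z))" for x y z l
    by (simp add: cnj_mcoeff V_def)
  have V1: "cmod (V l x y) \<le> 1" for l x y
    using mcoeff_le[of u v "(x, y, 0)" l] arg_cong[OF cm[of x y 0 l], of cmod] by simp
  have z_int: "(\<integral>\<^sup>+z. ennreal ((cmod (packet u v (x, y, z)))\<^sup>2) \<partial>lborel) = (\<integral>\<^sup>+l. ennreal ((k l)\<^sup>2) * ennreal ((cmod (V l x y))\<^sup>2) \<partial>lborel)" for x y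
  proof -
    define w where "w l = of_real (k l) * V l x y" for l
    have wm: "w \<in> borel_measurable borel" unfolding w_def[abs_def] by measurable
    have b: "cmod (w l) \<le> indicator {-1..1} l" for l
    proof -
      have "cmod (w l) = (\<bar>l\<bar> * cf l) * cmod (V l x y)"
        unfolding w_def norm_mult k_def norm_of_real using abs_cf_le(2)[of l] by simp
      also have "\<dots> \<le> indicator {-1..1} l * 1"
        by (intro mult_mono abs_cf_le V1) auto
      finally show ?thesis by simp
    qed
    note w = bounded_support_L2[OF wm b]
    have "packet u v (x, y, z) = FT w (- z)" for z
      unfolding packet_def FT_def cm w_def k_def by (intro Bochner_Integration.integral_cong) (auto simp: mult_ac)
    then have "(\<integral>\<^sup>+z. ennreal ((cmod (packet u v (x, y, z)))\<^sup>2) \<partial>lborel) = (\<integral>\<^sup>+l. ennreal ((cmod (w l))\<^sup>2) \<partial>lborel)"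
      using plancherel_reflect[OF w] by simp
    then show ?thesis by (simp add: w_def norm_mult power_mult_distrib ennreal_mult)
  qed
  have y_int: "(\<integral>\<^sup>+x. (\<integral>\<^sup>+y. ennreal ((cmod (V l x y))\<^sup>2) \<partial>lborel) \<partial>lborel) = ennreal (1 / \<bar>l\<bar>)" if l: "l \<noteq> 0" for l
  proof -
    have "(\<integral>\<^sup>+y. ennreal ((cmod (V l x y))\<^sup>2) \<partial>lborel) = ennreal (1 / \<bar>l\<bar>) * (\<integral>\<^sup>+t. ennreal ((cmod (vfun u v l x t))\<^sup>2) \<partial>lborel)" for x
    proof -
      have "(\<integral>\<^sup>+t. ennreal ((cmod (vfun u v l x t))\<^sup>2) \<partial>lborel) = (\<integral>\<^sup>+w. ennreal ((cmod (FT (vfun u v l x) w))\<^sup>2) \<partial>lborel)"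
        by (rule plancherel_real[OF vfun_L2, symmetric])
      also have "\<dots> = ennreal \<bar>l\<bar> * (\<integral>\<^sup>+y. ennreal ((cmod (V l x y))\<^sup>2) \<partial>lborel)"
        unfolding V_def by (subst nn_integral_real_affine[where c=l and t=0]) (use l in simp_all)
      finally show ?thesis using l by (simp add: mult.assoc[symmetric] flip: ennreal_mult)
    qed
    moreover have "(\<lambda>x. \<integral>\<^sup>+t. ennreal ((cmod (vfun u v l x t))\<^sup>2) \<partial>lborel) \<in> borel_measurable lborel"
      by (rule lborel.borel_measurable_nn_integral) (unfold vfun_def, measurable)
    ultimately show ?thesis by (simp add: nn_integral_cmult vfun_nn)
  qed
  have "(\<integral>\<^sup>+p. ennreal ((cmod (packet u v p))\<^sup>2) \<partial>lborel) = (\<integral>\<^sup>+x. (\<integral>\<^sup>+q. ennreal ((cmod (packet u v (x, q)))\<^sup>2) \<partial>lborel) \<partial>lborel)"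
    by (rule nn_integral_lborel_pair) measurable
  also have "\<dots> = (\<integral>\<^sup>+x. (\<integral>\<^sup>+y. (\<integral>\<^sup>+z. ennreal ((cmod (packet u v (x, y, z)))\<^sup>2) \<partial>lborel) \<partial>lborel) \<partial>lborel)"
  proof (rule nn_integral_cong)
    fix x
    have "(\<lambda>q. packet u v (x, q)) \<in> borel_measurable borel"
      by (rule measurable_compose[OF borel_measurable_continuous_onI packet_measurable]) (intro continuous_intros)
    then show "(\<integral>\<^sup>+q. ennreal ((cmod (packet u v (x, q)))\<^sup>2) \<partial>lborel) = (\<integral>\<^sup>+y. (\<integral>\<^sup>+z. ennreal ((cmod (packet u v (x, y, z)))\<^sup>2) \<partial>lborel) \<partial>lborel)"
      by (intro nn_integral_lborel_pair) measurable
  qed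
  also have "\<dots> = (\<integral>\<^sup>+x. (\<integral>\<^sup>+y. (\<integral>\<^sup>+l. ennreal ((k l)\<^sup>2) * ennreal ((cmod (V l x y))\<^sup>2) \<partial>lborel) \<partial>lborel) \<partial>lborel)"
    by (simp add: z_int)
  also have "\<dots> = (\<integral>\<^sup>+x. (\<integral>\<^sup>+l. (\<integral>\<^sup>+y. ennreal ((k l)\<^sup>2) * ennreal ((cmod (V l x y))\<^sup>2) \<partial>lborel) \<partial>lborel) \<partial>lborel)"
    by (rule nn_integral_cong, rule nn_integral_swap) measurable
  also have "\<dots> = (\<integral>\<^sup>+l. (\<integral>\<^sup>+x. (\<integral>\<^sup>+y. ennreal ((k l)\<^sup>2) * ennreal ((cmod (V l x y))\<^sup>2) \<partial>lborel) \<partial>lborel) \<partial>lborel)"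
    by (rule nn_integral_swap) (unfold split_beta', rule lborel.borel_measurable_nn_integral, unfold measurable_pair_lborel, measurable)
  also have "\<dots> = (\<integral>\<^sup>+l. ennreal ((k l)\<^sup>2) * (\<integral>\<^sup>+x. (\<integral>\<^sup>+y. ennreal ((cmod (V l x y))\<^sup>2) \<partial>lborel) \<partial>lborel) \<partial>lborel)"
  proof (rule nn_integral_cong)
    fix l
    have "(\<lambda>x. \<integral>\<^sup>+y. ennreal ((cmod (V l x y))\<^sup>2) \<partial>lborel) \<in> borel_measurable lborel"
      by (rule lborel.borel_measurable_nn_integral) (unfold measurable_pair_lborel, measurable)
    then show "(\<integral>\<^sup>+x. (\<integral>\<^sup>+y. ennreal ((k l)\<^sup>2) * ennreal ((cmod (V l x y))\<^sup>2) \<partial>lborel) \<partial>lborel) = ennreal ((k l)\<^sup>2) * (\<integral>\<^sup>+x. (\<integral>\<^sup>+y. ennreal ((cmod (V l x y))\<^sup>2) \<partial>lborel) \<partial>lborel)"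
      by (simp add: nn_integral_cmult)
  qed
  also have "\<dots> = mass"
    unfolding mass_def
  proof (rule nn_integral_cong)
    fix l :: real
    show "ennreal ((k l)\<^sup>2) * (\<integral>\<^sup>+x. (\<integral>\<^sup>+y. ennreal ((cmod (V l x y))\<^sup>2) \<partial>lborel) \<partial>lborel) = ennreal (l\<^sup>2) * indicator S l"
    proof (cases "l \<in> S")
      case True
      then have l: "l \<noteq> 0" using S_nz by auto
      have "(k l)\<^sup>2 * (1 / \<bar>l\<bar>) = l\<^sup>2"
      proof -
        have "(k l)\<^sup>2 = l\<^sup>2 * \<bar>l\<bar>" using True by (simp add: k_def cf_def power_mult_distrib)
        then show ?thesis using l by simp
      qed
      moreover have "ennreal ((k l)\<^sup>2) * ennreal (1 / \<bar>l\<bar>) = ennreal ((k l)\<^sup>2 * (1 / \<bar>l\<bar>))"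
        by (rule ennreal_mult[symmetric]) auto
      ultimately show ?thesis using True by (simp only: y_int[OF l]) simp
    qed (simp add: k_def cf_def)
  qed
  finally show ?thesis .
qed

end

lemma HS_sums:
  assumes "HS_norm_sq G < \<infinity>"
  shows "(\<lambda>n. (L2_norm lborel (G (hs_basis n)))\<^sup>2) sums enn2real (HS_norm_sq G)"
proof -
  have s: "summable (\<lambda>n. (L2_norm lborel (G (hs_basis n)))\<^sup>2)"
    by (rule summable_suminf_not_top) (use assms in \<open>auto simp: HS_norm_sq_eq\<close>)
  then have "HS_norm_sq G = ennreal (\<Sum>n. (L2_norm lborel (G (hs_basis n)))\<^sup>2)"
    unfolding HS_norm_sq_eq by (rule suminf_ennreal2[rotated]) simp
  then have "enn2real (HS_norm_sq G) = (\<Sum>n. (L2_norm lborel (G (hs_basis n)))\<^sup>2)"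
    by (simp add: suminf_nonneg s)
  with summable_sums[OF s] show ?thesis by simp
qed

section \<open>The Plancherel transform of a packet\<close>

context band
begin

lemma packet_L2: "packet u v \<in> L2 lborel"
proof (rule L2I_nn)
  have "mass < \<infinity>" using mass_le by (rule le_less_trans) simp
  then show "(\<integral>\<^sup>+p. ennreal ((cmod (packet u v p))\<^sup>2) \<partial>lborel) < \<infinity>" by (simp add: packet_norm_nn)
qed simp

lemma packet_norm: "ennreal ((L2_norm lborel (packet u v))\<^sup>2) = mass"
  using L2_norm_sq_nn[OF packet_L2] packet_norm_nn by simp

lemma packet_norm_le: "(L2_norm lborel (packet u v))\<^sup>2 \<le> 2 / 3"
proof -
  have "ennreal ((L2_norm lborel (packet u v))\<^sup>2) \<le> ennreal (2 / 3)"
    unfolding packet_norm by (rule mass_le)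
  then show ?thesis by (subst (asm) ennreal_le_iff) auto
qed

definition field :: "R3 \<Rightarrow> R3 \<Rightarrow> real \<Rightarrow> operator" where
  "field u v l \<phi> t = of_real (cf l) * L2_inner lborel \<phi> (rep3 l v ubox) * rep3 l u ubox t"

lemma field_L2_norm: "L2_norm lborel (field u v l \<phi>) = cf l * cmod (L2_inner lborel \<phi> (rep3 l v ubox))"
  unfolding field_def[abs_def] L2_norm_scale by (simp add: rep3_ubox_L2 norm_mult cf_bounds)

lemma field_bounded: "bounded_operator (field u v l)"
  unfolding bounded_operator_def
proof (intro conjI ballI allI)
  show "field u v l \<phi> \<in> L2R" for \<phi>
    unfolding field_def[abs_def] by (intro L2_scale rep3_ubox_L2)
  show "AE t in lborel. field u v l (\<lambda>s. a * \<phi> s + b * \<psi> s) t = a * field u v l \<phi> t + b * field u v l \<psi> t"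
    if "\<phi> \<in> L2R" "\<psi> \<in> L2R" for \<phi> \<psi> a b
    using that by (simp add: field_def L2_inner_add_left L2_inner_scale_left L2_scale rep3_ubox_L2 algebra_simps)
  have "L2_norm lborel (field u v l \<phi>) \<le> 1 * L2_norm lborel \<phi>" if "\<phi> \<in> L2R" for \<phi>
    unfolding field_L2_norm using L2_Cauchy_Schwarz[OF that rep3_ubox_L2(1), of l v]
    by (intro mult_mono cf_bounds) (auto simp: rep3_ubox_L2)
  then show "\<exists>C. \<forall>\<phi>\<in>L2R. L2_norm lborel (field u v l \<phi>) \<le> C * L2_norm lborel \<phi>" by blast
qed

lemma field_sums: "(\<lambda>n. (L2_norm lborel (field u v l (hs_basis n)))\<^sup>2) sums (cf l)\<^sup>2"
proof -
  have eq: "(L2_norm lborel (field u v l (hs_basis n)))\<^sup>2 = (cf l)\<^sup>2 * (cmod (L2_inner lborel (rep3 l v ubox) (hs_basis n)))\<^sup>2" for n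
    unfolding field_L2_norm power_mult_distrib L2_inner_cnj[of lborel "hs_basis n" "rep3 l v ubox"] by simp
  have "(\<lambda>n. (cf l)\<^sup>2 * (cmod (L2_inner lborel (rep3 l v ubox) (hs_basis n)))\<^sup>2) sums ((cf l)\<^sup>2 * (L2_norm lborel (rep3 l v ubox))\<^sup>2)"
    by (rule sums_mult[OF total_orthonormal_expansion(2)[OF total_hs_basis rep3_ubox_L2(1)]])
  then show ?thesis unfolding eq by (simp add: rep3_ubox_L2)
qed

lemma field_HS: "HS_norm_sq (field u v l) = ennreal ((cf l)\<^sup>2)"
  unfolding HS_norm_sq_eq by (rule ennreal_sums_eq[OF field_sums]) simp

lemma cf_sq: "ennreal ((cf l)\<^sup>2) * ennreal \<bar>l\<bar> = ennreal (l\<^sup>2) * indicator S l"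
proof (cases "l \<in> S")
  case True
  have "(cf l)\<^sup>2 * \<bar>l\<bar> = l\<^sup>2" using True by (simp add: cf_def power_mult_distrib power2_eq_square)
  then show ?thesis using True by (simp flip: ennreal_mult)
qed (simp add: cf_def)

lemma field_norm_sq_field: "field_norm_sq (field u v) = mass"
  unfolding field_norm_sq_def mass_def by (simp add: field_HS cf_sq)

lemma rep3_ubox_joint: "(\<lambda>(l, t). rep3 l u ubox t) \<in> borel_measurable (borel \<Otimes>\<^sub>M borel)"
  unfolding rep3_def split_beta' by measurable

lemma field_direct_integral: "field u v \<in> HS_direct_integral"
  unfolding HS_direct_integral_def
proof (intro CollectI conjI allI impI ballI)
  show "hilbert_schmidt (field u v l)" for l
    by (simp add: hilbert_schmidt_def field_bounded field_HS)
  show "field_norm_sq (field u v) < \<infinity>"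
    unfolding field_norm_sq_field using mass_le by (rule le_less_trans) simp
  fix \<phi> \<psi> assume \<phi>: "\<phi> \<in> L2R" and \<psi>: "\<psi> \<in> L2R"
  have [measurable]: "\<phi> \<in> borel_measurable borel" "\<psi> \<in> borel_measurable borel" using \<phi> \<psi> by (auto simp: L2_def)
  note rep3_ubox_joint[measurable]
  have 1: "(\<lambda>(l, t). \<phi> t * cnj (rep3 l v ubox t)) \<in> borel_measurable (borel \<Otimes>\<^sub>M lborel)"
    unfolding measurable_pair_lborel by measurable
  have 2: "(\<lambda>(l, t). rep3 l u ubox t * cnj (\<psi> t)) \<in> borel_measurable (borel \<Otimes>\<^sub>M lborel)"
    unfolding measurable_pair_lborel by measurable
  have [measurable]: "(\<lambda>l. L2_inner lborel \<phi> (rep3 l v ubox)) \<in> borel_measurable borel"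
    "(\<lambda>l. L2_inner lborel (rep3 l u ubox) \<psi>) \<in> borel_measurable borel"
    unfolding L2_inner_def by (rule lborel.borel_measurable_lebesgue_integral[OF 1] lborel.borel_measurable_lebesgue_integral[OF 2])+
  show "(\<lambda>l. L2_inner lborel (field u v l \<phi>) \<psi>) \<in> borel_measurable lborel"
    unfolding field_def[abs_def] L2_inner_scale_left by measurable
qed

text \<open>The law of cosines for Hilbert-Schmidt operators, summed over the basis: the trace
  pairing with a rank-one operator is a single matrix coefficient. Nonnegativity of the real
  expression is recorded for passing between \<open>ennreal\<close> and real integrals.\<close>

lemma HS_field_diff:
  assumes G: "bounded_operator G" and fin: "HS_norm_sq G < \<infinity>"
  shows "HS_norm_sq (\<lambda>\<phi> t. G \<phi> t - field u v l \<phi> t) =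
      ennreal (enn2real (HS_norm_sq G) - 2 * (cf l * Re (L2_inner lborel (G (rep3 l v ubox)) (rep3 l u ubox))) + (cf l)\<^sup>2)" (is "_ = ennreal ?X")
    and "0 \<le> enn2real (HS_norm_sq G) - 2 * (cf l * Re (L2_inner lborel (G (rep3 l v ubox)) (rep3 l u ubox))) + (cf l)\<^sup>2"
proof -
  let ?b = "rep3 l v ubox" and ?a = "rep3 l u ubox"
  let ?f = "\<lambda>n. (L2_norm lborel (\<lambda>t. G (hs_basis n) t - field u v l (hs_basis n) t))\<^sup>2"
  have inner: "Re (L2_inner lborel (G (hs_basis n)) (field u v l (hs_basis n)))
    = cf l * Re (L2_inner lborel ?b (hs_basis n) * L2_inner lborel (G (hs_basis n)) ?a)" for n
    unfolding field_def[abs_def] L2_inner_scale_right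
    by (simp add: L2_inner_cnj[of lborel "hs_basis n" ?b] algebra_simps)
  have "(\<lambda>n. (L2_norm lborel (G (hs_basis n)))\<^sup>2 - 2 * (cf l * Re (L2_inner lborel ?b (hs_basis n) * L2_inner lborel (G (hs_basis n)) ?a))
      + (L2_norm lborel (field u v l (hs_basis n)))\<^sup>2) sums ?X"
    by (intro sums_add sums_diff HS_sums fin field_sums sums_mult sums_Re operator_inner_sums G rep3_ubox_L2)
  then have s: "?f sums ?X"
    unfolding L2_norm_diff_sq[OF operator_L2[OF G hs_basis_L2] operator_L2[OF field_bounded hs_basis_L2]] inner .
  show "HS_norm_sq (\<lambda>\<phi> t. G \<phi> t - field u v l \<phi> t) = ennreal ?X"
    unfolding HS_norm_sq_eq[of "\<lambda>\<phi> t. G \<phi> t - field u v l \<phi> t"] by (rule ennreal_sums_eq[OF s]) simp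
  show "0 \<le> ?X" by (rule sums_le[OF _ sums_zero s]) simp
qed

text \<open>The cross term is twice the pairing of g with the packet, which is twice the squared
  norm of g because g is a restriction of the packet. Together with the norms of
  \<open>opFT g\<close> and of the field, one squared norm of g is left with a minus sign.\<close>

lemma truncated_packet:
  fixes g :: "R3 \<Rightarrow> complex" and A :: "R3 set"
  assumes A [measurable]: "A \<in> sets borel" and Afin: "emeasure lborel A < \<infinity>"
    and g_def: "g = (\<lambda>p. indicator A p * packet u v p)"
  shows "g \<in> L2 lborel" "integrable lborel g"
    and "field_norm_sq (\<lambda>l \<phi> t. opFT g l \<phi> t - field u v l \<phi> t) =
      ennreal ((L2_norm lborel (packet u v))\<^sup>2 - (L2_norm lborel g)\<^sup>2)"
proof -
  have gm [measurable]: "g \<in> borel_measurable borel" unfolding g_def by measurable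
  have "integrable lborel (\<lambda>p. (cmod (g p))\<^sup>2)"
    by (rule Bochner_Integration.integrable_bound[OF L2_sq_integrable[OF packet_L2]])
      (auto simp: g_def indicator_def)
  then show g2: "g \<in> L2 lborel" by (simp add: L2_def)
  have iA: "integrable lborel (indicator A :: _ \<Rightarrow> real)"
    by (rule integrable_real_indicator) (use A Afin in auto)
  have "(\<lambda>p. complex_of_real (indicator A p)) \<in> L2 lborel"
  proof -
    have "(\<lambda>p. (cmod (complex_of_real (indicator A p)))\<^sup>2) = (indicator A :: _ \<Rightarrow> real)"
      by (auto simp: indicator_def fun_eq_iff)
    then show ?thesis using iA by (simp add: L2_def)
  qed
  from L2_inner_integrable[OF packet_L2 this, of u v]
  show gi: "integrable lborel g"
    by (rule Bochner_Integration.integrable_cong[THEN iffD1, OF refl, rotated]) (auto simp: g_def indicator_def)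
  have self: "L2_inner lborel g (packet u v) = of_real ((L2_norm lborel g)\<^sup>2)"
    unfolding L2_inner_self[symmetric] unfolding L2_inner_def
    by (intro Bochner_Integration.integral_cong) (auto simp: g_def indicator_def)
  \<comment> \<open>Setting the value at 0 to zero makes the norm measurable, and the weight |l|
    hides the change.\<close>
  define H where "H l = indicator (- {0}) l * HS_norm_sq (opFT g l)" for l
  have [measurable]: "H \<in> borel_measurable borel"
    unfolding H_def[abs_def] by (rule measurable_HS_norm_sq[OF opFT_weakly_measurable[OF gi]])
  have Hfin: "AE l in lborel. H l < \<infinity>"
    using opFT_plancherel(1)[OF gi g2] by eventually_elim (auto simp: H_def indicator_def)
  have HS: "HS_norm_sq (opFT g l) * ennreal \<bar>l\<bar> = H l * ennreal \<bar>l\<bar>" for l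
    by (auto simp: H_def indicator_def)
  define P where "P l = of_real (\<bar>l\<bar> * cf l) * L2_inner lborel (opFT g l (rep3 l v ubox)) (rep3 l u ubox)" for l
  have P: "integrable lborel P" "(LINT l|lborel. P l) = of_real ((L2_norm lborel g)\<^sup>2)"
    unfolding P_def[abs_def] using packet_pairing[OF gi, where u=u and v=v] by (simp_all only: self)
  then have RP: "integrable lborel (\<lambda>l. Re (P l))" "(LINT l|lborel. Re (P l)) = (L2_norm lborel g)\<^sup>2"
    by auto
  have Anni: "(\<integral>\<^sup>+l. ennreal (enn2real (H l) * \<bar>l\<bar>) \<partial>lborel) = ennreal ((L2_norm lborel g)\<^sup>2)"
  proof -
    have "(\<integral>\<^sup>+l. ennreal (enn2real (H l) * \<bar>l\<bar>) \<partial>lborel) = (\<integral>\<^sup>+l. H l * ennreal \<bar>l\<bar> \<partial>lborel)"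
      by (rule nn_integral_cong_AE) (use Hfin in eventually_elim, simp add: ennreal_mult)
    also have "\<dots> = field_norm_sq (opFT g)" by (simp add: field_norm_sq_def HS)
    finally show ?thesis by (simp add: opFT_plancherel(2)[OF gi g2])
  qed
  have Ai: "integrable lborel (\<lambda>l. enn2real (H l) * \<bar>l\<bar>)"
    by (rule integrableI_nonneg) (auto simp: Anni)
  have Aint: "(LINT l|lborel. enn2real (H l) * \<bar>l\<bar>) = (L2_norm lborel g)\<^sup>2"
    by (subst integral_eq_nn_integral) (auto simp: Anni)
  have Cnn: "(\<integral>\<^sup>+l. ennreal ((cf l)\<^sup>2 * \<bar>l\<bar>) \<partial>lborel) = ennreal ((L2_norm lborel (packet u v))\<^sup>2)"
    unfolding packet_norm mass_def by (rule nn_integral_cong) (simp add: ennreal_mult cf_sq)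
  have Ci: "integrable lborel (\<lambda>l. (cf l)\<^sup>2 * \<bar>l\<bar>)"
    by (rule integrableI_nonneg) (auto simp: Cnn)
  have Cint: "(LINT l|lborel. (cf l)\<^sup>2 * \<bar>l\<bar>) = (L2_norm lborel (packet u v))\<^sup>2"
    by (subst integral_eq_nn_integral) (auto simp: Cnn)
  let ?Y = "\<lambda>l. enn2real (H l) * \<bar>l\<bar> - 2 * Re (P l) + (cf l)\<^sup>2 * \<bar>l\<bar>"
  have pt: "AE l in lborel. HS_norm_sq (\<lambda>\<phi> t. opFT g l \<phi> t - field u v l \<phi> t) * ennreal \<bar>l\<bar> = ennreal (?Y l) \<and> 0 \<le> ?Y l"
    using opFT_plancherel(1)[OF gi g2] AE_lborel_singleton[of "0::real"]
  proof eventually_elim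
    fix l assume fin: "HS_norm_sq (opFT g l) < \<infinity>" and l: "l \<noteq> 0"
    let ?X = "enn2real (HS_norm_sq (opFT g l)) - 2 * (cf l * Re (L2_inner lborel (opFT g l (rep3 l v ubox)) (rep3 l u ubox))) + (cf l)\<^sup>2"
    have eq: "?Y l = ?X * \<bar>l\<bar>"
      using l by (simp add: H_def P_def algebra_simps)
    have "0 \<le> ?X" by (rule HS_field_diff(2)[OF opFT_bounded[OF gi] fin])
    then have "0 \<le> ?Y l" unfolding eq by (intro mult_nonneg_nonneg) auto
    moreover have "HS_norm_sq (\<lambda>\<phi> t. opFT g l \<phi> t - field u v l \<phi> t) * ennreal \<bar>l\<bar> = ennreal (?Y l)"
      unfolding eq HS_field_diff(1)[OF opFT_bounded[OF gi] fin] by (rule ennreal_mult''[symmetric]) simp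
    ultimately show "HS_norm_sq (\<lambda>\<phi> t. opFT g l \<phi> t - field u v l \<phi> t) * ennreal \<bar>l\<bar> = ennreal (?Y l) \<and> 0 \<le> ?Y l" by blast
  qed
  have "field_norm_sq (\<lambda>l \<phi> t. opFT g l \<phi> t - field u v l \<phi> t) = (\<integral>\<^sup>+l. ennreal (?Y l) \<partial>lborel)"
    unfolding field_norm_sq_def by (rule nn_integral_cong_AE) (use pt in eventually_elim, blast)
  also have "\<dots> = ennreal (LINT l|lborel. ?Y l)"
  proof (rule nn_integral_eq_integral)
    show "integrable lborel ?Y" using Ai RP(1) Ci by auto
    show "AE l in lborel. 0 \<le> ?Y l" using pt by eventually_elim blast
  qed
  also have "(LINT l|lborel. ?Y l) = (L2_norm lborel (packet u v))\<^sup>2 - (L2_norm lborel g)\<^sup>2"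
    using Ai RP(1) Ci by (simp add: Aint Cint RP(2))
  finally show "field_norm_sq (\<lambda>l \<phi> t. opFT g l \<phi> t - field u v l \<phi> t) =
      ennreal ((L2_norm lborel (packet u v))\<^sup>2 - (L2_norm lborel g)\<^sup>2)" .
qed

text \<open>Restrictions to growing balls lie in L1 and L2 and converge to the packet. Their
  distance to the field is a difference of squared norms, so convergence of the norms
  suffices.\<close>

lemma packet_plancherel: "has_plancherel_transform (lift (packet u v)) (field u v)"
proof -
  define A where "A k = cball (0::R3) (real k)" for k :: nat
  define g where "g k p = indicator (A k) p * packet u v p" for k p
  have A: "A k \<in> sets borel" "emeasure lborel (A k) < \<infinity>" for k
    unfolding A_def by (simp, rule emeasure_bounded_finite, simp)
  have gk: "g k = (\<lambda>p. indicator (A k) p * packet u v p)" for k by (simp add: g_def fun_eq_iff)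
  note T = truncated_packet[OF A gk]
  have lg: "lift (g k) \<in> borel_measurable haar" for k
    by (rule lift_measurable) (use T(1)[of k] in \<open>auto simp: L2_def\<close>)
  have li: "integrable haar (lift (g k))" for k
    using T(2)[of k] by (simp add: integrable_haar_iff[OF lg])
  have ft: "has_fourier_transform (lift (g k)) l (opFT (g k) l)" for k l
    unfolding has_fourier_transform_iff[OF li] by (simp add: opFT_bounded[OF T(2)])
  have dn: "(\<lambda>k. L2_norm lborel (\<lambda>p. g k p - packet u v p)) \<longlonglongrightarrow> 0"
  proof -
    have "(\<lambda>k. LINT p|lborel. (cmod (g k p - packet u v p))\<^sup>2) \<longlonglongrightarrow> (LINT p|(lborel :: R3 measure). (0::real))"
    proof (rule integral_dominated_convergence[where w="\<lambda>p. (cmod (packet u v p))\<^sup>2" and f="\<lambda>p. 0"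
        and s="\<lambda>k p. (cmod (g k p - packet u v p))\<^sup>2"])
      have "(\<lambda>k. (cmod (g k p - packet u v p))\<^sup>2) \<longlonglongrightarrow> 0" for p
      proof (rule tendsto_eventually)
        obtain N :: nat where "norm p \<le> real N" using real_arch_simple by blast
        then show "\<forall>\<^sub>F k in sequentially. (cmod (g k p - packet u v p))\<^sup>2 = 0"
          by (intro eventually_sequentiallyI[of N]) (auto simp: g_def A_def)
      qed
      then show "AE p in lborel. (\<lambda>k. (cmod (g k p - packet u v p))\<^sup>2) \<longlonglongrightarrow> 0" by simp
      have [measurable]: "g k \<in> borel_measurable borel" for k using T(1)[of k] by (auto simp: L2_def)
      show "(\<lambda>p. (cmod (g k p - packet u v p))\<^sup>2) \<in> borel_measurable lborel" for k by measurable
      show "AE p in lborel. norm ((cmod (g k p - packet u v p))\<^sup>2) \<le> (cmod (packet u v p))\<^sup>2" for k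
        by (auto simp: g_def indicator_def)
    qed (auto simp: L2_sq_integrable[OF packet_L2])
    then have "(\<lambda>k. sqrt (LINT p|lborel. (cmod (g k p - packet u v p))\<^sup>2)) \<longlonglongrightarrow> sqrt 0"
      by (intro tendsto_real_sqrt) simp
    then show ?thesis by (simp add: L2_norm_def)
  qed
  have "(\<lambda>k. (L2_norm lborel (packet u v))\<^sup>2 - (L2_norm lborel (g k))\<^sup>2) \<longlonglongrightarrow> (L2_norm lborel (packet u v))\<^sup>2 - (L2_norm lborel (packet u v))\<^sup>2"
    by (intro tendsto_intros L2_norm_tendsto[OF T(1) packet_L2 dn])
  from tendsto_ennrealI[OF this]
  have fn: "(\<lambda>k. field_norm_sq (\<lambda>l \<phi> t. opFT (g k) l \<phi> t - field u v l \<phi> t)) \<longlonglongrightarrow> 0"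
    unfolding T(3) by simp
  have hn: "(\<lambda>k. L2_norm haar (\<lambda>n. lift (g k) n - lift (packet u v) n)) \<longlonglongrightarrow> 0"
  proof -
    have "L2_norm haar (\<lambda>n. lift (g k) n - lift (packet u v) n) = L2_norm lborel (\<lambda>p. g k p - packet u v p)" for k
      by (subst L2_norm_haar) (auto intro!: borel_measurable_diff lg lift_measurable)
    then show ?thesis using dn by simp
  qed
  show ?thesis
    unfolding has_plancherel_transform_def
  proof (intro conjI exI[of _ "\<lambda>k. lift (g k)"] exI[of _ "\<lambda>k. opFT (g k)"] allI impI)
    show "lift (packet u v) \<in> L2 haar" by (rule lift_L2[OF packet_L2])
    show "lift (g k) \<in> L2 haar" for k by (rule lift_L2[OF T(1)])
  qed (use li ft hn fn field_direct_integral in auto)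
qed

end

section \<open>The Plancherel transform is isometric\<close>

lemma operator_coeff_le:
  assumes A: "bounded_operator A" and "\<phi> \<in> L2R" "\<psi> \<in> L2R" "L2_norm lborel \<phi> = 1" "L2_norm lborel \<psi> = 1"
  shows "ennreal ((cmod (L2_inner lborel (A \<phi>) \<psi>))\<^sup>2) \<le> HS_norm_sq A"
proof (cases "HS_norm_sq A = \<infinity>")
  case False
  then have fin: "HS_norm_sq A < \<infinity>" by (simp add: less_top)
  have "cmod (L2_inner lborel (A \<phi>) \<psi>) \<le> sqrt (enn2real (HS_norm_sq A))"
    using HS_operator_bound[OF A fin assms(2,3)] assms(4,5) by simp
  then have "(cmod (L2_inner lborel (A \<phi>) \<psi>))\<^sup>2 \<le> (sqrt (enn2real (HS_norm_sq A)))\<^sup>2"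
    by (intro power_mono) auto
  then have "ennreal ((cmod (L2_inner lborel (A \<phi>) \<psi>))\<^sup>2) \<le> ennreal (enn2real (HS_norm_sq A))"
    by (intro ennreal_leI) simp
  also have "\<dots> = HS_norm_sq A" using fin by (intro ennreal_enn2real) simp
  finally show ?thesis .
qed simp

lemma HS_norm_sq_cong:
  assumes "bounded_operator G" "bounded_operator G'"
    and "\<And>\<phi>. \<phi> \<in> L2R \<Longrightarrow> AE t in lborel. G \<phi> t = G' \<phi> t"
  shows "HS_norm_sq G = HS_norm_sq G'"
proof -
  have "L2_norm lborel (G (hs_basis n)) = L2_norm lborel (G' (hs_basis n))" for n
    by (rule L2_norm_cong_AE[OF L2_measurable L2_measurable assms(3)])
      (auto intro: operator_L2[OF assms(1)] operator_L2[OF assms(2)] hs_basis_L2)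
  then show ?thesis by (simp add: HS_norm_sq_eq)
qed

lemma field_norm_sq_cong:
  assumes "\<And>l. l \<noteq> 0 \<Longrightarrow> HS_norm_sq (G l) = HS_norm_sq (G' l)"
  shows "field_norm_sq G = field_norm_sq G'"
  unfolding field_norm_sq_def
proof (rule nn_integral_cong)
  fix l show "HS_norm_sq (G l) * ennreal \<bar>l\<bar> = HS_norm_sq (G' l) * ennreal \<bar>l\<bar>"
    using assms[of l] by (cases "l = 0") auto
qed

text \<open>The value of a field at \<open>0\<close> is arbitrary; replacing it by the zero operator makes the
  field measurable everywhere.\<close>

definition pruned :: "(real \<Rightarrow> operator) \<Rightarrow> real \<Rightarrow> operator" where
  "pruned T l = (if l = 0 then (\<lambda>\<phi> t. 0) else T l)"

lemma pruned_weakly_measurable: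
  assumes T: "T \<in> HS_direct_integral"
  shows "weakly_measurable (pruned T)" "bounded_operator (pruned T l)"
proof -
  show b: "bounded_operator (pruned T l)" for l
  proof (cases "l = 0")
    case True
    then show ?thesis
      by (auto simp: pruned_def bounded_operator_def L2_zero L2_norm_def intro!: exI[of _ 0])
  next
    case False
    then show ?thesis using T by (auto simp: pruned_def HS_direct_integral_def hilbert_schmidt_def)
  qed
  show "weakly_measurable (pruned T)"
    unfolding weakly_measurable_def
  proof (intro conjI allI impI ballI b)
    fix \<phi> \<psi> assume \<phi>: "\<phi> \<in> L2R" and \<psi>: "\<psi> \<in> L2R"
    then have [measurable]: "(\<lambda>l. L2_inner lborel (T l \<phi>) \<psi>) \<in> borel_measurable borel"
      using T by (auto simp: HS_direct_integral_def)
    have "L2_inner lborel (pruned T l \<phi>) \<psi> = indicator (- {0}) l * L2_inner lborel (T l \<phi>) \<psi>" for l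
      by (simp add: pruned_def indicator_def)
    then show "(\<lambda>l. L2_inner lborel (pruned T l \<phi>) \<psi>) \<in> borel_measurable borel" by simp
  qed
qed

lemma weakly_measurable_diff:
  assumes G: "weakly_measurable G" "\<And>l. bounded_operator (G l)"
    and T: "weakly_measurable T" "\<And>l. bounded_operator (T l)"
  shows "weakly_measurable (\<lambda>l \<phi> t. G l \<phi> t - T l \<phi> t)"
  unfolding weakly_measurable_def
proof (intro conjI allI impI ballI bounded_operator_diff G(2) T(2))
  fix \<phi> \<psi> assume \<phi>: "\<phi> \<in> L2R" and \<psi>: "\<psi> \<in> L2R"
  have [measurable]: "(\<lambda>l. L2_inner lborel (T l \<phi>) \<psi>) \<in> borel_measurable borel"
    "(\<lambda>l. L2_inner lborel (G l \<phi>) \<psi>) \<in> borel_measurable borel"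
    using G(1) T(1) \<phi> \<psi> by (auto simp: weakly_measurable_def)
  show "(\<lambda>l. L2_inner lborel (\<lambda>t. G l \<phi> t - T l \<phi> t) \<psi>) \<in> borel_measurable borel"
    by (simp add: L2_inner_diff_left operator_L2[OF G(2)] operator_L2[OF T(2)] \<phi> \<psi>)
qed

lemma measurable_HS_weighted:
  assumes "weakly_measurable T"
  shows "(\<lambda>l. HS_norm_sq (T l) * ennreal \<bar>l\<bar>) \<in> borel_measurable borel"
proof -
  note measurable_HS_norm_sq[OF assms, measurable]
  have "HS_norm_sq (T l) * ennreal \<bar>l\<bar> = (indicator (- {0}) l * HS_norm_sq (T l)) * ennreal \<bar>l\<bar>" for l
    by (auto simp: indicator_def)
  then show ?thesis by simp
qed

lemma field_norm_sq_eps: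
  assumes G: "weakly_measurable G" "\<And>l. bounded_operator (G l)"
    and T: "weakly_measurable T" "\<And>l. bounded_operator (T l)" and e: "\<epsilon> > 0"
  shows "field_norm_sq G \<le> ennreal (1 + \<epsilon>) * field_norm_sq T
    + ennreal (1 + 1/\<epsilon>) * field_norm_sq (\<lambda>l \<phi> t. G l \<phi> t - T l \<phi> t)"
proof -
  note [measurable] = measurable_HS_weighted[OF T(1)] measurable_HS_weighted[OF weakly_measurable_diff[OF G T]]
  have "field_norm_sq G \<le> (\<integral>\<^sup>+l. ennreal (1 + \<epsilon>) * (HS_norm_sq (T l) * ennreal \<bar>l\<bar>)
      + ennreal (1 + 1/\<epsilon>) * (HS_norm_sq (\<lambda>\<phi> t. G l \<phi> t - T l \<phi> t) * ennreal \<bar>l\<bar>) \<partial>lborel)"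
    unfolding field_norm_sq_def
  proof (rule nn_integral_mono)
    fix l
    have "HS_norm_sq (G l) * ennreal \<bar>l\<bar> \<le> (ennreal (1 + \<epsilon>) * HS_norm_sq (T l)
      + ennreal (1 + 1/\<epsilon>) * HS_norm_sq (\<lambda>\<phi> t. G l \<phi> t - T l \<phi> t)) * ennreal \<bar>l\<bar>"
      by (intro mult_right_mono HS_norm_sq_eps G T e) simp
    then show "HS_norm_sq (G l) * ennreal \<bar>l\<bar> \<le> ennreal (1 + \<epsilon>) * (HS_norm_sq (T l) * ennreal \<bar>l\<bar>)
      + ennreal (1 + 1/\<epsilon>) * (HS_norm_sq (\<lambda>\<phi> t. G l \<phi> t - T l \<phi> t) * ennreal \<bar>l\<bar>)"
      by (simp add: distrib_right mult.assoc)
  qed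
  also have "\<dots> = ennreal (1 + \<epsilon>) * field_norm_sq T
    + ennreal (1 + 1/\<epsilon>) * field_norm_sq (\<lambda>l \<phi> t. G l \<phi> t - T l \<phi> t)"
    unfolding field_norm_sq_def by (simp add: nn_integral_add nn_integral_cmult)
  finally show ?thesis .
qed

text \<open>Fourier transforms are fixed only up to null sets, and Hilbert-Schmidt norms do not see
  the difference. The approximating transforms may therefore be taken to be \<open>opFT\<close>, and
  the limit field to be zero at l = 0.\<close>

lemma plancherel_sequence:
  assumes "has_plancherel_transform h T"
  obtains g where "\<And>k. integrable lborel (g k)" "\<And>k. g k \<in> L2 lborel"
    "(\<lambda>k. L2_norm lborel (\<lambda>p. g k p - h (heis3 p))) \<longlonglongrightarrow> 0"
    "(\<lambda>k. field_norm_sq (\<lambda>l \<phi> t. opFT (g k) l \<phi> t - pruned T l \<phi> t)) \<longlonglongrightarrow> 0"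
proof -
  obtain g G where g: "\<And>k. integrable haar (g k)" "\<And>k::nat. g k \<in> L2 haar"
    and G: "\<And>k l. l \<noteq> 0 \<Longrightarrow> has_fourier_transform (g k) l (G k l)"
    and lim: "(\<lambda>k. L2_norm haar (\<lambda>n. g k n - h n)) \<longlonglongrightarrow> 0"
    and fl: "(\<lambda>k. field_norm_sq (\<lambda>l \<phi> t. G k l \<phi> t - T l \<phi> t)) \<longlonglongrightarrow> 0"
    using assms unfolding has_plancherel_transform_def by blast
  have h: "h \<in> L2 haar" and T: "T \<in> HS_direct_integral" using assms by (auto simp: has_plancherel_transform_def)
  have [measurable]: "g k \<in> borel_measurable haar" "h \<in> borel_measurable haar" for k using g(1) h by (auto simp: L2_def)
  define g3 where "g3 k p = g k (heis3 p)" for k p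
  have i3: "integrable lborel (g3 k)" for k using g(1)[of k] by (simp add: g3_def[abs_def] integrable_haar_iff)
  have "field_norm_sq (\<lambda>l \<phi> t. G k l \<phi> t - T l \<phi> t) = field_norm_sq (\<lambda>l \<phi> t. opFT (g3 k) l \<phi> t - pruned T l \<phi> t)" for k
  proof (rule field_norm_sq_cong, rule HS_norm_sq_cong)
    fix l :: real assume l: "l \<noteq> 0"
    have GG: "bounded_operator (G k l)" "\<And>\<phi>. \<phi> \<in> L2R \<Longrightarrow> AE t in lborel. G k l \<phi> t = opFT (g3 k) l \<phi> t"
      using G[OF l, of k] unfolding has_fourier_transform_iff[OF g(1)] g3_def[abs_def] by auto
    have TT: "bounded_operator (T l)" using pruned_weakly_measurable(2)[OF T, of l] l by (simp add: pruned_def)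
    show "bounded_operator (\<lambda>\<phi> t. G k l \<phi> t - T l \<phi> t)" by (rule bounded_operator_diff[OF GG(1) TT])
    show "bounded_operator (\<lambda>\<phi> t. opFT (g3 k) l \<phi> t - pruned T l \<phi> t)"
      by (rule bounded_operator_diff[OF opFT_bounded[OF i3] pruned_weakly_measurable(2)[OF T]])
    fix \<phi> assume "\<phi> \<in> L2R"
    from GG(2)[OF this] show "AE t in lborel. G k l \<phi> t - T l \<phi> t = opFT (g3 k) l \<phi> t - pruned T l \<phi> t"
      by eventually_elim (simp add: pruned_def l)
  qed
  moreover have "L2_norm haar (\<lambda>n. g k n - h n) = L2_norm lborel (\<lambda>p. g3 k p - h (heis3 p))" for k
    unfolding g3_def by (rule L2_norm_haar) measurable
  moreover have "g3 k \<in> L2 lborel" for k using g(2)[of k] by (simp add: g3_def[abs_def] L2_haar_iff)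
  ultimately show thesis using that[of g3] i3 lim fl by simp
qed

lemma real_le_of_eps:
  fixes a b :: real
  assumes "a \<ge> 0" "b \<ge> 0" "\<And>\<epsilon>. \<epsilon> > 0 \<Longrightarrow> a \<le> (1 + \<epsilon>) * b"
  shows "a \<le> b"
proof (rule ccontr)
  assume "\<not> a \<le> b"
  then have d: "a - b > 0" by simp
  define \<epsilon> where "\<epsilon> = (a - b) / (2 * (b + 1))"
  have e: "\<epsilon> > 0" using d assms(2) by (simp add: \<epsilon>_def)
  have "\<epsilon> * b \<le> \<epsilon> * (b + 1)" using e by simp
  also have "\<dots> = (a - b) / 2" using assms(2) by (simp add: \<epsilon>_def field_simps)
  finally have "(1 + \<epsilon>) * b < a" using d by (simp add: distrib_right)
  with assms(3)[OF e] show False by simp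
qed

text \<open>The identity is known for the approximating functions. The epsilon inequalities pass it
  to the limit in both directions, the error terms vanishing for each fixed epsilon before epsilon
  tends to 0.\<close>

theorem plancherel_isometry:
  assumes P: "has_plancherel_transform h T"
  shows "field_norm_sq T = ennreal ((L2_norm haar h)\<^sup>2)"
proof -
  have h: "h \<in> L2 haar" and T: "T \<in> HS_direct_integral" using P by (auto simp: has_plancherel_transform_def)
  have hm: "h \<in> borel_measurable haar" using h by (auto simp: L2_def)
  let ?h = "\<lambda>p. h (heis3 p)"
  have h3: "?h \<in> L2 lborel" using h L2_haar_iff[OF hm] by simp
  obtain g where g: "\<And>k. integrable lborel (g k)" "\<And>k. g k \<in> L2 lborel"
    and lim: "(\<lambda>k. L2_norm lborel (\<lambda>p. g k p - ?h p)) \<longlonglongrightarrow> 0"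
    and fl: "(\<lambda>k. field_norm_sq (\<lambda>l \<phi> t. opFT (g k) l \<phi> t - pruned T l \<phi> t)) \<longlonglongrightarrow> 0"
    using plancherel_sequence[OF P] by blast
  note Tp = pruned_weakly_measurable[OF T]
  define D where "D k = field_norm_sq (\<lambda>l \<phi> t. opFT (g k) l \<phi> t - pruned T l \<phi> t)" for k
  have D': "field_norm_sq (\<lambda>l \<phi> t. pruned T l \<phi> t - opFT (g k) l \<phi> t) = D k" for k
    unfolding D_def field_norm_sq_def HS_norm_sq_eq by (subst L2_norm_minus) simp
  have fl: "D \<longlonglongrightarrow> 0" using fl by (simp add: D_def[abs_def])
  have nT: "field_norm_sq (pruned T) = field_norm_sq T"
    by (rule field_norm_sq_cong) (simp add: pruned_def)
  have fin: "field_norm_sq T < \<infinity>" using T by (simp add: HS_direct_integral_def)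
  define b where "b = enn2real (field_norm_sq T)"
  have b: "field_norm_sq T = ennreal b" "b \<ge> 0" using fin by (auto simp: b_def)
  define a where "a = (L2_norm lborel ?h)\<^sup>2"
  have na: "(\<lambda>k. ennreal ((L2_norm lborel (g k))\<^sup>2)) \<longlonglongrightarrow> ennreal a"
    unfolding a_def by (intro tendsto_intros L2_norm_tendsto[OF g(2) h3 lim])
  have lim2: "(\<lambda>k. ennreal (1 + 1/\<epsilon>) * D k) \<longlonglongrightarrow> 0" for \<epsilon> :: real
    using ennreal_tendsto_cmult[OF _ fl, of "ennreal (1 + 1/\<epsilon>)"] by simp
  have ab: "a \<le> (1 + \<epsilon>) * b" if e: "\<epsilon> > 0" for \<epsilon>
  proof -
    have "ennreal a \<le> ennreal (1 + \<epsilon>) * ennreal b + 0"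
    proof (rule LIMSEQ_le[OF na])
      show "(\<lambda>k. ennreal (1 + \<epsilon>) * ennreal b + ennreal (1 + 1/\<epsilon>) * D k) \<longlonglongrightarrow> ennreal (1 + \<epsilon>) * ennreal b + 0"
        by (intro tendsto_add tendsto_const lim2)
      show "\<exists>N. \<forall>k\<ge>N. ennreal ((L2_norm lborel (g k))\<^sup>2) \<le> ennreal (1 + \<epsilon>) * ennreal b + ennreal (1 + 1/\<epsilon>) * D k"
        using field_norm_sq_eps[OF opFT_weakly_measurable[OF g(1)] opFT_bounded[OF g(1)] Tp e]
        by (simp add: opFT_plancherel(2)[OF g] nT b D_def)
    qed
    moreover have "ennreal (1 + \<epsilon>) * ennreal b = ennreal ((1 + \<epsilon>) * b)"
      using e b(2) by (intro ennreal_mult[symmetric]) auto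
    ultimately have "ennreal a \<le> ennreal ((1 + \<epsilon>) * b)" by (simp only: add_0_right)
    then show ?thesis using e b(2) by (subst (asm) ennreal_le_iff) auto
  qed
  have ba: "b \<le> (1 + \<epsilon>) * a" if e: "\<epsilon> > 0" for \<epsilon>
  proof -
    have "ennreal b \<le> ennreal (1 + \<epsilon>) * ennreal a + 0"
    proof (rule LIMSEQ_le[OF tendsto_const])
      show "(\<lambda>k. ennreal (1 + \<epsilon>) * ennreal ((L2_norm lborel (g k))\<^sup>2) + ennreal (1 + 1/\<epsilon>) * D k) \<longlonglongrightarrow> ennreal (1 + \<epsilon>) * ennreal a + 0"
        by (intro tendsto_add ennreal_tendsto_cmult na lim2) simp
      show "\<exists>N. \<forall>k\<ge>N. ennreal b \<le> ennreal (1 + \<epsilon>) * ennreal ((L2_norm lborel (g k))\<^sup>2) + ennreal (1 + 1/\<epsilon>) * D k"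
        using field_norm_sq_eps[OF Tp opFT_weakly_measurable[OF g(1)] opFT_bounded[OF g(1)] e]
        by (simp add: opFT_plancherel(2)[OF g] nT b D')
    qed
    moreover have "ennreal (1 + \<epsilon>) * ennreal a = ennreal ((1 + \<epsilon>) * a)"
      using e by (intro ennreal_mult[symmetric]) (auto simp: a_def)
    ultimately have "ennreal b \<le> ennreal ((1 + \<epsilon>) * a)" by (simp only: add_0_right)
    then show ?thesis using e by (subst (asm) ennreal_le_iff) (auto simp: a_def)
  qed
  have "a = b"
    using real_le_of_eps[OF _ b(2) ab] real_le_of_eps[OF b(2) _ ba] by (simp add: a_def order.antisym)
  then show ?thesis using b by (simp add: a_def L2_norm_haar[OF hm])
qed

section \<open>Inner products with packets on the spectral side\<close>

context band
begin

text \<open>Both sides are continuous in h, so the formula extends from L1 and L2 by approximation.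
  For the right-hand side this means writing the l-integral as an inner product in L2 of the
  line.\<close>

lemma packet_inner:
  assumes P: "has_plancherel_transform h T"
  shows "L2_inner haar h (lift (packet u v)) =
      (LINT l|lborel. of_real (\<bar>l\<bar> * cf l) * L2_inner lborel (T l (rep3 l v ubox)) (rep3 l u ubox))"
proof -
  have h: "h \<in> L2 haar" and T: "T \<in> HS_direct_integral" using P by (auto simp: has_plancherel_transform_def)
  have hm: "h \<in> borel_measurable haar" using h by (auto simp: L2_def)
  let ?h = "\<lambda>p. h (heis3 p)"
  have h3: "?h \<in> L2 lborel" using h L2_haar_iff[OF hm] by simp
  obtain g where g: "\<And>k. integrable lborel (g k)" "\<And>k. g k \<in> L2 lborel"
    and lim: "(\<lambda>k. L2_norm lborel (\<lambda>p. g k p - ?h p)) \<longlonglongrightarrow> 0"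
    and fl: "(\<lambda>k. field_norm_sq (\<lambda>l \<phi> t. opFT (g k) l \<phi> t - pruned T l \<phi> t)) \<longlonglongrightarrow> 0"
    using plancherel_sequence[OF P] by blast
  note Tp = pruned_weakly_measurable[OF T]
  let ?\<beta> = "\<lambda>l. rep3 l v ubox" and ?\<alpha> = "\<lambda>l. rep3 l u ubox"
  \<comment> \<open>The density |l| c(l) is split into sqrt |l| times sqrt |l| c(l). The second
    factor has squared norm \<open>mass\<close>, and the first, multiplied by the matrix
    coefficient, is bounded by the field norm.\<close>
  define a where "a l = complex_of_real (sqrt \<bar>l\<bar> * cf l)" for l
  define w where "w A l = of_real (sqrt \<bar>l\<bar>) * (indicator (- {0}) l * L2_inner lborel (A l (?\<beta> l)) (?\<alpha> l))" for A :: "real \<Rightarrow> operator" and l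
  have wm: "w A \<in> borel_measurable borel" if "weakly_measurable A" for A
  proof -
    note measurable_operator_inner[OF that rep3_ubox_joint rep3_ubox_joint rep3_ubox_L2(1) rep3_ubox_L2(1), measurable]
    show ?thesis unfolding w_def[abs_def] by measurable
  qed
  have wn: "(\<integral>\<^sup>+l. ennreal ((cmod (w A l))\<^sup>2) \<partial>lborel) \<le> field_norm_sq A" if A: "\<And>l. bounded_operator (A l)" for A
    unfolding field_norm_sq_def
  proof (rule nn_integral_mono)
    fix l
    show "ennreal ((cmod (w A l))\<^sup>2) \<le> HS_norm_sq (A l) * ennreal \<bar>l\<bar>"
    proof (cases "l = 0")
      case False
      then have "(cmod (w A l))\<^sup>2 = (cmod (L2_inner lborel (A l (?\<beta> l)) (?\<alpha> l)))\<^sup>2 * \<bar>l\<bar>"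
        by (simp add: w_def norm_mult power_mult_distrib)
      then show ?thesis
        using operator_coeff_le[OF A rep3_ubox_L2(1) rep3_ubox_L2(1) rep3_ubox_L2(2) rep3_ubox_L2(2), of l l v l u]
        by (simp add: ennreal_mult mult_right_mono)
    qed (simp add: w_def)
  qed
  have a2: "a \<in> L2R"
  proof (rule L2I_nn)
    have "(\<integral>\<^sup>+l. ennreal ((cmod (a l))\<^sup>2) \<partial>lborel) = mass"
      unfolding mass_def
    proof (rule nn_integral_cong)
      fix l
      have "(cmod (a l))\<^sup>2 = (cf l)\<^sup>2 * \<bar>l\<bar>"
        by (simp add: a_def norm_mult power_mult_distrib cf_bounds)
      then show "ennreal ((cmod (a l))\<^sup>2) = ennreal (l\<^sup>2) * indicator S l"
        by (simp only: cf_sq[symmetric]) (simp add: ennreal_mult)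
    qed
    then show "(\<integral>\<^sup>+l. ennreal ((cmod (a l))\<^sup>2) \<partial>lborel) < \<infinity>" using le_less_trans[OF mass_le] by simp
  qed (unfold a_def[abs_def], measurable)
  have wL: "w A \<in> L2R" if "weakly_measurable A" "\<And>l. bounded_operator (A l)" "field_norm_sq A < \<infinity>" for A
    by (rule L2I_nn) (use wm[OF that(1)] le_less_trans[OF wn[OF that(2)] that(3)] in auto)
  have nT: "field_norm_sq (pruned T) = field_norm_sq T"
    by (rule field_norm_sq_cong) (simp add: pruned_def)
  have Tfin: "field_norm_sq (pruned T) < \<infinity>" using T by (simp add: HS_direct_integral_def nT)
  have gW: "weakly_measurable (opFT (g k))" "\<And>l. bounded_operator (opFT (g k) l)" "field_norm_sq (opFT (g k)) < \<infinity>" for k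
    using opFT_weakly_measurable[OF g(1)] opFT_bounded[OF g(1)] by (simp_all add: opFT_plancherel(2)[OF g])
  note wT = wL[OF Tp Tfin] and wG = wL[OF gW]
  have wa: "L2_inner lborel (w A) a = (LINT l|lborel. of_real (\<bar>l\<bar> * cf l) * L2_inner lborel (A l (?\<beta> l)) (?\<alpha> l))" for A
    unfolding L2_inner_def[of _ "w A" a]
  proof (rule Bochner_Integration.integral_cong[OF refl])
    fix l
    have "complex_of_real (sqrt \<bar>l\<bar>) * complex_of_real (sqrt \<bar>l\<bar>) = of_real \<bar>l\<bar>"
      by (simp flip: of_real_mult)
    then show "w A l * cnj (a l) = of_real (\<bar>l\<bar> * cf l) * L2_inner lborel (A l (?\<beta> l)) (?\<alpha> l)"
      by (cases "l = 0") (simp_all add: w_def a_def mult_ac)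
  qed
  have diff: "w (opFT (g k)) l - w (pruned T) l = w (\<lambda>l \<phi> t. opFT (g k) l \<phi> t - pruned T l \<phi> t) l" for k l
    unfolding w_def by (simp add: L2_inner_diff_left operator_L2[OF gW(2)] operator_L2[OF Tp(2)] rep3_ubox_L2 right_diff_distrib)
  have "(\<lambda>k. ennreal ((L2_norm lborel (\<lambda>l. w (opFT (g k)) l - w (pruned T) l))\<^sup>2)) \<longlonglongrightarrow> 0"
  proof (rule tendsto_sandwich[OF _ _ tendsto_const fl])
    show "\<forall>\<^sub>F k in sequentially. ennreal ((L2_norm lborel (\<lambda>l. w (opFT (g k)) l - w (pruned T) l))\<^sup>2)
        \<le> field_norm_sq (\<lambda>l \<phi> t. opFT (g k) l \<phi> t - pruned T l \<phi> t)"
      unfolding L2_norm_sq_nn[OF L2_diff[OF wG wT]] unfolding diff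
      by (intro always_eventually allI wn bounded_operator_diff gW(2) Tp(2))
  qed simp
  then have "(\<lambda>k. (L2_norm lborel (\<lambda>l. w (opFT (g k)) l - w (pruned T) l))\<^sup>2) \<longlonglongrightarrow> 0"
    by (subst (asm) ennreal_0[symmetric]) (simp only: tendsto_ennreal_iff eventually_True zero_le_power2 order_refl)
  then have "(\<lambda>k. sqrt ((L2_norm lborel (\<lambda>l. w (opFT (g k)) l - w (pruned T) l))\<^sup>2)) \<longlonglongrightarrow> sqrt 0"
    by (rule tendsto_real_sqrt)
  then have wlim: "(\<lambda>k. L2_norm lborel (\<lambda>l. w (opFT (g k)) l - w (pruned T) l)) \<longlonglongrightarrow> 0" by simp
  have "(\<lambda>k. L2_inner lborel (g k) (packet u v)) \<longlonglongrightarrow> L2_inner lborel ?h (packet u v)"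
    by (rule L2_inner_tendsto_left[OF g(2) h3 packet_L2 lim])
  moreover have "(\<lambda>k. L2_inner lborel (g k) (packet u v)) \<longlonglongrightarrow> L2_inner lborel (w (pruned T)) a"
    using L2_inner_tendsto_left[OF wG wT a2 wlim] by (simp only: wa packet_pairing(1)[OF g(1)])
  ultimately have "L2_inner lborel ?h (packet u v) = L2_inner lborel (w (pruned T)) a"
    by (rule LIMSEQ_unique)
  also have "\<dots> = (LINT l|lborel. of_real (\<bar>l\<bar> * cf l) * L2_inner lborel (T l (?\<beta> l)) (?\<alpha> l))"
    unfolding wa by (rule Bochner_Integration.integral_cong) (auto simp: pruned_def)
  finally show ?thesis
    by (subst L2_inner_haar[OF hm lift_measurable]) auto
qed

end

section \<open>The Parseval frame\<close>

lemma has_sum_of_nn_integral: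
  fixes f :: "'i \<Rightarrow> real"
  assumes f: "\<And>i. f i \<ge> 0" and c: "c \<ge> 0"
    and eq: "(\<integral>\<^sup>+i. ennreal (f i) \<partial>count_space I) = ennreal c"
  shows "(f has_sum c) I"
proof -
  have "integrable (count_space I) f"
    by (rule integrableI_nonneg) (auto simp: f eq)
  then have s: "Infinite_Set_Sum.abs_summable_on f I" by (simp add: abs_summable_on_def)
  have "ennreal (infsetsum f I) = ennreal c"
    using nn_integral_conv_infsetsum[OF s] f eq by simp
  then have "infsetsum f I = c"
    using infsetsum_nonneg[of I f] f c by simp
  moreover have as: "Infinite_Sum.abs_summable_on f I" using s abs_summable_equivalent by blast
  ultimately have "infsum f I = c" using infsetsum_infsum[OF s] by simp
  moreover have "f summable_on I" using as by (rule abs_summable_summable)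
  ultimately show ?thesis by (metis has_sum_infsum)
qed

text \<open>Translation congruence ignores null sets. Almost every point avoids all integer
  translates of the exceptional sets, because there are countably many.\<close>

lemma AE_translates_not_null:
  fixes N :: "real set"
  assumes "N \<in> null_sets lebesgue"
  shows "AE x in lborel. \<forall>j::int. x + of_int j \<notin> N"
proof -
  obtain N' where N': "N' \<in> null_sets lborel" "N \<subseteq> N'"
    using assms by (auto simp: null_sets_completion_iff2)
  have [measurable]: "N' \<in> sets borel" using N' by auto
  have "AE x in lborel. x \<notin> N'" by (rule AE_not_in[OF N'(1)])
  then have "AE x in lborel. of_int j + x \<notin> N'" for j :: int
    using AE_borel_affine[of 1 "\<lambda>x. x \<notin> N'" "of_int j"] by simp
  then have "AE x in lborel. \<forall>j::int. of_int j + x \<notin> N'" by (simp add: AE_all_countable)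
  then show ?thesis by eventually_elim (use N' in \<open>auto simp: add.commute\<close>)
qed

text \<open>Only the injectivity of the congruence enters: a Parseval frame needs no surjectivity onto
  \<open>(0, 1]\<close>.\<close>

lemma packing_congruent:
  assumes "translation_congruent S {0<..1}"
  shows "packing S"
proof -
  obtain I' J' and k :: "real \<Rightarrow> int" where
    N: "sym_diff S I' \<in> null_sets lebesgue" "sym_diff {0<..1} J' \<in> null_sets lebesgue"
    and bij: "bij_betw (\<lambda>l. l + of_int (k l)) I' J'"
    using assms unfolding translation_congruent_def by blast
  have "AE x in lborel. x \<in> {0..<1} \<longrightarrow> (\<forall>i j :: int. x + of_int i \<in> S \<longrightarrow> x + of_int j \<in> S \<longrightarrow> i = j)"
    using AE_translates_not_null[OF N(1)] AE_translates_not_null[OF N(2)] AE_lborel_singleton[of "0::real"]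
  proof eventually_elim
    case (elim x)
    show ?case
    proof (intro impI allI)
      fix i j :: int
      assume x: "x \<in> {0..<1}" and S: "x + of_int i \<in> S" "x + of_int j \<in> S"
      \<comment> \<open>The congruence moves x + n by an integer into (0, 1], and the only point of
        that coset there is x itself. Hence all points of the coset in S have the same image, and
        injectivity identifies them.\<close>
      have ret: "x + of_int n \<in> I' \<and> x + of_int n + of_int (k (x + of_int n)) = x" if "x + of_int n \<in> S" for n
      proof -
        have I: "x + of_int n \<in> I'" using that elim(1) by auto
        define m where "m = n + k (x + of_int n)"
        have "x + of_int m \<in> J'" using bij_betwE[OF bij] I unfolding m_def by (auto simp: add.assoc)
        then have "x + of_int m \<in> {0<..1}" using elim(2) by auto
        \<comment> \<open>Here x = 0 has been excluded: it would allow m = 1, as 1 belongs to (0,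
          1].\<close>
        then have "m = 0" using x elim(3) by (auto) 
        then show ?thesis using I by (simp add: m_def add.assoc flip: of_int_add)
      qed
      have "x + of_int i = x + of_int j"
        using ret[OF S(1)] ret[OF S(2)] bij unfolding bij_betw_def inj_on_def by metis
      then show "i = j" by simp
    qed
  qed
  then show ?thesis
    unfolding packing_def by (subst AE_restrict_space_iff) auto
qed

section \<open>Summation over the index lattice\<close>

lemma gabor_parseval_pair:
  assumes "l \<noteq> 0" "\<bar>l\<bar> \<le> 1" "v \<in> L2 lborel"
  shows "(\<integral>\<^sup>+k. ennreal ((cmod (L2_inner lborel v (gabor l (of_int (fst k)) (of_int (snd k)))))\<^sup>2) \<partial>count_space (UNIV :: (int \<times> int) set))
    = ennreal (1 / \<bar>l\<bar>) * ennreal ((L2_norm lborel v)\<^sup>2)"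
  unfolding gabor_parseval[OF assms, symmetric] by (subst nn_integral_fst_count_space[symmetric]) simp

text \<open>The inner sum is the Gabor frame identity for the vector A g, the outer one is
  \<open>HS_frame\<close> for A; each contributes 1 / |l|.\<close>

lemma gabor_frame_operator:
  assumes l: "l \<noteq> 0" "\<bar>l\<bar> \<le> 1" and A: "bounded_operator A" and fin: "HS_norm_sq A < \<infinity>"
  shows "(\<integral>\<^sup>+m. (\<integral>\<^sup>+k. ennreal ((cmod (L2_inner lborel (A (gabor l (of_int (fst m)) (of_int (snd m)))) (gabor l (of_int (fst k)) (of_int (snd k)))))\<^sup>2)
      \<partial>count_space (UNIV :: (int \<times> int) set)) \<partial>count_space (UNIV :: (int \<times> int) set)) = ennreal (1 / l\<^sup>2) * HS_norm_sq A"
proof -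
  have "(\<integral>\<^sup>+m. (\<integral>\<^sup>+k. ennreal ((cmod (L2_inner lborel (A (gabor l (of_int (fst m)) (of_int (snd m)))) (gabor l (of_int (fst k)) (of_int (snd k)))))\<^sup>2)
      \<partial>count_space (UNIV :: (int \<times> int) set)) \<partial>count_space (UNIV :: (int \<times> int) set))
    = (\<integral>\<^sup>+m. ennreal (1 / \<bar>l\<bar>) * ennreal ((L2_norm lborel (A (gabor l (of_int (fst m)) (of_int (snd m)))))\<^sup>2) \<partial>count_space (UNIV :: (int \<times> int) set))"
    by (intro nn_integral_cong gabor_parseval_pair l operator_L2[OF A] gabor_L2)
  also have "\<dots> = ennreal (1 / \<bar>l\<bar>) * (ennreal (1 / \<bar>l\<bar>) * HS_norm_sq A)"
    by (subst nn_integral_cmult) (simp_all add: HS_frame[OF A fin gabor_L2 gabor_parseval_pair[OF l]])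
  also have "\<dots> = ennreal (1 / l\<^sup>2) * HS_norm_sq A"
    using l by (simp add: mult.assoc[symmetric] power2_eq_square flip: ennreal_mult)
  finally show ?thesis .
qed

lemma zero_operator_HS:
  assumes "zero_operator A" "bounded_operator A"
  shows "HS_norm_sq A = 0"
proof -
  have "L2_norm lborel (A (hs_basis n)) = 0" for n
    using assms(1) hs_basis_L2[of n] unfolding zero_operator_def
    by (subst L2_norm_eq_0_iff[OF operator_L2[OF assms(2) hs_basis_L2]]) blast
  then show ?thesis by (simp add: HS_norm_sq_eq)
qed

definition pt :: "int \<times> int \<Rightarrow> int \<Rightarrow> R3" where
  "pt k j = (of_int (fst k), of_int (snd k), of_int j)"

lemma rep3_pt: "rep3 l (pt k j) ubox = (\<lambda>t. ee (l * of_int j) * gabor l (of_int (fst k)) (of_int (snd k)) t)"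
  by (simp add: pt_def rep3_ubox fun_eq_iff)

context band
begin

text \<open>The central index j is summed first and, by the packing property, gives an L2 norm in l.
  The two Gabor lattices are then summed for fixed l. On S the factors (|l| c(l))^2 and 1 / l^2
  multiply to |l|, and the Plancherel isometry finishes.\<close>

lemma packet_frame:
  assumes pack: "packing S" and P: "has_plancherel_transform h T"
    and zero: "AE l in lborel. l \<notin> S \<longrightarrow> zero_operator (T l)"
  shows "(\<integral>\<^sup>+i. ennreal ((cmod (L2_inner haar h (lift (packet (pt (fst (snd i)) (snd (snd i))) (pt (fst i) 0)))))\<^sup>2)
      \<partial>count_space (UNIV :: ((int \<times> int) \<times> (int \<times> int) \<times> int) set)) = ennreal ((L2_norm haar h)\<^sup>2)"
proof -
  have T: "T \<in> HS_direct_integral" using P by (auto simp: has_plancherel_transform_def)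
  note Tp = pruned_weakly_measurable[OF T]
  have Tl: "bounded_operator (T l)" "HS_norm_sq (T l) < \<infinity>" if "l \<noteq> 0" for l
    using T that by (auto simp: HS_direct_integral_def hilbert_schmidt_def)
  let ?g = "\<lambda>l k. gabor l (of_int (fst k)) (of_int (snd k))"
  define W where "W m k l = of_real (\<bar>l\<bar> * cf l) * L2_inner lborel (pruned T l (?g l m)) (?g l k)" for m k :: "int \<times> int" and l
  have gj: "(\<lambda>(l, t). ?g l k t) \<in> borel_measurable (borel \<Otimes>\<^sub>M borel)" for k
    using rep3_ubox_joint[of "pt k 0"] unfolding rep3_pt by simp
  have [measurable]: "W m k \<in> borel_measurable borel" for m k
  proof -
    note measurable_operator_inner[OF Tp(1) gj[of k] gj[of m] gabor_L2 gabor_L2, measurable]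
    have eq: "W m k = (\<lambda>l. of_real (\<bar>l\<bar> * cf l) * (indicator (- {0}) l * L2_inner lborel (pruned T l (?g l m)) (?g l k)))"
      by (auto simp: W_def indicator_def fun_eq_iff)
    show ?thesis unfolding eq by measurable
  qed
  have WL: "W m k \<in> L2R" for m k
  proof (rule L2I_nn)
    have "(\<integral>\<^sup>+l. ennreal ((cmod (W m k l))\<^sup>2) \<partial>lborel) \<le> field_norm_sq (pruned T)"
      unfolding field_norm_sq_def
    proof (rule nn_integral_mono)
      fix l
      \<comment> \<open>On S the left side is |l|^3, which is at most |l| because S lies in
        [-1, 1].\<close>
      have "(\<bar>l\<bar> * cf l)\<^sup>2 \<le> \<bar>l\<bar>"
      proof (cases "l \<in> S")
        case True
        have "(\<bar>l\<bar> * cf l)\<^sup>2 = \<bar>l\<bar> * (\<bar>l\<bar> * (cf l * cf l))" by (simp add: power2_eq_square)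
        also have "cf l * cf l = \<bar>l\<bar>" using True by (simp add: cf_def)
        also have "\<bar>l\<bar> * (\<bar>l\<bar> * \<bar>l\<bar>) \<le> \<bar>l\<bar> * (1 * 1)"
        proof -
          have "\<bar>l\<bar> \<le> 1" using True S_sub by (auto simp: abs_le_iff)
          then show ?thesis by (intro mult_left_mono mult_mono) auto
        qed
        finally show ?thesis by simp
      qed (simp add: cf_def)
      have "ennreal ((cmod (W m k l))\<^sup>2) = ennreal ((\<bar>l\<bar> * cf l)\<^sup>2) * ennreal ((cmod (L2_inner lborel (pruned T l (?g l m)) (?g l k)))\<^sup>2)"
        by (simp only: W_def norm_mult norm_of_real power_mult_distrib power2_abs) (simp add: ennreal_mult)
      also have "\<dots> \<le> ennreal \<bar>l\<bar> * HS_norm_sq (pruned T l)"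
        by (intro mult_mono ennreal_leI operator_coeff_le Tp(2) gabor_L2 L2_norm_gabor) (use \<open>(\<bar>l\<bar> * cf l)\<^sup>2 \<le> \<bar>l\<bar>\<close> in auto)
      finally show "ennreal ((cmod (W m k l))\<^sup>2) \<le> HS_norm_sq (pruned T l) * ennreal \<bar>l\<bar>" by (simp add: mult.commute)
    qed
    also have "field_norm_sq (pruned T) = field_norm_sq T"
      by (rule field_norm_sq_cong) (simp add: pruned_def)
    also have "\<dots> < \<infinity>" using T by (simp add: HS_direct_integral_def)
    finally show "(\<integral>\<^sup>+l. ennreal ((cmod (W m k l))\<^sup>2) \<partial>lborel) < \<infinity>" .
  qed simp
  have W0: "W m k l = 0" if "l \<notin> S" for m k l using that by (simp add: W_def cf_def)
  have coeff: "L2_inner haar h (lift (packet (pt k j) (pt m 0))) = (LINT l|lborel. W m k l * ee (of_int (- j) * l))" for m k j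
    unfolding packet_inner[OF P]
  proof (rule Bochner_Integration.integral_cong[OF refl])
    fix l
    have "rep3 l (pt m 0) ubox = ?g l m" by (simp add: rep3_pt)
    then show "of_real (\<bar>l\<bar> * cf l) * L2_inner lborel (T l (rep3 l (pt m 0) ubox)) (rep3 l (pt k j) ubox)
      = W m k l * ee (of_int (- j) * l)"
      by (cases "l = 0") (simp_all add: W_def rep3_pt[of l k j] L2_inner_scale_right pruned_def mult_ac)
  qed
  have sum_j: "(\<integral>\<^sup>+j. ennreal ((cmod (L2_inner haar h (lift (packet (pt k j) (pt m 0)))))\<^sup>2) \<partial>count_space UNIV)
     = (\<integral>\<^sup>+l. ennreal ((cmod (W m k l))\<^sup>2) \<partial>lborel)" for m k
  proof -
    \<comment> \<open>Conjugation in the inner product reverses the frequency, so the sum over j is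
      reindexed by its sign.\<close>
    have "bij_betw (\<lambda>j::int. - j) UNIV UNIV" by (rule bij_betwI[where g="\<lambda>j. - j"]) auto
    from nn_integral_bij_count_space[OF this, of "\<lambda>j. ennreal ((cmod (LINT l|lborel. W m k l * ee (of_int j * l)))\<^sup>2)"]
    show ?thesis unfolding coeff using parseval_packing(2)[OF WL W0 pack] by simp
  qed
  have "(\<integral>\<^sup>+i. ennreal ((cmod (L2_inner haar h (lift (packet (pt (fst (snd i)) (snd (snd i))) (pt (fst i) 0)))))\<^sup>2)
      \<partial>count_space (UNIV :: ((int \<times> int) \<times> (int \<times> int) \<times> int) set))
    = (\<integral>\<^sup>+m. (\<integral>\<^sup>+k. (\<integral>\<^sup>+j. ennreal ((cmod (L2_inner haar h (lift (packet (pt k j) (pt m 0)))))\<^sup>2)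
        \<partial>count_space UNIV) \<partial>count_space UNIV) \<partial>count_space UNIV)"
    by (simp add: nn_integral_fst_count_space[symmetric])
  also have "\<dots> = (\<integral>\<^sup>+m. (\<integral>\<^sup>+k. (\<integral>\<^sup>+l. ennreal ((cmod (W m k l))\<^sup>2) \<partial>lborel)
      \<partial>count_space (UNIV :: (int \<times> int) set)) \<partial>count_space (UNIV :: (int \<times> int) set))"
    by (simp only: sum_j)
  also have "\<dots> = (\<integral>\<^sup>+m. (\<integral>\<^sup>+l. (\<integral>\<^sup>+k. ennreal ((cmod (W m k l))\<^sup>2) \<partial>count_space (UNIV :: (int \<times> int) set))
      \<partial>lborel) \<partial>count_space (UNIV :: (int \<times> int) set))"
    by (rule nn_integral_cong, rule nn_integral_count_space_nn_integral[symmetric]) auto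
  also have "\<dots> = (\<integral>\<^sup>+l. (\<integral>\<^sup>+m. (\<integral>\<^sup>+k. ennreal ((cmod (W m k l))\<^sup>2) \<partial>count_space (UNIV :: (int \<times> int) set))
      \<partial>count_space (UNIV :: (int \<times> int) set)) \<partial>lborel)"
  proof (rule nn_integral_count_space_nn_integral[symmetric])
    fix m
    \<comment> \<open>Enumerating the pairs writes the sum over k as a series of measurable
      functions, which settles measurability in l.\<close>
    have "bij int2_decode" by (rule bij_int2_decode)
    from nn_integral_bij_count_space[OF this, symmetric, of "\<lambda>k. ennreal ((cmod (W m k _))\<^sup>2)"]
    have "(\<integral>\<^sup>+k. ennreal ((cmod (W m k l))\<^sup>2) \<partial>count_space UNIV) = (\<Sum>n. ennreal ((cmod (W m (int2_decode n) l))\<^sup>2))" for l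
      unfolding nn_integral_count_space_nat .
    then show "(\<lambda>l. \<integral>\<^sup>+k. ennreal ((cmod (W m k l))\<^sup>2) \<partial>count_space (UNIV :: (int \<times> int) set)) \<in> borel_measurable lborel"
      by simp
  qed simp
  also have "\<dots> = (\<integral>\<^sup>+l. HS_norm_sq (T l) * ennreal \<bar>l\<bar> \<partial>lborel)"
  proof (rule nn_integral_cong_AE, use zero AE_lborel_singleton[of "0::real"] in eventually_elim)
    fix l assume z: "l \<notin> S \<longrightarrow> zero_operator (T l)" and l: "l \<noteq> 0"
    show "(\<integral>\<^sup>+m. (\<integral>\<^sup>+k. ennreal ((cmod (W m k l))\<^sup>2) \<partial>count_space (UNIV :: (int \<times> int) set))
      \<partial>count_space (UNIV :: (int \<times> int) set)) = HS_norm_sq (T l) * ennreal \<bar>l\<bar>"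
    proof (cases "l \<in> S")
      case False
      then show ?thesis using z zero_operator_HS[OF _ Tl(1)[OF l]] by (simp add: W0)
    next
      case True
      then have l1: "\<bar>l\<bar> \<le> 1" using S_sub by (auto simp: abs_le_iff)
      have "ennreal ((cmod (W m k l))\<^sup>2) = ennreal ((\<bar>l\<bar> * cf l)\<^sup>2) * ennreal ((cmod (L2_inner lborel (T l (?g l m)) (?g l k)))\<^sup>2)" for m k
        using l by (simp only: W_def norm_mult norm_of_real power_mult_distrib power2_abs pruned_def if_False) (simp add: ennreal_mult)
      then have "(\<integral>\<^sup>+m. (\<integral>\<^sup>+k. ennreal ((cmod (W m k l))\<^sup>2) \<partial>count_space (UNIV :: (int \<times> int) set))
          \<partial>count_space (UNIV :: (int \<times> int) set)) = ennreal ((\<bar>l\<bar> * cf l)\<^sup>2) * (ennreal (1 / l\<^sup>2) * HS_norm_sq (T l))"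
        by (simp add: nn_integral_cmult gabor_frame_operator[OF l l1 Tl[OF l]])
      also have "\<dots> = ennreal ((\<bar>l\<bar> * cf l)\<^sup>2 * (1 / l\<^sup>2)) * HS_norm_sq (T l)"
        by (subst ennreal_mult) (auto simp: mult.assoc)
      also have "(\<bar>l\<bar> * cf l)\<^sup>2 * (1 / l\<^sup>2) = \<bar>l\<bar>"
        using l True by (simp add: cf_def power_mult_distrib)
      finally show ?thesis by (simp add: mult.commute)
    qed
  qed
  also have "\<dots> = ennreal ((L2_norm haar h)\<^sup>2)"
    using plancherel_isometry[OF P] by (simp add: field_norm_sq_def)
  finally show ?thesis .
qed

lemma packet_spectral: "lift (packet u v) \<in> spectral_subspace S"
  unfolding spectral_subspace_def
proof (intro CollectI conjI exI)
  show "lift (packet u v) \<in> L2 haar" by (rule lift_L2[OF packet_L2])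
  show "has_plancherel_transform (lift (packet u v)) (field u v)" by (rule packet_plancherel)
  show "AE l in lborel. l \<notin> S \<longrightarrow> zero_operator (field u v l)"
    by (simp add: zero_operator_def field_def cf_def)
qed

text \<open>The representation is a unitary homomorphism, so the factor belonging to the inverse of
  u moves to the other side of the inner product as the factor of u.\<close>

lemma packet_translate: "packet (0, 0, 0) (0, 0, 0) (mul3 (mul3 (inv3 u) p) v) = packet u v p"
proof -
  have id: "rep3 l (0, 0, 0) \<phi> = \<phi>" for l \<phi> by (simp add: rep3_def)
  have "mcoeff (0, 0, 0) (0, 0, 0) (mul3 (mul3 (inv3 u) p) v) l = mcoeff u v p l" for l
    unfolding mcoeff_def id rep3_mul
    by (subst rep3_unitary[of l u, symmetric]) (simp add: rep3_inverse)
  then show ?thesis by (simp add: packet_def)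
qed

lemma biregular_packet:
  assumes "n \<in> heisenberg"
  shows "biregular (heis3 u, heis3 v) (lift (packet (0, 0, 0) (0, 0, 0))) n = lift (packet u v) n"
proof -
  obtain p where n: "n = heis3 p" using assms heisenberg_heis3 by blast
  show ?thesis
    by (simp add: n biregular_def left_translation_def right_translation_def heis3_inv heis3_mul packet_translate)
qed

end

text \<open>A biregular translate agrees with its packet only on the group, where Haar measure
  lives; this transfers membership from one to the other.\<close>

lemma spectral_subspace_cong:
  assumes f: "f \<in> spectral_subspace S" and eq: "\<And>n. n \<in> heisenberg \<Longrightarrow> f' n = f n"
  shows "f' \<in> spectral_subspace S"
proof -
  have m: "f' \<in> borel_measurable haar \<longleftrightarrow> f \<in> borel_measurable haar"
    by (rule measurable_cong) (simp add: space_haar eq)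
  have i: "integrable haar (\<lambda>x. (cmod (f' x))\<^sup>2) \<longleftrightarrow> integrable haar (\<lambda>x. (cmod (f x))\<^sup>2)"
    by (rule Bochner_Integration.integrable_cong) (simp_all add: space_haar eq)
  have L: "f' \<in> L2 haar \<longleftrightarrow> f \<in> L2 haar" using m i by (simp add: L2_def)
  have "L2_norm haar (\<lambda>n. g n - f' n) = L2_norm haar (\<lambda>n. g n - f n)" for g
    unfolding L2_norm_def by (intro arg_cong[where f=sqrt] Bochner_Integration.integral_cong) (simp_all add: space_haar eq)
  then have "has_plancherel_transform f' T \<longleftrightarrow> has_plancherel_transform f T" for T
    unfolding has_plancherel_transform_def L by simp
  then show ?thesis using f by (simp add: spectral_subspace_def L)
qed

text \<open>The components are nested in the order (m, (k, j)) of the iterated sums in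
  \<open>packet_frame\<close>: right lattice point, left lattice point, central index.\<close>

definition index_pair :: "(int \<times> int) \<times> (int \<times> int) \<times> int \<Rightarrow> (real^4^4) \<times> (real^4^4)" where
  "index_pair i = (heis3 (pt (fst (snd i)) (snd (snd i))), heis3 (pt (fst i) 0))"

lemma bij_index_pair: "bij_betw index_pair UNIV index_set"
proof (rule bij_betw_imageI)
  show "inj_on index_pair UNIV"
  proof (rule injI)
    fix i j assume "index_pair i = index_pair j"
    then have "coords (fst (index_pair i)) = coords (fst (index_pair j))" "coords (snd (index_pair i)) = coords (snd (index_pair j))"
      by simp_all
    then show "i = j" by (simp add: index_pair_def pt_def prod_eq_iff coords_def)
  qed
  show "range index_pair = index_set"
  proof
    show "range index_pair \<subseteq> index_set"
      unfolding index_set_def index_pair_def pt_def by force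
    show "index_set \<subseteq> range index_pair"
    proof
      fix x assume "x \<in> index_set"
      then obtain k1 k2 k3 m2 m3 where "x = index_pair ((m3, m2), (k3, k2), k1)"
        unfolding index_set_def index_pair_def pt_def by auto
      then show "x \<in> range index_pair" by simp
    qed
  qed
qed

theorem theorem1:
  fixes S :: "real set"
  assumes "S \<in> sets lebesgue"
    and "S \<subseteq> - {0}"
    and "translation_congruent S {0<..1}"
    and "S \<subseteq> {-1..1}"
  shows "\<exists>f\<in>spectral_subspace S.
           parseval_frame haar (spectral_subspace S) index_set (\<lambda>\<gamma>. biregular \<gamma> f) \<and>
           (L2_norm haar f)\<^sup>2 \<le> 2 / 3"
proof -
  \<comment> \<open>A Borel subset of S that differs from it by a null set. The spectral subspace is
    unchanged, and packing passes to subsets.\<close>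
  define S0 where "S0 = main_part lborel S"
  have S0: "S0 \<in> sets borel" using main_part_sets[of S lborel] assms(1) by (simp add: S0_def)
  have S0S: "S0 \<subseteq> S" using main_part_null_part_Un[OF assms(1)] by (auto simp: S0_def)
  have same: "AE l in lborel. l \<in> S0 \<longleftrightarrow> l \<in> S"
    unfolding S0_def using AE_in_main_part[OF assms(1)] by auto
  interpret band S0
    by unfold_locales (use S0 S0S assms in auto)
  have "packing S" by (rule packing_congruent[OF assms(3)])
  then have pack: "packing S0" unfolding packing_def by eventually_elim (use S0S in blast)
  have spec: "spectral_subspace S = spectral_subspace S0"
  proof -
    have "(AE l in lborel. l \<notin> S \<longrightarrow> zero_operator (T l)) \<longleftrightarrow> (AE l in lborel. l \<notin> S0 \<longrightarrow> zero_operator (T l))" for T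
    proof
      assume "AE l in lborel. l \<notin> S \<longrightarrow> zero_operator (T l)"
      with same show "AE l in lborel. l \<notin> S0 \<longrightarrow> zero_operator (T l)" by eventually_elim blast
    next
      assume "AE l in lborel. l \<notin> S0 \<longrightarrow> zero_operator (T l)"
      with same show "AE l in lborel. l \<notin> S \<longrightarrow> zero_operator (T l)" by eventually_elim blast
    qed
    then show ?thesis by (simp add: spectral_subspace_def)
  qed
  define f where "f = lift (packet (0, 0, 0) (0, 0, 0))"
  have trans: "biregular (index_pair i) f n = lift (packet (pt (fst (snd i)) (snd (snd i))) (pt (fst i) 0)) n"
    if "n \<in> heisenberg" for i n
    unfolding index_pair_def f_def by (rule biregular_packet[OF that])
  have mem: "biregular \<gamma> f \<in> spectral_subspace S0" if "\<gamma> \<in> index_set" for \<gamma>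
  proof -
    have "\<gamma> \<in> range index_pair" using that bij_index_pair by (simp add: bij_betw_def)
    then obtain i where "\<gamma> = index_pair i" by (rule rangeE)
    then show ?thesis using spectral_subspace_cong[OF packet_spectral trans] by simp
  qed
  have parseval: "((\<lambda>\<gamma>. (cmod (L2_inner haar h (biregular \<gamma> f)))\<^sup>2) has_sum (L2_norm haar h)\<^sup>2) index_set"
    if h: "h \<in> spectral_subspace S0" for h
  proof -
    obtain T where T: "has_plancherel_transform h T" "AE l in lborel. l \<notin> S0 \<longrightarrow> zero_operator (T l)"
      using h unfolding spectral_subspace_def by blast
    have "L2_inner haar h (biregular (index_pair i) f) = L2_inner haar h (lift (packet (pt (fst (snd i)) (snd (snd i))) (pt (fst i) 0)))" for i
      unfolding L2_inner_def by (intro Bochner_Integration.integral_cong) (simp_all add: space_haar trans)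
    then have "((\<lambda>i. (cmod (L2_inner haar h (biregular (index_pair i) f)))\<^sup>2) has_sum (L2_norm haar h)\<^sup>2) UNIV"
      using packet_frame[OF pack T] by (intro has_sum_of_nn_integral) auto
    then show ?thesis
      using has_sum_reindex_bij_betw[OF bij_index_pair, of "\<lambda>\<gamma>. (cmod (L2_inner haar h (biregular \<gamma> f)))\<^sup>2"] by simp
  qed
  have "countable index_set"
    using bij_index_pair countable_image[of UNIV index_pair] by (simp add: bij_betw_def)
  moreover have "(L2_norm haar f)\<^sup>2 \<le> 2 / 3"
    unfolding f_def using packet_norm_le by (subst L2_norm_haar) (auto intro: lift_measurable)
  moreover have "f \<in> spectral_subspace S0" unfolding f_def by (rule packet_spectral)
  ultimately show ?thesis
    unfolding spec parseval_frame_def using mem parseval by blast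
qed

end
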